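(* Let $n\ge2$, let $1\le k\le n$ be an integer and let $p>1$. Assume $u$ is a positive, smooth, strictly convex solution on $\mathbb{S}^n$ of $$\sigma_k(D^2u+ug_{\mathbb{S}^n})=u^{p-1}.$$ Then $u\equiv$ constant.
   Context: $D$ and $g_{\mathbb{S}^n}$ are the Levi-Civita connection and standard metric of $\mathbb{S}^n$; $\sigma_k$ of a symmetric matrix is the $k$-th elementary symmetric function of its eigenvalues. Strict convexity of $u$ means that the matrix $[u_{ij}+u\delta_{ij}]$ (orthonormal frame) is positive definite on $\mathbb{S}^n$. *)

theory Defs
  imports "HOL-Analysis.Analysis" "Jordan_Normal_Form.Char_Poly"
begin

no_notation scalar_prod (infix \<open>\<bullet>\<close> 70)

section \<open>Calculus on the unit sphere\<close>

text \<open>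
  The sphere \<open>S\<^sup>n\<close> is \<open>sphere 0 1\<close> in a Euclidean space of dimension \<open>n + 1\<close>, with the induced
  metric; its tangent space at \<open>x\<close> is the orthogonal complement of \<open>x\<close>.  Functions and vector
  fields on the sphere are functions on the ambient space of which only the values on the
  sphere are ever used.
\<close>

text \<open>Meant for open \<open>U\<close> only.\<close>

primrec Ck_on :: "nat \<Rightarrow> 'a::euclidean_space set \<Rightarrow> ('a \<Rightarrow> real) \<Rightarrow> bool" where
  "Ck_on 0 U f \<longleftrightarrow> continuous_on U f"
| "Ck_on (Suc k) U f \<longleftrightarrow>
     f differentiable_on U \<and> (\<forall>b\<in>Basis. Ck_on k U (\<lambda>x. frechet_derivative f (at x) b))"

definition smooth_on_sphere :: "('a::euclidean_space \<Rightarrow> real) \<Rightarrow> bool" where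
  "smooth_on_sphere u \<longleftrightarrow>
     (\<forall>x\<in>sphere 0 1. \<exists>U F. open U \<and> x \<in> U \<and> (\<forall>k. Ck_on k U F) \<and>
        (\<forall>y\<in>U \<inter> sphere 0 1. F y = u y))"

text \<open>
  The differential at a point \<open>x\<close> of the sphere. Composing with the retraction
  \<open>sgn y = y /\<^sub>R norm y\<close> makes it depend only on the values of \<open>f\<close> on the sphere; the
  derivative of \<open>sgn\<close> at \<open>x\<close> is the orthogonal projection onto the tangent space, so this is the
  usual differential on tangent vectors and it vanishes on the normal direction \<open>x\<close>.
\<close>

definition sphere_deriv ::
    "('a::euclidean_space \<Rightarrow> 'b::real_normed_vector) \<Rightarrow> 'a \<Rightarrow> 'a \<Rightarrow> 'b" where
  "sphere_deriv f x v = frechet_derivative (\<lambda>y. f (sgn y)) (at x) v"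

definition tangent_proj :: "'a::euclidean_space \<Rightarrow> 'a \<Rightarrow> 'a" where
  "tangent_proj x w = w - (w \<bullet> x) *\<^sub>R x"

text \<open>
  The Levi-Civita connection \<open>D\<^sub>v Y\<close> at \<open>x\<close> of the induced metric is the tangential part of the
  Euclidean derivative; that it is compatible with the metric and torsion-free is proved below.
\<close>

definition levi_civita :: "'a::euclidean_space \<Rightarrow> 'a \<Rightarrow> ('a \<Rightarrow> 'a) \<Rightarrow> 'a" where
  "levi_civita x v Y = tangent_proj x (sphere_deriv Y x v)"

text \<open>The tangent vector representing the differential with respect to the metric.\<close>

definition sphere_grad :: "('a::euclidean_space \<Rightarrow> real) \<Rightarrow> 'a \<Rightarrow> 'a" where
  "sphere_grad u x = (\<Sum>b\<in>Basis. sphere_deriv u x b *\<^sub>R b)"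

text \<open>\<open>(D\<^sup>2u)(v, w) = \<langle>D\<^sub>v (grad u), w\<rangle>\<close> for \<open>v\<close>, \<open>w\<close> tangent at \<open>x\<close>.\<close>

definition sphere_hessian :: "('a::euclidean_space \<Rightarrow> real) \<Rightarrow> 'a \<Rightarrow> 'a \<Rightarrow> 'a \<Rightarrow> real" where
  "sphere_hessian u x v w = levi_civita x v (sphere_grad u) \<bullet> w"

definition orthonormal_frame :: "nat \<Rightarrow> 'a::euclidean_space \<Rightarrow> (nat \<Rightarrow> 'a) \<Rightarrow> bool" where
  "orthonormal_frame n x e \<longleftrightarrow>
     (\<forall>i<n. e i \<bullet> x = 0) \<and> (\<forall>i<n. \<forall>j<n. e i \<bullet> e j = (if i = j then 1 else 0))"

text \<open>The matrix of the bilinear form \<open>D\<^sup>2u + u g\<close> at \<open>x\<close> in the frame \<open>e\<close>.\<close>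

definition hessian_plus_mat ::
    "nat \<Rightarrow> ('a::euclidean_space \<Rightarrow> real) \<Rightarrow> 'a \<Rightarrow> (nat \<Rightarrow> 'a) \<Rightarrow> real mat" where
  "hessian_plus_mat n u x e =
     Matrix.mat n n (\<lambda>(i, j). sphere_hessian u x (e i) (e j) + u x * (e i \<bullet> e j))"

section \<open>Symmetric functions of eigenvalues\<close>

definition elem_sym :: "nat \<Rightarrow> real list \<Rightarrow> real" where
  "elem_sym k xs = (\<Sum>S | S \<subseteq> {..<length xs} \<and> card S = k. \<Prod>i\<in>S. xs ! i)"

text \<open>
  Only real eigenvalues, listed with multiplicity.  For a symmetric matrix these are all the
  eigenvalues.
\<close>

definition eigenvalue_list :: "real mat \<Rightarrow> real list" where
  "eigenvalue_list A = sorted_list_of_multiset (proots (char_poly A))"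

definition sigma_mat :: "nat \<Rightarrow> real mat \<Rightarrow> real" where
  "sigma_mat k A = elem_sym k (eigenvalue_list A)"

definition positive_definite :: "real mat \<Rightarrow> bool" where
  "positive_definite A \<longleftrightarrow>
     (\<forall>c\<in>carrier_vec (dim_row A). c \<noteq> 0\<^sub>v (dim_row A) \<longrightarrow> scalar_prod c (A *\<^sub>v c) > 0)"

definition strictly_convex_on_sphere :: "nat \<Rightarrow> ('a::euclidean_space \<Rightarrow> real) \<Rightarrow> bool" where
  "strictly_convex_on_sphere n u \<longleftrightarrow>
     (\<forall>x\<in>sphere 0 1. \<forall>e. orthonormal_frame n x e \<longrightarrow>
        positive_definite (hessian_plus_mat n u x e))"

section \<open>Characterisation of the connection and the gradient\<close>

lemma sgn_sphere: "x \<in> sphere 0 1 \<Longrightarrow> sgn x = (x::'a::euclidean_space)"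
  by (simp add: sgn_div_norm)

lemma has_derivative_sgn_sphere:
  fixes x :: "'a::euclidean_space"
  assumes "x \<in> sphere 0 1"
  shows "(sgn has_derivative tangent_proj x) (at x)"
proof -
  have n: "norm x = 1" "x \<noteq> 0" "x \<bullet> x = 1"
    using assms by (auto simp: dot_square_norm)
  have "(norm has_derivative (\<lambda>h. h \<bullet> x)) (at x)"
    using has_derivative_norm[OF \<open>x \<noteq> 0\<close>] by (simp add: sgn_div_norm n)
  then have "((\<lambda>y. inverse (norm y) *\<^sub>R y) has_derivative tangent_proj x) (at x)"
    using n by (auto intro!: derivative_eq_intros simp: tangent_proj_def)
  then show ?thesis
    by (simp add: sgn_div_norm[abs_def])
qed

lemma sphere_deriv_eq:
  fixes f :: "'a::euclidean_space \<Rightarrow> 'b::real_normed_vector"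
  assumes x: "x \<in> sphere 0 1" and f: "(f has_derivative f') (at x)"
  shows "sphere_deriv f x v = f' (tangent_proj x v)"
proof -
  have "((\<lambda>y. f (sgn y)) has_derivative (\<lambda>v. f' (tangent_proj x v))) (at x)"
    using has_derivative_compose[OF has_derivative_sgn_sphere[OF x], of f f']
      f sgn_sphere[OF x] by simp
  then show ?thesis
    by (simp add: sphere_deriv_def frechet_derivative_at[symmetric])
qed

lemma sphere_deriv_normal:
  fixes f :: "'a::euclidean_space \<Rightarrow> 'b::real_normed_vector"
  assumes x: "x \<in> sphere 0 1" and f: "(\<lambda>y. f (sgn y)) differentiable (at x)"
  shows "sphere_deriv f x x = 0"
proof -
  let ?g = "\<lambda>y. f (sgn y)"
  have xx: "x \<bullet> x = 1" using x by (simp add: dot_square_norm)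
  have g: "(?g has_derivative sphere_deriv f x) (at x)"
    using f by (simp add: sphere_deriv_def[abs_def] frechet_derivative_works)
  have "sphere_deriv ?g x x = sphere_deriv f x (tangent_proj x x)"
    by (rule sphere_deriv_eq[OF x g])
  moreover have "sgn (sgn y) = sgn y" for y :: 'a
    by (cases "y = 0") (simp_all add: sgn_div_norm)
  then have "sphere_deriv ?g x x = sphere_deriv f x x"
    by (simp add: sphere_deriv_def)
  ultimately show ?thesis
    using xx linear_0[OF has_derivative_linear[OF g]] by (simp add: tangent_proj_def)
qed

lemma sphere_grad:
  fixes u :: "'a::euclidean_space \<Rightarrow> real"
  assumes x: "x \<in> sphere 0 1" and u: "(\<lambda>y. u (sgn y)) differentiable (at x)"
  shows "sphere_grad u x \<bullet> v = sphere_deriv u x v" and "sphere_grad u x \<bullet> x = 0"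
proof -
  have "linear (sphere_deriv u x)"
    using u by (simp add: sphere_deriv_def[abs_def] frechet_derivative_works has_derivative_linear)
  then have lin: "sphere_deriv u x w = (\<Sum>b\<in>Basis. (w \<bullet> b) * sphere_deriv u x b)" for w
    using linear_sum[of "sphere_deriv u x" "\<lambda>b. (w \<bullet> b) *\<^sub>R b" Basis]
    by (simp only: euclidean_representation linear_cmul real_scaleR_def)
  have grad: "sphere_grad u x \<bullet> w = sphere_deriv u x w" for w
    unfolding lin[of w] by (simp add: sphere_grad_def inner_sum_left inner_commute[of w] mult.commute)
  show "sphere_grad u x \<bullet> v = sphere_deriv u x v"
    by (rule grad)
  show "sphere_grad u x \<bullet> x = 0"
    by (simp add: grad sphere_deriv_normal[OF x u])
qed

lemma levi_civita_metric:
  fixes Y Z :: "'a::euclidean_space \<Rightarrow> 'a"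
  assumes x: "x \<in> sphere 0 1"
    and Y: "(\<lambda>y. Y (sgn y)) differentiable (at x)" "Y x \<bullet> x = 0"
    and Z: "(\<lambda>y. Z (sgn y)) differentiable (at x)" "Z x \<bullet> x = 0"
  shows "sphere_deriv (\<lambda>y. Y y \<bullet> Z y) x v =
           levi_civita x v Y \<bullet> Z x + Y x \<bullet> levi_civita x v Z"
proof -
  have "((\<lambda>y. Y (sgn y)) has_derivative sphere_deriv Y x) (at x)"
       "((\<lambda>y. Z (sgn y)) has_derivative sphere_deriv Z x) (at x)"
    using Y Z by (simp_all add: sphere_deriv_def[abs_def] frechet_derivative_works)
  from has_derivative_inner[OF this]
  have "sphere_deriv (\<lambda>y. Y y \<bullet> Z y) x v =
          Y x \<bullet> sphere_deriv Z x v + sphere_deriv Y x v \<bullet> Z x"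
    by (simp add: sphere_deriv_def[of "\<lambda>y. Y y \<bullet> Z y"] frechet_derivative_at[symmetric] sgn_sphere[OF x])
  then show ?thesis
    using Y(2) Z(2)
    by (simp add: levi_civita_def tangent_proj_def inner_diff_left inner_diff_right inner_commute)
qed

text \<open>The right-hand side is the Lie bracket of the tangent vector fields \<open>X\<close> and \<open>Y\<close>.\<close>

lemma levi_civita_torsion_free:
  fixes X Y :: "'a::euclidean_space \<Rightarrow> 'a"
  assumes x: "x \<in> sphere 0 1"
    and X: "(\<lambda>y. X (sgn y)) differentiable (at x)" "\<forall>y\<in>sphere 0 1. X y \<bullet> y = 0"
    and Y: "(\<lambda>y. Y (sgn y)) differentiable (at x)" "\<forall>y\<in>sphere 0 1. Y y \<bullet> y = 0"
  shows "levi_civita x (X x) Y - levi_civita x (Y x) X =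
           sphere_deriv Y x (X x) - sphere_deriv X x (Y x)"
proof -
  have normal: "sphere_deriv W x v \<bullet> x = - (W x \<bullet> v)"
    if W: "(\<lambda>y. W (sgn y)) differentiable (at x)" "\<forall>y\<in>sphere 0 1. W y \<bullet> y = 0"
      and v: "v \<bullet> x = 0" for W :: "'a \<Rightarrow> 'a" and v
  proof -
    have "((\<lambda>y. W (sgn y)) has_derivative sphere_deriv W x) (at x)"
      using W by (simp add: sphere_deriv_def[abs_def] frechet_derivative_works)
    from has_derivative_inner[OF this has_derivative_sgn_sphere[OF x]]
    have d: "((\<lambda>y. W (sgn y) \<bullet> sgn y) has_derivative
            (\<lambda>v. W x \<bullet> tangent_proj x v + sphere_deriv W x v \<bullet> x)) (at x)"
      by (simp add: sgn_sphere[OF x])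
    have "W (sgn y) \<bullet> sgn y = 0" for y
      using W(2) by (cases "y = 0") (auto simp: norm_sgn)
    then have "((\<lambda>y. 0 :: real) has_derivative
            (\<lambda>v. W x \<bullet> tangent_proj x v + sphere_deriv W x v \<bullet> x)) (at x)"
      using d by simp
    from has_derivative_unique[OF this has_derivative_const]
    have "W x \<bullet> tangent_proj x v + sphere_deriv W x v \<bullet> x = 0"
      by (rule fun_cong)
    then show ?thesis
      using v by (simp add: tangent_proj_def)
  qed
  have "X x \<bullet> x = 0" "Y x \<bullet> x = 0"
    using x X(2) Y(2) by auto
  then have "sphere_deriv Y x (X x) \<bullet> x = sphere_deriv X x (Y x) \<bullet> x"
    using normal[OF X] normal[OF Y] by (simp add: inner_commute)
  then show ?thesis
    by (simp add: levi_civita_def tangent_proj_def)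
qed

end

theory Submission
  imports Defs
begin

text \<open>
  Let \<open>K\<close> be the convex body with support function \<open>u\<close>, let \<open>X = u x + grad u\<close> be its inverse
  Gauss map and let \<open>r\<^sub>1, \<dots>, r\<^sub>n\<close> be the eigenvalues of \<open>D\<^sup>2u + u g\<close>, the principal radii of
  curvature; \<open>\<sigma>\<^sub>k\<close> is their elementary symmetric function and integrals are over the sphere.

  The Laplacian of \<open>u\<^sup>p\<close> has integral zero, and the Laplacian of \<open>u\<close> is \<open>\<sigma>\<^sub>1 - n u\<close>.  With
  \<open>\<sigma>\<^sub>k = u\<^bsup>p-1\<^esup>\<close> this gives
  \<open>\<integral> \<sigma>\<^sub>1 \<sigma>\<^sub>k = n \<integral> u \<sigma>\<^sub>k - (p - 1) \<integral> u\<^bsup>p-2\<^esup> \<bar>grad u\<bar>\<^sup>2\<close>.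
  Every strictly convex body satisfies \<open>n \<integral> u \<sigma>\<^sub>k \<le> \<integral> \<sigma>\<^sub>1 \<sigma>\<^sub>k\<close> (\<open>sigma_1_sigma_ge\<close>).  As \<open>p > 1\<close>, the
  gradient vanishes (\<open>sphere_grad_eq_0\<close>), so \<open>u\<close> is constant.

  For \<open>k < n\<close> the inequality follows from the Minkowski formula
  \<open>(n - k) \<integral> u \<sigma>\<^sub>k = (k + 1) \<integral> \<sigma>\<^bsub>k+1\<^esub>\<close> (\<open>minkowski_formula\<close>) and the pointwise Newton--Maclaurin
  inequality \<open>n (k + 1) \<sigma>\<^bsub>k+1\<^esub> \<le> (n - k) \<sigma>\<^sub>1 \<sigma>\<^sub>k\<close> (\<open>newton_maclaurin\<close>).  For \<open>k = n\<close> it is a form of the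
  Heintze--Karcher inequality, \<open>\<integral> u \<sigma>\<^sub>n \<le> \<integral> (\<sigma>\<^sub>1 / n) \<sigma>\<^sub>n\<close> (\<open>heintze_karcher\<close>).

  Both integral statements come from the change of variables formula, without integration by
  parts.  The map \<open>y \<mapsto> \<bar>y\<bar> X(y)\<close> of the unit ball onto \<open>K\<close> shows that the volume of the parallel
  body \<open>K\<^sub>t\<close>, with support function \<open>u + t\<close>, is a polynomial in \<open>t\<close> whose coefficients are sums of
  the integrals of \<open>u \<sigma>\<^sub>j\<close> and \<open>\<sigma>\<^sub>j\<close>.  The normal tube around \<open>K\<^sub>t\<close> computes its derivative, and
  comparing coefficients gives all Minkowski formulas.  For the Heintze--Karcher inequality, each
  point of \<open>K\<close> lies on an inner normal, not beyond the first focal point of this normal; up to a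
  null set this covers \<open>K\<close> by an image whose Jacobian is at most \<open>(\<sigma>\<^sub>1 / n) \<sigma>\<^sub>n\<close>, by the inequality
  between the means.  Bijectivity of the first two maps and the covering property of the third
  are all obtained by looking at a maximum of \<open>z \<bullet> x - u x\<close> or of \<open>(z \<bullet> x) / u x\<close> over the
  sphere.  Finally, the vanishing of the integral of a Laplacian is the Minkowski formula for
  \<open>k = 0\<close> and the convex function \<open>u\<^sup>p + C\<close> with a large constant \<open>C\<close>.
\<close>

section \<open>Elementary symmetric functions\<close>

text \<open>The elementary symmetric function of degree \<open>k\<close> of the numbers \<open>r i\<close>, \<open>i \<in> N\<close>.\<close>

definition esym :: "nat \<Rightarrow> ('i \<Rightarrow> real) \<Rightarrow> 'i set \<Rightarrow> real" where
  "esym k r N = (\<Sum>S | S \<subseteq> N \<and> card S = k. \<Prod>i\<in>S. r i)"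

lemma esym_0: "finite N \<Longrightarrow> esym 0 r N = 1"
proof -
  assume N: "finite N"
  have "{S. S \<subseteq> N \<and> card S = 0} = {{}}"
    using N by (auto dest: finite_subset)
  then show ?thesis by (simp add: esym_def)
qed

lemma esym_1: "finite N \<Longrightarrow> esym 1 r N = sum r N"
proof -
  assume N: "finite N"
  have "{S. S \<subseteq> N \<and> card S = 1} = (\<lambda>i. {i}) ` N"
    by (auto simp: card_Suc_eq)
  then show ?thesis by (simp add: esym_def sum.reindex)
qed

lemma esym_card: "finite N \<Longrightarrow> esym (card N) r N = prod r N"
proof -
  assume N: "finite N"
  have "{S. S \<subseteq> N \<and> card S = card N} = {N}"
    using N by (auto dest: card_subset_eq)
  then show ?thesis by (simp add: esym_def)
qed

lemma esym_nonneg: "(\<And>i. i \<in> N \<Longrightarrow> r i \<ge> 0) \<Longrightarrow> esym k r N \<ge> 0"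
  unfolding esym_def by (intro sum_nonneg prod_nonneg) auto

lemma esym_cong: "(\<And>i. i \<in> N \<Longrightarrow> r i = q i) \<Longrightarrow> esym k r N = esym k q N"
  unfolding esym_def by (intro sum.cong refl prod.cong) auto

lemma esym_image:
  assumes "bij_betw f M N"
  shows "esym k r N = esym k (r \<circ> f) M"
proof -
  have inj: "inj_on f M" and N: "N = f ` M"
    using assms by (auto simp: bij_betw_def)
  have "{S. S \<subseteq> N \<and> card S = k} = image f ` {S. S \<subseteq> M \<and> card S = k}"
    unfolding N by (auto simp: subset_image_iff card_image inj_on_subset[OF inj])
  moreover have "inj_on (image f) {S. S \<subseteq> M \<and> card S = k}"
    by (rule inj_on_subset[OF inj_on_image_Pow[OF inj]]) auto
  ultimately have "esym k r N = (\<Sum>S | S \<subseteq> M \<and> card S = k. \<Prod>i\<in>f ` S. r i)"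
    by (simp add: esym_def sum.reindex)
  also have "\<dots> = esym k (r \<circ> f) M"
    unfolding esym_def
    by (intro sum.cong refl) (auto simp: prod.reindex inj_on_subset[OF inj])
  finally show ?thesis .
qed

lemma prod_add_eq_esym:
  fixes t :: real
  assumes N: "finite N"
  shows "(\<Prod>i\<in>N. r i + t) = (\<Sum>j\<le>card N. esym j r N * t ^ (card N - j))"
proof -
  have "(\<Prod>i\<in>N. r i + t) = (\<Sum>S\<in>Pow N. prod r S * t ^ (card N - card S))"
    unfolding prod_add[OF N] using N
    by (intro sum.cong refl) (auto simp: card_Diff_subset finite_subset)
  also have "\<dots> = (\<Sum>j\<le>card N. \<Sum>S | S \<in> Pow N \<and> card S = j. prod r S * t ^ (card N - card S))"
    using N by (intro sum.group[symmetric]) (auto intro: card_mono)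
  also have "\<dots> = (\<Sum>j\<le>card N. esym j r N * t ^ (card N - j))"
    by (intro sum.cong refl) (auto simp: esym_def sum_distrib_right)
  finally show ?thesis .
qed

lemma esym_Suc_insert:
  assumes N: "finite N" and i: "i \<notin> N"
  shows "esym (Suc k) r (insert i N) = esym (Suc k) r N + r i * esym k r N"
proof -
  let ?A = "{S. S \<subseteq> N \<and> card S = Suc k}" and ?B = "{S. S \<subseteq> N \<and> card S = k}"
  have fin: "finite S" if "S \<subseteq> N" for S using that N finite_subset by blast
  have eq: "{S. S \<subseteq> insert i N \<and> card S = Suc k} = ?A \<union> insert i ` ?B"
  proof (intro Set.set_eqI iffI)
    fix S assume S: "S \<in> {S. S \<subseteq> insert i N \<and> card S = Suc k}"
    show "S \<in> ?A \<union> insert i ` ?B"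
    proof (cases "i \<in> S")
      case True
      then have "S - {i} \<in> ?B" "S = insert i (S - {i})" using S by auto
      then show ?thesis by blast
    next
      case False
      then show ?thesis using S by auto
    qed
  next
    fix S assume "S \<in> ?A \<union> insert i ` ?B"
    then show "S \<in> {S. S \<subseteq> insert i N \<and> card S = Suc k}"
    proof
      assume "S \<in> insert i ` ?B"
      then obtain T where T: "T \<subseteq> N" "card T = k" "S = insert i T" by auto
      moreover have "i \<notin> T" using T i by auto
      ultimately show ?thesis using fin[of T] by auto
    qed auto
  qed
  have dis: "?A \<inter> insert i ` ?B = {}" using i by auto
  have inj: "inj_on (insert i) ?B"
  proof (rule inj_onI)
    fix S T assume "S \<in> ?B" "T \<in> ?B" "insert i S = insert i T"
    then show "S = T" using i by (metis (no_types, lifting) insert_ident mem_Collect_eq subset_iff)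
  qed
  have "esym (Suc k) r (insert i N) = sum (prod r) ?A + sum (prod r) (insert i ` ?B)"
    unfolding esym_def eq using N dis by (intro sum.union_disjoint) auto
  also have "sum (prod r) (insert i ` ?B) = (\<Sum>S\<in>?B. r i * prod r S)"
    unfolding sum.reindex[OF inj] o_def
  proof (rule sum.cong[OF refl])
    fix S assume "S \<in> ?B"
    then have "finite S" "i \<notin> S" using fin i by auto
    then show "prod r (insert i S) = r i * prod r S" by simp
  qed
  finally show ?thesis by (simp add: esym_def sum_distrib_left)
qed

lemma esym_Suc_remove:
  "finite N \<Longrightarrow> i \<in> N \<Longrightarrow>
     esym (Suc k) r N = esym (Suc k) r (N - {i}) + r i * esym k r (N - {i})"
  using esym_Suc_insert[of "N - {i}" i k r] by (simp add: insert_absorb)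

lemma sum_esym_remove:
  assumes N: "finite N"
  shows "(\<Sum>i\<in>N. esym k r (N - {i})) = (real (card N) - k) * esym k r N"
proof -
  have fin: "finite {S. S \<subseteq> N \<and> card S = k}" using N by auto
  have "(\<Sum>i\<in>N. esym k r (N - {i}))
      = (\<Sum>i\<in>N. \<Sum>S | S \<subseteq> N \<and> card S = k. if i \<in> S then 0 else prod r S)"
  proof (rule sum.cong[OF refl])
    fix i assume "i \<in> N"
    have "esym k r (N - {i}) = (\<Sum>S \<in> {S. S \<subseteq> N \<and> card S = k} \<inter> {S. i \<notin> S}. prod r S)"
      unfolding esym_def by (rule sum.cong) auto
    also have "\<dots> = (\<Sum>S | S \<subseteq> N \<and> card S = k. if i \<in> S then 0 else prod r S)"
      unfolding sum.inter_restrict[OF fin] by (intro sum.cong) auto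
    finally show "esym k r (N - {i}) = (\<Sum>S | S \<subseteq> N \<and> card S = k. if i \<in> S then 0 else prod r S)" .
  qed
  also have "\<dots> = (\<Sum>S | S \<subseteq> N \<and> card S = k. \<Sum>i\<in>N. if i \<in> S then 0 else prod r S)"
    by (rule sum.swap)
  also have "\<dots> = (\<Sum>S | S \<subseteq> N \<and> card S = k. (real (card N) - k) * prod r S)"
  proof (rule sum.cong[OF refl])
    fix S assume S: "S \<in> {S. S \<subseteq> N \<and> card S = k}"
    have "(\<Sum>i\<in>N. if i \<in> S then 0 else prod r S) = (\<Sum>i\<in>N - S. prod r S)"
      using N by (intro sum.mono_neutral_cong_right) auto
    also have "\<dots> = (real (card N) - k) * prod r S"
      using S N by (auto simp: card_Diff_subset finite_subset of_nat_diff card_mono)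
    finally show "(\<Sum>i\<in>N. if i \<in> S then 0 else prod r S) = (real (card N) - k) * prod r S" .
  qed
  finally show ?thesis by (simp add: esym_def sum_distrib_left)
qed

lemma sum_mult_esym_remove:
  assumes N: "finite N"
  shows "(\<Sum>i\<in>N. r i * esym k r (N - {i})) = (real k + 1) * esym (Suc k) r N"
proof -
  have "(\<Sum>i\<in>N. r i * esym k r (N - {i})) = (\<Sum>i\<in>N. esym (Suc k) r N - esym (Suc k) r (N - {i}))"
    using esym_Suc_remove[OF N] by (intro sum.cong) auto
  also have "\<dots> = real (card N) * esym (Suc k) r N - (real (card N) - Suc k) * esym (Suc k) r N"
    unfolding sum_subtractf sum_esym_remove[OF N] by simp
  finally show ?thesis by (simp add: algebra_simps)
qed

text \<open>
  In terms of the normalised functions \<open>E\<^sub>k = \<sigma>\<^sub>k / (n choose k)\<close> this is \<open>E\<^sub>1 E\<^sub>k \<ge> E\<^bsub>k+1\<^esub>\<close>.  It is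
  Chebyshev's sum inequality: \<open>\<sigma>\<^sub>k\<close> of the numbers other than \<open>r i\<close> decreases as \<open>r i\<close> increases.
\<close>

lemma newton_maclaurin:
  fixes r :: "'i \<Rightarrow> real"
  assumes N: "finite N" and pos: "\<And>i. i \<in> N \<Longrightarrow> r i \<ge> 0"
  shows "real (card N) * (real k + 1) * esym (Suc k) r N \<le> (real (card N) - k) * (sum r N * esym k r N)"
proof -
  define b where "b i = esym k r (N - {i})" for i
  have anti: "(r i - r j) * (b i - b j) \<le> 0" if ij: "i \<in> N" "j \<in> N" for i j
  proof (cases "i = j \<or> k = 0")
    case True
    then show ?thesis using N by (auto simp: b_def esym_0)
  next
    case False
    then obtain l where l: "k = Suc l" and ne: "i \<noteq> j" by (cases k) auto
    have sub: "N - {i} - {j} = N - {j} - {i}" by auto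
    have "b i - b j = - (r i - r j) * esym l r (N - {i} - {j})"
      unfolding b_def l using esym_Suc_remove[of "N - {i}" j l r] esym_Suc_remove[of "N - {j}" i l r]
        N ij ne by (simp add: algebra_simps sub)
    then have "(r i - r j) * (b i - b j) = (r i - r j) * (- (r i - r j) * esym l r (N - {i} - {j}))"
      by (simp only:)
    also have "\<dots> = - ((r i - r j)^2 * esym l r (N - {i} - {j}))"
      by (simp only: power2_eq_square) algebra
    also have "\<dots> \<le> 0"
      using esym_nonneg[of "N - {i} - {j}" r l] pos by auto
    finally show ?thesis .
  qed
  have "0 \<ge> (\<Sum>i\<in>N. \<Sum>j\<in>N. (r i - r j) * (b i - b j))"
    by (intro sum_nonpos anti) auto
  also have "(\<Sum>i\<in>N. \<Sum>j\<in>N. (r i - r j) * (b i - b j))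
     = (\<Sum>i\<in>N. real (card N) * (r i * b i) - r i * sum b N - sum r N * b i + (\<Sum>j\<in>N. r j * b j))"
    by (intro sum.cong refl) (simp add: algebra_simps sum_subtractf sum.distrib flip: sum_distrib_left sum_distrib_right)
  also have "\<dots> = 2 * (real (card N) * (\<Sum>i\<in>N. r i * b i) - sum r N * sum b N)"
    by (simp add: sum_subtractf sum.distrib flip: sum_distrib_left sum_distrib_right)
  finally show ?thesis
    unfolding b_def using sum_mult_esym_remove[OF N, where r=r and k=k] sum_esym_remove[OF N, where r=r and k=k]
    by (simp add: algebra_simps)
qed

lemma sum_inverse_ge:
  fixes r :: "'i \<Rightarrow> real"
  assumes N: "finite N" and pos: "\<And>i. i \<in> N \<Longrightarrow> r i > 0" and m: "m > 0" "sum r N = real (card N) * m"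
  shows "real (card N) \<le> (\<Sum>i\<in>N. m / r i)"
proof -
  have "2 - r i / m \<le> m / r i" if "i \<in> N" for i
  proof -
    have "0 \<le> (r i - m)^2 / (r i * m)" using pos[OF that] m by simp
    also have "\<dots> = m / r i + r i / m - 2"
      using pos[OF that] m by (simp add: field_simps power2_eq_square)
    finally show ?thesis by simp
  qed
  then have "(\<Sum>i\<in>N. 2 - r i / m) \<le> (\<Sum>i\<in>N. m / r i)" by (rule sum_mono)
  moreover have "(\<Sum>i\<in>N. 2 - r i / m) = real (card N)"
    using m by (simp add: sum_subtractf flip: sum_divide_distrib)
  ultimately show ?thesis by simp
qed

text \<open>
  The geometric-arithmetic and the arithmetic-harmonic mean inequality: with \<open>m\<close> the arithmetic mean
  of the \<open>r i\<close>, the product of the numbers \<open>1 - (1 - t) * m / r i\<close>, if they are nonnegative, is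
  at most \<open>t ^ card N\<close>.
\<close>

lemma prod_diff_mean_le:
  fixes r :: "'i \<Rightarrow> real"
  assumes N: "finite N" and pos: "\<And>i. i \<in> N \<Longrightarrow> r i > 0" and m: "m > 0" "sum r N = real (card N) * m"
    and t: "0 < t" "t \<le> 1" and ge: "\<And>i. i \<in> N \<Longrightarrow> r i \<ge> (1 - t) * m"
  shows "(\<Prod>i\<in>N. (r i - (1 - t) * m) / t) \<le> prod r N"
proof -
  define a where "a i = 1 - (1 - t) * m / r i" for i
  have a0: "a i \<ge> 0" if "i \<in> N" for i
    using ge[OF that] pos[OF that] by (simp add: a_def)
  \<comment> \<open>the tangent of \<open>exp\<close> at \<open>0\<close> gives the inequality between geometric and arithmetic mean\<close>
  have "a i / t \<le> exp (a i / t - 1)" for i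
    using exp_ge_add_one_self[of "a i / t - 1"] by simp
  then have "(\<Prod>i\<in>N. a i / t) \<le> (\<Prod>i\<in>N. exp (a i / t - 1))"
    using a0 t by (intro prod_mono) auto
  also have "\<dots> = exp ((\<Sum>i\<in>N. a i) / t - real (card N))"
    by (simp add: exp_sum[OF N, symmetric] sum_subtractf flip: sum_divide_distrib)
  also have "\<dots> \<le> exp 0"
  proof -
    have "(\<Sum>i\<in>N. a i) = real (card N) - (1 - t) * (\<Sum>i\<in>N. m / r i)"
      by (simp add: a_def sum_subtractf sum_distrib_left)
    also have "\<dots> \<le> real (card N) - (1 - t) * real (card N)"
      using sum_inverse_ge[OF N pos m] t by (intro diff_left_mono mult_left_mono) auto
    finally have "(\<Sum>i\<in>N. a i) \<le> t * real (card N)" by (simp add: algebra_simps)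
    then show ?thesis using t by (simp add: field_simps)
  qed
  finally have le: "(\<Prod>i\<in>N. a i / t) \<le> 1" by simp
  have "(\<Prod>i\<in>N. (r i - (1 - t) * m) / t) = (\<Prod>i\<in>N. r i * (a i / t))"
  proof (intro prod.cong refl)
    fix i assume "i \<in> N"
    from pos[OF this] t show "(r i - (1 - t) * m) / t = r i * (a i / t)"
      by (simp add: a_def field_simps)
  qed
  also have "\<dots> = prod r N * (\<Prod>i\<in>N. a i / t)" by (rule prod.distrib)
  also have "\<dots> \<le> prod r N * 1"
    using le pos by (intro mult_left_mono prod_nonneg) (auto intro: less_imp_le)
  finally show ?thesis by simp
qed

section \<open>Eigenvalues of a diagonal matrix\<close>

lemma sigma_mat_diagonal:
  assumes A: "A = Matrix.mat n n (\<lambda>(i, j). if i = j then r i else 0)"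
  shows "sigma_mat k A = esym k r {..<n}"
proof -
  have cA: "A \<in> carrier_mat n n" by (simp add: A)
  have "upper_triangular A" by (auto simp: A upper_triangular_def)
  from char_poly_upper_triangular[OF cA this]
  have cp: "char_poly A = (\<Prod>a\<leftarrow>map r [0..<n]. [:- a, 1:])"
    by (auto simp: diag_mat_def A o_def intro!: arg_cong[where f=prod_list])
  have "proots (\<Prod>a\<leftarrow>xs. [:- a, 1:]) = mset xs" for xs :: "real list"
  proof (induction xs)
    case (Cons x xs)
    have "(\<Prod>a\<leftarrow>xs. [:- a, 1:]) \<noteq> 0" by (auto simp: prod_list_zero_iff)
    then show ?case using Cons by (simp add: proots_mult del: mult_pCons_left)
  qed auto
  then have ev: "eigenvalue_list A = sort (map r [0..<n])" (is "_ = ?ys")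
    unfolding eigenvalue_list_def cp by (simp only: sorted_list_of_multiset_mset)
  have "mset ?ys = mset (map r [0..<n])" by simp
  then obtain f where f: "f permutes {..<length (map r [0..<n])}" "permute_list f (map r [0..<n]) = ?ys"
    using mset_eq_permutation by metis
  have len: "length ?ys = n" by simp
  have nth: "?ys ! i = r (f i)" if "i < n" for i
  proof -
    have "f i < n" using f(1) that permutes_in_image[of f "{..<n}" i] by auto
    then show ?thesis unfolding f(2)[symmetric] using that by (simp add: permute_list_nth[OF f(1)])
  qed
  have "sigma_mat k A = esym k (\<lambda>i. ?ys ! i) {..<n}"
    unfolding sigma_mat_def ev elem_sym_def esym_def len ..
  also have "\<dots> = esym k (r \<circ> f) {..<n}"
    by (rule esym_cong) (simp add: nth)
  also have "\<dots> = esym k r {..<n}"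
    using f(1) by (intro esym_image[symmetric]) (simp add: permutes_imp_bij)
  finally show ?thesis .
qed

section \<open>Calculus of continuously differentiable functions\<close>

lemma Ck_on_cong:
  "open U \<Longrightarrow> (\<And>x. x \<in> U \<Longrightarrow> f x = g x) \<Longrightarrow> Ck_on k U f \<longleftrightarrow> Ck_on k U g"
proof (induction k arbitrary: f g)
  case 0
  then show ?case by (simp cong: continuous_on_cong)
next
  case (Suc k)
  have iff: "(f has_derivative F) (at x) \<longleftrightarrow> (g has_derivative F) (at x)" if x: "x \<in> U" for x F
    using has_derivative_transform_within_open[of f F x UNIV U g, OF _ Suc.prems(1) x]
      has_derivative_transform_within_open[of g F x UNIV U f, OF _ Suc.prems(1) x] Suc.prems(2) by auto
  have d: "f differentiable (at x) \<longleftrightarrow> g differentiable (at x)" if "x \<in> U" for x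
    unfolding differentiable_def iff[OF that] ..
  have "frechet_derivative f (at x) = frechet_derivative g (at x)" if "x \<in> U" for x
    unfolding frechet_derivative_def iff[OF that] ..
  then have "Ck_on k U (\<lambda>x. frechet_derivative f (at x) b) \<longleftrightarrow> Ck_on k U (\<lambda>x. frechet_derivative g (at x) b)" for b
    by (intro Suc.IH Suc.prems) auto
  then show ?case
    using d Suc.prems(1) by (auto simp: differentiable_on_eq_differentiable_at)
qed

lemma Ck_on_differentiable: "Ck_on (Suc k) U f \<Longrightarrow> open U \<Longrightarrow> x \<in> U \<Longrightarrow> f differentiable (at x)"
  by (auto simp: differentiable_on_eq_differentiable_at)

lemma Ck_on_Suc_imp: "Ck_on (Suc k) U f \<Longrightarrow> Ck_on k U f"
proof (induction k arbitrary: f)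
  case 0
  then show ?case by (auto intro: differentiable_imp_continuous_on)
next
  case (Suc k)
  from Suc.prems have "f differentiable_on U" by (simp only: Ck_on.simps)
  moreover have "Ck_on k U (\<lambda>x. frechet_derivative f (at x) b)" if "b \<in> Basis" for b
    using Suc.prems that by (intro Suc.IH) (simp only: Ck_on.simps, blast)
  ultimately show ?case by simp
qed

lemma Ck_on_continuous: "Ck_on k U f \<Longrightarrow> continuous_on U f"
  by (induction k) (auto intro: differentiable_imp_continuous_on)

lemma Ck_on_subset: "Ck_on k U f \<Longrightarrow> V \<subseteq> U \<Longrightarrow> Ck_on k V f"
  by (induction k arbitrary: f) (auto intro: continuous_on_subset differentiable_on_subset)

lemma Ck_on_local:
  assumes "open U" "\<And>x. x \<in> U \<Longrightarrow> \<exists>V. open V \<and> x \<in> V \<and> Ck_on k V f"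
  shows "Ck_on k U f"
  using assms(2)
proof (induction k arbitrary: f)
  case 0
  have "isCont f x" if "x \<in> U" for x
    using 0[OF that] by (auto simp: continuous_on_eq_continuous_at)
  then show ?case by (simp add: continuous_at_imp_continuous_on)
next
  case (Suc k)
  have "f differentiable (at x)" if "x \<in> U" for x
    using Suc.prems[OF that] Ck_on_differentiable by blast
  then have "f differentiable_on U"
    using assms(1) by (simp add: differentiable_on_eq_differentiable_at)
  moreover have "Ck_on k U (\<lambda>x. frechet_derivative f (at x) b)" if b: "b \<in> Basis" for b
      proof (rule Suc.IH)
    fix x assume "x \<in> U"
    then obtain V where "open V" "x \<in> V" "Ck_on (Suc k) V f" using Suc.prems by blast
    then show "\<exists>V. open V \<and> x \<in> V \<and> Ck_on k V (\<lambda>x. frechet_derivative f (at x) b)"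
      using b by (intro exI[of _ V]) simp
  qed
  ultimately show ?case by simp
qed

lemma Ck_on_const: "Ck_on k U (\<lambda>x. c)"
  by (induction k arbitrary: c) auto

lemma Ck_on_inner_const: "Ck_on k U (\<lambda>x. x \<bullet> a)"
proof (cases k)
  case (Suc j)
  have "((\<lambda>x. x \<bullet> a) has_derivative (\<lambda>x. x \<bullet> a)) (at x)" for x
    by (intro derivative_eq_intros) auto
  then have "frechet_derivative (\<lambda>x. x \<bullet> a) (at x) = (\<lambda>x. x \<bullet> a)" for x
    by (rule frechet_derivative_at[symmetric])
  then show ?thesis
    unfolding Suc by (auto simp: Ck_on_const differentiable_on_def intro!: differentiable_inner)
qed (auto intro: continuous_intros)

lemma Ck_on_add:
  assumes U: "open U"
  shows "Ck_on k U f \<Longrightarrow> Ck_on k U g \<Longrightarrow> Ck_on k U (\<lambda>x. f x + g x)"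
proof (induction k arbitrary: f g)
  case (Suc k)
  have d: "f differentiable (at x)" "g differentiable (at x)" if "x \<in> U" for x
    using Ck_on_differentiable[OF Suc.prems(1) U that] Ck_on_differentiable[OF Suc.prems(2) U that] by auto
  have "Ck_on k U (\<lambda>x. frechet_derivative (\<lambda>x. f x + g x) (at x) b)" if "b \<in> Basis" for b
  proof (subst Ck_on_cong[OF U])
    show "Ck_on k U (\<lambda>x. frechet_derivative f (at x) b + frechet_derivative g (at x) b)"
      using Suc.prems that by (intro Suc.IH) auto
    show "frechet_derivative (\<lambda>x. f x + g x) (at x) b = frechet_derivative f (at x) b + frechet_derivative g (at x) b"
      if "x \<in> U" for x
    proof -
      have "((\<lambda>x. f x + g x) has_derivative (\<lambda>h. frechet_derivative f (at x) h + frechet_derivative g (at x) h)) (at x)"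
        using d[OF that] by (intro has_derivative_add) (auto simp: frechet_derivative_works[symmetric])
      from fun_cong[OF frechet_derivative_at[OF this]] show ?thesis by simp
    qed
  qed
  then show ?case using d U by (auto simp: differentiable_on_eq_differentiable_at intro: differentiable_add)
qed (auto intro: continuous_intros)

lemma Ck_on_mult:
  fixes f g :: "'a::euclidean_space \<Rightarrow> real"
  assumes U: "open U"
  shows "Ck_on k U f \<Longrightarrow> Ck_on k U g \<Longrightarrow> Ck_on k U (\<lambda>x. f x * g x)"
proof (induction k arbitrary: f g)
  case (Suc k)
  have d: "f differentiable (at x)" "g differentiable (at x)" if "x \<in> U" for x
    using Ck_on_differentiable[OF Suc.prems(1) U that] Ck_on_differentiable[OF Suc.prems(2) U that] by auto
  have "Ck_on k U (\<lambda>x. frechet_derivative (\<lambda>x. f x * g x) (at x) b)" if "b \<in> Basis" for b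
  proof (subst Ck_on_cong[OF U])
    show "Ck_on k U (\<lambda>x. f x * frechet_derivative g (at x) b + frechet_derivative f (at x) b * g x)"
      using Suc.prems Ck_on_Suc_imp[OF Suc.prems(1)] Ck_on_Suc_imp[OF Suc.prems(2)] that
      by (intro Ck_on_add[OF U] Suc.IH) auto
    show "frechet_derivative (\<lambda>x. f x * g x) (at x) b = f x * frechet_derivative g (at x) b + frechet_derivative f (at x) b * g x"
      if "x \<in> U" for x
    proof -
      have "((\<lambda>x. f x * g x) has_derivative (\<lambda>h. f x * frechet_derivative g (at x) h + frechet_derivative f (at x) h * g x)) (at x)"
        using d[OF that] by (intro has_derivative_mult) (auto simp: frechet_derivative_works[symmetric])
      from fun_cong[OF frechet_derivative_at[OF this]] show ?thesis by simp
    qed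
  qed
  then show ?case using d U by (auto simp: differentiable_on_eq_differentiable_at intro: differentiable_mult)
qed (auto intro: continuous_intros)

lemma Ck_on_sum:
  assumes U: "open U"
  shows "(\<And>i. i \<in> I \<Longrightarrow> Ck_on k U (f i)) \<Longrightarrow> Ck_on k U (\<lambda>x. \<Sum>i\<in>I. f i x)"
  by (induction I rule: infinite_finite_induct) (auto simp: Ck_on_const Ck_on_add[OF U])

lemma differentiable_componentwise:
  fixes g :: "'a::euclidean_space \<Rightarrow> 'b::euclidean_space"
  shows "(\<And>c. c \<in> Basis \<Longrightarrow> (\<lambda>x. g x \<bullet> c) differentiable (at x)) \<Longrightarrow> g differentiable (at x)"
  using differentiable_componentwise_within[of g x UNIV] by auto

lemma frechet_derivative_inner_const:
  fixes g :: "'a::euclidean_space \<Rightarrow> 'b::euclidean_space"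
  assumes "g differentiable (at x)"
  shows "frechet_derivative (\<lambda>x. g x \<bullet> c) (at x) v = frechet_derivative g (at x) v \<bullet> c"
proof -
  have "((\<lambda>x. g x \<bullet> c) has_derivative (\<lambda>v. frechet_derivative g (at x) v \<bullet> c)) (at x)"
    using assms by (intro has_derivative_inner_left) (simp add: frechet_derivative_works[symmetric])
  from fun_cong[OF frechet_derivative_at[OF this]] show ?thesis by simp
qed

lemma frechet_derivative_eq_sum_Basis:
  fixes f :: "'a::euclidean_space \<Rightarrow> 'b::real_normed_vector"
  assumes "f differentiable (at x)"
  shows "frechet_derivative f (at x) v = (\<Sum>c\<in>Basis. (v \<bullet> c) *\<^sub>R frechet_derivative f (at x) c)"
proof -
  have "linear (frechet_derivative f (at x))"
    using assms by (rule linear_frechet_derivative)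
  from linear_sum[OF this, of "\<lambda>c. (v \<bullet> c) *\<^sub>R c" Basis] linear_cmul[OF this]
  show ?thesis by (simp add: euclidean_representation)
qed

lemma Ck_on_compose:
  fixes g :: "'a::euclidean_space \<Rightarrow> 'b::euclidean_space" and f :: "'b \<Rightarrow> real"
  assumes U: "open U" and V: "open V" and g: "\<And>c. c \<in> Basis \<Longrightarrow> Ck_on k U (\<lambda>x. g x \<bullet> c)"
    and UV: "\<And>x. x \<in> U \<Longrightarrow> g x \<in> V"
  shows "Ck_on k V f \<Longrightarrow> Ck_on k U (\<lambda>x. f (g x))"
  using g
proof (induction k arbitrary: f)
  case 0
  have "continuous_on U g"
    using 0(2) by (intro continuous_on_componentwise[THEN iffD2]) auto
  then show ?case
    using 0(1) UV by (auto intro: continuous_on_compose2)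
next
  case (Suc k)
  have dg: "g differentiable (at x)" if "x \<in> U" for x
    using Ck_on_differentiable[OF Suc.prems(2) U that] by (rule differentiable_componentwise)
  have df: "f differentiable (at (g x))" if "x \<in> U" for x
    using Ck_on_differentiable[OF Suc.prems(1) V UV[OF that]] .
  have d: "((\<lambda>x. f (g x)) has_derivative (\<lambda>h. frechet_derivative f (at (g x)) (frechet_derivative g (at x) h))) (at x)"
    if "x \<in> U" for x
    using has_derivative_compose[OF dg[OF that, unfolded frechet_derivative_works] df[OF that, unfolded frechet_derivative_works]] .
  have "Ck_on k U (\<lambda>x. frechet_derivative (\<lambda>x. f (g x)) (at x) b)" if b: "b \<in> Basis" for b
  proof (subst Ck_on_cong[OF U])
    show "Ck_on k U (\<lambda>x. \<Sum>c\<in>Basis. frechet_derivative (\<lambda>x. g x \<bullet> c) (at x) b * frechet_derivative f (at (g x)) c)"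
    proof (intro Ck_on_sum[OF U] Ck_on_mult[OF U])
      fix c :: 'b assume c: "c \<in> Basis"
      show "Ck_on k U (\<lambda>x. frechet_derivative (\<lambda>x. g x \<bullet> c) (at x) b)"
        using Suc.prems(2)[OF c] b by simp
      show "Ck_on k U (\<lambda>x. frechet_derivative f (at (g x)) c)"
      proof (rule Suc.IH)
        show "Ck_on k V (\<lambda>y. frechet_derivative f (at y) c)" using Suc.prems(1) c by simp
        show "Ck_on k U (\<lambda>x. g x \<bullet> c')" if "c' \<in> Basis" for c'
          by (rule Ck_on_Suc_imp[OF Suc.prems(2)[OF that]])
      qed
    qed
    show "frechet_derivative (\<lambda>x. f (g x)) (at x) b = (\<Sum>c\<in>Basis. frechet_derivative (\<lambda>x. g x \<bullet> c) (at x) b * frechet_derivative f (at (g x)) c)"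
      if "x \<in> U" for x
    proof -
      have "frechet_derivative (\<lambda>x. f (g x)) (at x) b = frechet_derivative f (at (g x)) (frechet_derivative g (at x) b)"
        using fun_cong[OF frechet_derivative_at[OF d[OF that]]] by simp
      then show ?thesis
        using frechet_derivative_eq_sum_Basis[OF df[OF that], of "frechet_derivative g (at x) b"] frechet_derivative_inner_const[OF dg[OF that]] by simp
    qed
  qed
  moreover have "(\<lambda>x. f (g x)) differentiable_on U"
    unfolding differentiable_on_eq_differentiable_at[OF U] differentiable_def using d by blast
  ultimately show ?case by simp
qed

lemma Ck_on_powr: "Ck_on k {0<..} (\<lambda>x::real. c * x powr a)"
proof (induction k arbitrary: a c)
  case (Suc k)
  have d: "((\<lambda>x. c * x powr a) has_derivative (\<lambda>h. c * a * x powr (a - 1) * h)) (at x)" if "x > 0" for x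
    using that by (auto intro!: derivative_eq_intros simp: powr_diff)
  have "Ck_on k {0<..} (\<lambda>x. frechet_derivative (\<lambda>x. c * x powr a) (at x) b)" if "b \<in> Basis" for b :: real
  proof (subst Ck_on_cong)
    show "Ck_on k {0<..} (\<lambda>x. c * a * x powr (a - 1))" by (rule Suc)
    show "frechet_derivative (\<lambda>x. c * x powr a) (at x) b = c * a * x powr (a - 1)" if "x \<in> {0<..}" for x
      using fun_cong[OF frechet_derivative_at[OF d], of x b] that \<open>b \<in> Basis\<close> by simp
  qed auto
  then show ?case using d by (auto simp: differentiable_on_eq_differentiable_at differentiable_def)
qed (auto intro!: continuous_intros)

lemma Ck_on_powr_compose:
  fixes f :: "'a::euclidean_space \<Rightarrow> real"
  assumes "open U" "Ck_on k U f" "\<And>x. x \<in> U \<Longrightarrow> f x > 0"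
  shows "Ck_on k U (\<lambda>x. f x powr a)"
  using Ck_on_compose[OF assms(1), of "{0<..}" k f "\<lambda>x. x powr a"] assms Ck_on_powr[of k 1 a] by auto

lemma open_nonzero: "open (- {0 :: 'a::euclidean_space})"
  by (rule open_delete[of UNIV, unfolded Compl_eq_Diff_UNIV[symmetric]]) auto

lemma Ck_on_sgn: "Ck_on k (- {0}) (\<lambda>y :: 'a::euclidean_space. sgn y \<bullet> b)"
proof (subst Ck_on_cong)
  have "Ck_on k (- {0}) (\<lambda>y :: 'a. \<Sum>c\<in>Basis. (y \<bullet> c) * (y \<bullet> c))"
    by (intro Ck_on_sum Ck_on_mult Ck_on_inner_const open_nonzero)
  then have "Ck_on k (- {0}) (\<lambda>y :: 'a. y \<bullet> y)"
    by (simp add: euclidean_inner[symmetric])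
  then show "Ck_on k (- {0}) (\<lambda>y :: 'a. (y \<bullet> y) powr (- 1/2) * (y \<bullet> b))"
    by (intro Ck_on_mult Ck_on_inner_const open_nonzero Ck_on_powr_compose) auto
  show "sgn y \<bullet> b = (y \<bullet> y) powr (- 1/2) * (y \<bullet> b)" if "y \<in> - {0}" for y :: 'a
  proof -
    have "(y \<bullet> y) powr (- 1/2) = inverse (sqrt (y \<bullet> y))"
      using that by (simp add: powr_minus powr_half_sqrt)
    then show ?thesis by (simp add: sgn_div_norm norm_eq_sqrt_inner)
  qed
qed (rule open_nonzero)

lemma Ck_on_compose_sgn:
  "Ck_on k (- {0}) f \<Longrightarrow> Ck_on k (- {0}) (\<lambda>y :: 'a::euclidean_space. f (sgn y))"
  using Ck_on_compose[OF open_nonzero open_nonzero, of k sgn f] Ck_on_sgn by (auto simp: sgn_zero_iff)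

text \<open>
  Young's argument for the symmetry of second derivatives: the symmetric second difference in
  the directions \<open>a\<close> and \<open>b\<close> tends to the derivative in direction \<open>b\<close> of the derivative in direction
  \<open>a\<close>, as soon as the latter is differentiable at the point.
\<close>

lemma second_difference:
  fixes f D :: "'a::euclidean_space \<Rightarrow> real"
  assumes U: "open U" "x \<in> U" and D: "\<And>y. y \<in> U \<Longrightarrow> ((\<lambda>t. f (y + t *\<^sub>R a)) has_real_derivative D y) (at 0)"
    and L: "(D has_derivative L) (at x)"
  shows "((\<lambda>h. (f (x + h *\<^sub>R a + h *\<^sub>R b) - f (x + h *\<^sub>R a) - f (x + h *\<^sub>R b) + f x) / h^2) \<longlongrightarrow> L b) (at_right 0)"
proof (rule tendstoI)
  fix e :: real assume e: "e > 0"
  define N where "N = norm a + norm b + 1"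
  have N: "N > 0" by (simp add: N_def add_nonneg_pos)
  define e' where "e' = e / (4 * N)"
  have e': "e' > 0" using e N by (simp add: e'_def)
  obtain d1 where d1: "d1 > 0" "\<And>y. norm (y - x) < d1 \<Longrightarrow> norm (D y - D x - L (y - x)) \<le> e' * norm (y - x)"
    using L e' unfolding has_derivative_at_alt by metis
  obtain d2 where d2: "d2 > 0" "ball x d2 \<subseteq> U" using U open_contains_ball by blast
  define d where "d = min d1 d2 / N"
  have d: "d > 0" using d1 d2 N by (simp add: d_def)
  have lin: "linear L" using L by (rule has_derivative_linear)
  have "dist ((f (x + h *\<^sub>R a + h *\<^sub>R b) - f (x + h *\<^sub>R a) - f (x + h *\<^sub>R b) + f x) / h^2) (L b) < e"
    if h: "0 < h" "h < d" for h
  proof -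
    have near: "norm (s *\<^sub>R a + c *\<^sub>R b) \<le> h * N" "norm (s *\<^sub>R a + c *\<^sub>R b) < d1" "norm (s *\<^sub>R a + c *\<^sub>R b) < d2"
      if "0 \<le> s" "s \<le> h" "c = 0 \<or> c = h" for s c
    proof -
      have "norm (s *\<^sub>R a + c *\<^sub>R b) \<le> s * norm a + \<bar>c\<bar> * norm b"
        using norm_triangle_ineq[of "s *\<^sub>R a" "c *\<^sub>R b"] that by simp
      also have "\<dots> \<le> h * norm a + h * norm b"
        using that h by (intro add_mono mult_right_mono) auto
      finally show le: "norm (s *\<^sub>R a + c *\<^sub>R b) \<le> h * N"
        unfolding N_def using h by (simp add: algebra_simps)
      have "h * N < min d1 d2" using h N by (simp add: d_def field_simps)
      with le show "norm (s *\<^sub>R a + c *\<^sub>R b) < d1" "norm (s *\<^sub>R a + c *\<^sub>R b) < d2" by auto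
    qed
    define p where "p s = f (x + h *\<^sub>R b + s *\<^sub>R a) - f (x + s *\<^sub>R a)" for s
    have inU: "x + c *\<^sub>R b + s *\<^sub>R a \<in> U" if "0 \<le> s" "s \<le> h" "c = 0 \<or> c = h" for s c
      using near[OF that] d2 by (auto simp: subset_iff dist_norm norm_minus_commute algebra_simps)
    have der: "((\<lambda>s. f (x + c *\<^sub>R b + s *\<^sub>R a)) has_real_derivative D (x + c *\<^sub>R b + s *\<^sub>R a)) (at s)"
      if "0 \<le> s" "s \<le> h" "c = 0 \<or> c = h" for s c
      using DERIV_shift[of "\<lambda>s. f (x + c *\<^sub>R b + s *\<^sub>R a)" "D (x + c *\<^sub>R b + s *\<^sub>R a)" 0 s] D[OF inU[OF that]]
      by (simp add: algebra_simps)
    have "\<exists>z. 0 < z \<and> z < h \<and> p h - p 0 = (h - 0) * (D (x + h *\<^sub>R b + z *\<^sub>R a) - D (x + z *\<^sub>R a))"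
    proof (rule MVT2)
      fix s assume s: "0 \<le> s" "s \<le> h"
      show "(p has_real_derivative D (x + h *\<^sub>R b + s *\<^sub>R a) - D (x + s *\<^sub>R a)) (at s)"
        unfolding p_def using DERIV_diff[OF der[OF s, of h] der[OF s, of 0]] by simp
    qed (use h in auto)
    then obtain z where z: "0 < z" "z < h" "p h - p 0 = h * (D (x + h *\<^sub>R b + z *\<^sub>R a) - D (x + z *\<^sub>R a))"
      by auto
    let ?y1 = "z *\<^sub>R a + h *\<^sub>R b" and ?y2 = "z *\<^sub>R a + 0 *\<^sub>R b"
    have b1: "\<bar>D (x + ?y1) - D x - L ?y1\<bar> \<le> e' * (h * N)"
      using d1(2)[of "x + ?y1"] near[of z h] z e' by (auto intro: order_trans[OF _ mult_left_mono])
    have b2: "\<bar>D (x + ?y2) - D x - L ?y2\<bar> \<le> e' * (h * N)"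
      using d1(2)[of "x + ?y2"] near[of z 0] z e' by (auto intro: order_trans[OF _ mult_left_mono])
    have "L ?y1 - L ?y2 = h * L b"
      using linear_add[OF lin] linear_cmul[OF lin] by simp
    with b1 b2 have "\<bar>(D (x + ?y1) - D (x + ?y2)) - h * L b\<bar> \<le> 2 * (e' * (h * N))"
      by linarith
    also have "\<dots> = h * (e / 2)" using N by (simp add: e'_def)
    finally have b3: "\<bar>(D (x + ?y1) - D (x + ?y2)) - h * L b\<bar> \<le> h * (e / 2)" .
    have "f (x + h *\<^sub>R a + h *\<^sub>R b) - f (x + h *\<^sub>R a) - f (x + h *\<^sub>R b) + f x = p h - p 0"
      by (simp add: p_def add_ac)
    also have "\<dots> = h * (D (x + ?y1) - D (x + ?y2))"
      unfolding z(3) by (simp add: add_ac)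
    finally have num: "f (x + h *\<^sub>R a + h *\<^sub>R b) - f (x + h *\<^sub>R a) - f (x + h *\<^sub>R b) + f x = h * (D (x + ?y1) - D (x + ?y2))" .
    then have "(f (x + h *\<^sub>R a + h *\<^sub>R b) - f (x + h *\<^sub>R a) - f (x + h *\<^sub>R b) + f x) / h^2 - L b
        = ((D (x + ?y1) - D (x + ?y2)) - h * L b) / h"
      unfolding num using h by (simp add: diff_divide_distrib power2_eq_square)
    then have "\<bar>(f (x + h *\<^sub>R a + h *\<^sub>R b) - f (x + h *\<^sub>R a) - f (x + h *\<^sub>R b) + f x) / h^2 - L b\<bar> \<le> e / 2"
      using b3 h by (simp only: abs_divide) (simp add: pos_divide_le_eq mult.commute)
    then show ?thesis using e by (simp add: dist_real_def)
  qed
  then show "\<forall>\<^sub>F h in at_right 0. dist ((f (x + h *\<^sub>R a + h *\<^sub>R b) - f (x + h *\<^sub>R a) - f (x + h *\<^sub>R b) + f x) / h^2) (L b) < e"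
    unfolding eventually_at_right_field using d by (intro exI[of _ d]) auto
qed

lemma has_real_derivative_along:
  fixes f :: "'a::euclidean_space \<Rightarrow> real"
  assumes "(f has_derivative f') (at (y + t *\<^sub>R v))"
  shows "((\<lambda>t. f (y + t *\<^sub>R v)) has_real_derivative f' v) (at t)"
proof -
  have "((\<lambda>t. y + t *\<^sub>R v) has_derivative (\<lambda>s. s *\<^sub>R v)) (at t)"
    by (auto intro!: derivative_eq_intros)
  from has_derivative_compose[OF this, of f f'] assms
  have "((\<lambda>t. f (y + t *\<^sub>R v)) has_derivative (\<lambda>s. f' (s *\<^sub>R v))) (at t)" by simp
  moreover have "(\<lambda>s. f' (s *\<^sub>R v)) = (*) (f' v)"
    by (rule ext) (simp only: linear_cmul[OF has_derivative_linear[OF assms]] real_scaleR_def mult.commute)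
  ultimately show ?thesis
    by (simp only: has_field_derivative_def)
qed

lemma second_derivative_symmetric:
  fixes f :: "'a::euclidean_space \<Rightarrow> real"
  assumes U: "open U" "x \<in> U" and f: "Ck_on 2 U f" and ab: "a \<in> Basis" "b \<in> Basis"
  shows "frechet_derivative (\<lambda>y. frechet_derivative f (at y) a) (at x) b
       = frechet_derivative (\<lambda>y. frechet_derivative f (at y) b) (at x) a"
proof -
  have f1: "Ck_on (Suc (Suc 0)) U f" using f by (simp add: numeral_2_eq_2)
  have d1: "f differentiable (at y)" if "y \<in> U" for y
    using Ck_on_differentiable[OF f1 U(1) that] .
  have d2: "(\<lambda>y. frechet_derivative f (at y) c) differentiable (at x)" if "c \<in> Basis" for c
    using f1 that U by (auto simp: differentiable_on_eq_differentiable_at)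
  have D: "((\<lambda>t. f (y + t *\<^sub>R c)) has_real_derivative frechet_derivative f (at y) c) (at 0)" if "y \<in> U" for y c
    using has_real_derivative_along[of f _ y 0 c] d1[OF that] by (simp add: frechet_derivative_works)
  have "((\<lambda>h. (f (x + h *\<^sub>R a + h *\<^sub>R b) - f (x + h *\<^sub>R a) - f (x + h *\<^sub>R b) + f x) / h^2) \<longlongrightarrow>
      frechet_derivative (\<lambda>y. frechet_derivative f (at y) a) (at x) b) (at_right 0)"
    using d2[OF ab(1)] by (intro second_difference[OF U D]) (simp_all add: frechet_derivative_works)
  moreover have "((\<lambda>h. (f (x + h *\<^sub>R b + h *\<^sub>R a) - f (x + h *\<^sub>R b) - f (x + h *\<^sub>R a) + f x) / h^2) \<longlongrightarrow>
      frechet_derivative (\<lambda>y. frechet_derivative f (at y) b) (at x) a) (at_right 0)"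
    using d2[OF ab(2)] by (intro second_difference[OF U D]) (simp_all add: frechet_derivative_works)
  then have "((\<lambda>h. (f (x + h *\<^sub>R a + h *\<^sub>R b) - f (x + h *\<^sub>R a) - f (x + h *\<^sub>R b) + f x) / h^2) \<longlongrightarrow>
      frechet_derivative (\<lambda>y. frechet_derivative f (at y) b) (at x) a) (at_right 0)"
    by (simp add: algebra_simps)
  ultimately show ?thesis
    using tendsto_unique trivial_limit_at_right_real by blast
qed

section \<open>Orthonormal frames and determinants\<close>

text \<open>
  The spectral theorem on an invariant subspace \<open>S\<close>.  A unit vector of \<open>S\<close> at which \<open>A v \<bullet> v\<close> is
  maximal is an eigenvector, and its orthogonal complement in \<open>S\<close> is again invariant.
\<close>

lemma symmetric_eigenbasis:
  fixes A :: "'a::euclidean_space \<Rightarrow> 'a"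
  assumes lin: "linear A" and sym: "\<And>v w. A v \<bullet> w = v \<bullet> A w"
  shows "subspace S \<Longrightarrow> dim S = m \<Longrightarrow> A ` S \<subseteq> S \<Longrightarrow>
    \<exists>e r. \<forall>i<m. e i \<in> S \<and> A (e i) = r i *\<^sub>R e i \<and> (\<forall>j<m. e i \<bullet> e j = (if i = j then 1 else 0))"
proof (induction m arbitrary: S)
  case (Suc m)
  note S = \<open>subspace S\<close>
  have cont: "continuous_on X A" for X
    using lin by (simp add: linear_continuous_on linear_conv_bounded_linear)
  have ne: "S \<inter> sphere 0 1 \<noteq> {}"
  proof -
    obtain w where w: "w \<in> S" "w \<noteq> 0" using Suc.prems(2) dim_eq_0[of S] by auto
    then have "sgn w \<in> S \<inter> sphere 0 1"
      using S by (auto simp: sgn_div_norm subspace_scale)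
    then show ?thesis by auto
  qed
  have "compact (S \<inter> sphere 0 1)"
    using S by (simp add: closed_subspace closed_Int_compact)
  from continuous_attains_sup[OF this ne continuous_on_inner[OF cont continuous_on_id]]
  obtain v where v: "v \<in> S" "norm v = 1" and max: "\<And>w. w \<in> S \<Longrightarrow> norm w = 1 \<Longrightarrow> A w \<bullet> w \<le> A v \<bullet> v"
    by auto
  define l where "l = A v \<bullet> v"
  have vv: "v \<bullet> v = 1" using v by (simp add: dot_square_norm)
  have le: "A w \<bullet> w \<le> l * (w \<bullet> w)" if "w \<in> S" for w
  proof (cases "w = 0")
    case False
    have "A (sgn w) \<bullet> sgn w \<le> l"
      unfolding l_def using that False S by (intro max) (auto simp: sgn_div_norm subspace_scale)
    then have "A w \<bullet> w / (norm w)^2 \<le> l"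
      using lin by (simp add: sgn_div_norm linear_cmul power2_eq_square field_simps)
    then show ?thesis using False by (simp add: field_simps power2_norm_eq_inner)
  qed (use lin in \<open>simp add: linear_0\<close>)
  have orth: "A v \<bullet> w = 0" if w: "w \<in> S" "w \<bullet> v = 0" for w
  proof -
    define c M where "c = A v \<bullet> w" and "M = l * (w \<bullet> w) - A w \<bullet> w"
    have "2 * t * c \<le> t^2 * M" for t
    proof -
      have "v + t *\<^sub>R w \<in> S" using w v S by (simp add: subspace_add subspace_scale)
      from le[OF this] have "A v \<bullet> v + 2 * t * c + t^2 * (A w \<bullet> w) \<le> l * (1 + t^2 * (w \<bullet> w))"
        using w(2) vv sym[of w v] lin
        by (simp add: c_def linear_add linear_cmul inner_add_left inner_add_right power2_eq_square
            inner_commute algebra_simps)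
      then show ?thesis unfolding M_def l_def[symmetric] by (simp add: algebra_simps)
    qed
    note quad = this
    \<comment> \<open>a linear term \<open>c\<close> dominated by a quadratic one for all \<open>t\<close> vanishes; test with \<open>t = c / K\<close>\<close>
    define K where "K = \<bar>M\<bar> + 1"
    have K: "K > 0" "M \<le> K" by (auto simp: K_def)
    have "2 * c^2 / K \<le> c^2 * M / K^2"
      using quad[of "c / K"] by (simp add: power2_eq_square power_divide)
    then have "2 * c^2 * K \<le> c^2 * M"
      using K by (simp add: field_simps power2_eq_square)
    then have "c^2 * (2 * K - M) \<le> 0" by (simp add: algebra_simps)
    moreover have "2 * K - M > 0" using K by linarith
    ultimately have "c^2 \<le> 0" by (simp add: mult_le_0_iff)
    then show ?thesis by (simp add: c_def)
  qed
  have Av: "A v = l *\<^sub>R v"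
  proof -
    define w where "w = A v - l *\<^sub>R v"
    have w: "w \<in> S" "w \<bullet> v = 0"
      using v Suc.prems(3) S vv
      by (auto simp: w_def subspace_diff subspace_scale image_subset_iff inner_diff_left l_def)
    have "w \<bullet> w = A v \<bullet> w - l * (v \<bullet> w)" by (simp add: w_def inner_diff_left)
    also have "\<dots> = 0" using orth[OF w] w(2) by (simp add: inner_commute)
    finally show ?thesis by (simp add: w_def)
  qed
  define S' where "S' = {y \<in> S. \<forall>x\<in>span {v}. real_inner_class.orthogonal x y}"
  have S'_eq: "y \<in> S' \<longleftrightarrow> y \<in> S \<and> y \<bullet> v = 0" for y
    by (auto simp: S'_def real_inner_class.orthogonal_def span_singleton inner_commute)
  have sub': "subspace S'"
    using S by (auto simp: subspace_def S'_eq inner_add_left)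
  have "dim S' + dim (span {v}) = dim S"
    unfolding S'_def using S v by (intro dim_subspace_orthogonal_to_vectors) (auto simp: span_minimal)
  moreover have "dim (span {v}) = 1" using v dim_eq_card_independent[of "{v}"] by (auto simp: dependent_single)
  ultimately have dim': "dim S' = m" using Suc.prems(2) by simp
  have inv': "A ` S' \<subseteq> S'"
  proof (rule image_subsetI)
    fix y assume "y \<in> S'"
    then show "A y \<in> S'"
      using Suc.prems(3) by (auto simp: S'_eq sym Av)
  qed
  from Suc.IH[OF sub' dim' inv'] obtain e r where
    er: "\<forall>i<m. e i \<in> S' \<and> A (e i) = r i *\<^sub>R e i \<and> (\<forall>j<m. e i \<bullet> e j = (if i = j then 1 else 0))" by blast
  show ?case
  proof (intro exI allI impI conjI)
    fix i assume i: "i < Suc m"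
    show "(if i < m then e i else v) \<in> S" using er v by (auto simp: S'_eq)
    show "A (if i < m then e i else v) = (if i < m then r i else l) *\<^sub>R (if i < m then e i else v)"
      using er Av by auto
    fix j assume "j < Suc m"
    then show "(if i < m then e i else v) \<bullet> (if j < m then e j else v) = (if i = j then 1 else 0)"
      using i er vv by (auto simp: S'_eq less_Suc_eq inner_commute)
  qed
qed auto

lemma frame_inj: "orthonormal_frame n x e \<Longrightarrow> inj_on e {..<n}"
  unfolding orthonormal_frame_def inj_on_def by (metis lessThan_iff zero_neq_one)

lemma frame_expansion:
  fixes x :: "'a::euclidean_space"
  assumes x: "norm x = 1" and e: "orthonormal_frame n x e" and n: "DIM('a) = n + 1"
  shows "v = (v \<bullet> x) *\<^sub>R x + (\<Sum>i<n. (v \<bullet> e i) *\<^sub>R e i)"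
proof -
  let ?B = "insert x (e ` {..<n})"
  define w where "w = v - ((v \<bullet> x) *\<^sub>R x + (\<Sum>i<n. (v \<bullet> e i) *\<^sub>R e i))"
  have xx: "x \<bullet> x = 1" using x by (simp add: dot_square_norm)
  have ex: "e i \<bullet> x = 0" "x \<bullet> e i = 0" if "i < n" for i
    using e that by (auto simp: orthonormal_frame_def inner_commute)
  have ee: "e i \<bullet> e j = (if i = j then 1 else 0)" if "i < n" "j < n" for i j
    using e that by (auto simp: orthonormal_frame_def)
  have xn: "x \<notin> e ` {..<n}" using ex xx by auto
  have "0 \<notin> ?B" using xx ee by (auto simp: image_iff) (metis inner_zero_left zero_neq_one)
  moreover have "pairwise real_inner_class.orthogonal ?B"
    using ex ee by (auto simp: pairwise_def real_inner_class.orthogonal_def)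
  ultimately have ind: "independent ?B" by (intro pairwise_orthogonal_independent)
  have "card ?B = n + 1" using xn frame_inj[OF e] by (simp add: card_image)
  then have "span ?B = UNIV"
    using ind n by (metis card_eq_dim dim_UNIV finite_imageI finite_insert finite_lessThan independent_card_le_dim span_eq top.extremum_unique top_greatest le_refl)
  moreover have "real_inner_class.orthogonal w y" if "y \<in> ?B" for y
  proof -
    have "(\<Sum>i<n. (v \<bullet> e i) * (e i \<bullet> e j)) = v \<bullet> e j" if "j < n" for j
    proof -
      have "(\<Sum>i<n. (v \<bullet> e i) * (e i \<bullet> e j)) = (\<Sum>i<n. if i = j then v \<bullet> e j else 0)"
        using that ee by (intro sum.cong refl) simp
      then show ?thesis using that by simp
    qed
    then show ?thesis
      using that ex xx by (auto simp: w_def real_inner_class.orthogonal_def inner_diff_left inner_add_left inner_sum_left)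
  qed
  ultimately have "real_inner_class.orthogonal w w" using orthogonal_to_span[of w ?B w] by (auto simp: orthogonal_commute)
  then show ?thesis by (simp add: w_def real_inner_class.orthogonal_def)
qed

lemma frame_inner:
  fixes x :: "'a::euclidean_space"
  assumes "norm x = 1" "orthonormal_frame n x e" "DIM('a) = n + 1"
  shows "v \<bullet> w = (v \<bullet> x) * (w \<bullet> x) + (\<Sum>i<n. (v \<bullet> e i) * (w \<bullet> e i))"
  using arg_cong[OF frame_expansion[OF assms, of v], of "\<lambda>z. z \<bullet> w"]
  by (simp add: inner_add_right inner_sum_right inner_commute)

lemma frame_eqI:
  fixes x :: "'a::euclidean_space"
  assumes "norm x = 1" "orthonormal_frame n x e" "DIM('a) = n + 1"
    and "v \<bullet> x = w \<bullet> x" "\<And>i. i < n \<Longrightarrow> v \<bullet> e i = w \<bullet> e i"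
  shows "v = w"
proof -
  have "v = (v \<bullet> x) *\<^sub>R x + (\<Sum>i<n. (v \<bullet> e i) *\<^sub>R e i)" by (rule frame_expansion[OF assms(1-3)])
  also have "\<dots> = (w \<bullet> x) *\<^sub>R x + (\<Sum>i<n. (w \<bullet> e i) *\<^sub>R e i)" using assms(4,5) by simp
  also have "\<dots> = w" by (rule frame_expansion[OF assms(1-3), symmetric])
  finally show ?thesis .
qed

lemma trace_frame:
  fixes x :: "'a::euclidean_space" and A :: "'a \<Rightarrow> 'a"
  assumes A: "linear A" and f: "norm x = 1" "orthonormal_frame n x e" "DIM('a) = n + 1"
  shows "(\<Sum>b\<in>Basis. A b \<bullet> b) = A x \<bullet> x + (\<Sum>i<n. A (e i) \<bullet> e i)"
proof -
  have *: "(\<Sum>b\<in>Basis. (y \<bullet> b) * (A b \<bullet> y)) = A y \<bullet> y" for y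
  proof -
    have "A y = A (\<Sum>b\<in>Basis. (y \<bullet> b) *\<^sub>R b)" by (simp add: euclidean_representation)
    also have "\<dots> = (\<Sum>b\<in>Basis. (y \<bullet> b) *\<^sub>R A b)" by (simp add: linear_sum[OF A] linear_cmul[OF A])
    finally show ?thesis by (simp add: inner_sum_left)
  qed
  have "(\<Sum>b\<in>Basis. A b \<bullet> b) = (\<Sum>b\<in>Basis. (x \<bullet> b) * (A b \<bullet> x) + (\<Sum>i<n. (e i \<bullet> b) * (A b \<bullet> e i)))"
    by (intro sum.cong refl, subst frame_inner[OF f]) (simp add: inner_commute mult.commute)
  also have "\<dots> = A x \<bullet> x + (\<Sum>i<n. A (e i) \<bullet> e i)"
    by (simp add: sum.distrib * sum.swap[of _ _ Basis])
  finally show ?thesis .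
qed

lemma orthonormal_frame_exists:
  fixes x :: "'a::euclidean_space" and A :: "'a \<Rightarrow> 'a"
  assumes x: "norm x = 1" and n: "DIM('a) = n + 1"
    and A: "linear A" "\<And>v w. A v \<bullet> w = v \<bullet> A w" "A x = 0"
  obtains e r where "orthonormal_frame n x e" "\<And>i. i < n \<Longrightarrow> A (e i) = r i *\<^sub>R e i"
proof -
  define S where "S = {y. x \<bullet> y = 0}"
  have S: "subspace S" by (auto simp: S_def subspace_hyperplane)
  have "x \<noteq> 0" using x by auto
  then have dim: "dim S = n" unfolding S_def using n by (simp add: dim_hyperplane)
  have "A ` S \<subseteq> S" using A(2)[of x] A(3) by (auto simp: S_def)
  from symmetric_eigenbasis[OF A(1,2) S dim this] obtain e r where
    "\<forall>i<n. e i \<in> S \<and> A (e i) = r i *\<^sub>R e i \<and> (\<forall>j<n. e i \<bullet> e j = (if i = j then 1 else 0))" by blast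
  then show thesis
    by (intro that[of e r]) (auto simp: orthonormal_frame_def S_def inner_commute)
qed

lemma det_orthonormal_basis:
  fixes L :: "real^'n \<Rightarrow> real^'n" and f :: "'n \<Rightarrow> real^'n"
  assumes L: "linear L" and f: "\<And>i j. f i \<bullet> f j = (if i = j then 1 else 0)"
  shows "Determinants.det (matrix L) = Determinants.det (\<chi> i j. L (f j) \<bullet> f i)"
proof -
  define Q :: "real^'n^'n" where "Q = (\<chi> i j. f j $ i)"
  have Qkj: "Q $ k $ j = f j $ k" for k j by (simp add: Q_def)
  have colQ: "Finite_Cartesian_Product.column j Q = f j" for j
    by (simp add: Q_def Finite_Cartesian_Product.column_def Finite_Cartesian_Product.vec_eq_iff)
  have QQ: "Finite_Cartesian_Product.transpose Q ** Q = Finite_Cartesian_Product.mat 1"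
    by (simp add: Q_def matrix_matrix_mult_def Finite_Cartesian_Product.transpose_def Finite_Cartesian_Product.vec_eq_iff
        Finite_Cartesian_Product.mat_def f flip: inner_vec_def[of "f _" "f _", simplified])
  have M: "Finite_Cartesian_Product.transpose Q ** (matrix L ** Q) = (\<chi> i j. L (f j) \<bullet> f i)"
  proof -
    have "(matrix L ** Q) $ k $ j = L (f j) $ k" for k j
    proof -
      have "matrix L ** Q *v axis j 1 = matrix L *v (Q *v axis j 1)" by (simp add: matrix_vector_mul_assoc)
      also have "\<dots> = L (f j)" by (simp add: colQ L matrix_vector_mult_basis)
      finally have "Finite_Cartesian_Product.column j (matrix L ** Q) = L (f j)" by (simp add: matrix_vector_mult_basis)
      then show ?thesis by (auto simp: Finite_Cartesian_Product.column_def Finite_Cartesian_Product.vec_eq_iff)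
    qed
    then show ?thesis
      unfolding matrix_matrix_mult_def[of "Finite_Cartesian_Product.transpose Q"]
      by (simp add: Finite_Cartesian_Product.transpose_def Finite_Cartesian_Product.vec_eq_iff Qkj inner_vec_def mult.commute)
  qed
  have "Determinants.det Q * Determinants.det Q = 1"
    using arg_cong[OF QQ, of Determinants.det] by (simp add: Determinants.det_mul Determinants.det_transpose)
  then show ?thesis
    unfolding M[symmetric] by (simp add: Determinants.det_mul Determinants.det_transpose algebra_simps)
qed

text \<open>
  The determinant of a map that is diagonal on a frame of the tangent space at \<open>x\<close>; the image of
  \<open>x\<close> is arbitrary.
\<close>

lemma det_frame:
  fixes L :: "real^'n::{finite,wellorder} \<Rightarrow> real^'n::_"
  assumes L: "linear L" and x: "norm x = 1" and e: "orthonormal_frame n x e" and n: "CARD('n) = n + 1"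
    and Le: "\<And>i. i < n \<Longrightarrow> L (e i) = c i *\<^sub>R e i"
  shows "Determinants.det (matrix L) = (L x \<bullet> x) * (\<Prod>i<n. c i)"
proof -
  \<comment> \<open>with \<open>x\<close> at the least index, the matrix in the frame is lower triangular\<close>
  define i0 :: 'n where "i0 = (LEAST i. True)"
  have i0: "i0 \<le> i" for i unfolding i0_def by (simp add: Least_le)
  have "card (UNIV - {i0}) = card {..<n}" using n by simp
  then obtain h where h: "bij_betw h (UNIV - {i0}) {..<n}"
    using finite_same_card_bij[of "UNIV - {i0}" "{..<n}"] by auto
  define f where "f i = (if i = i0 then x else e (h i))" for i
  have hn: "h i < n" if "i \<noteq> i0" for i using h that by (auto simp: bij_betw_def)
  have hi: "h i = h j \<longleftrightarrow> i = j" if "i \<noteq> i0" "j \<noteq> i0" for i j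
    using h that by (auto simp: bij_betw_def inj_on_def)
  have xx: "x \<bullet> x = 1" using x by (simp add: dot_square_norm)
  have f: "f i \<bullet> f j = (if i = j then 1 else 0)" for i j
    using e xx hn hi by (auto simp: f_def orthonormal_frame_def inner_commute)
  have off: "L (f j) \<bullet> f i = 0" if "i < j" for i j
  proof -
    have "j \<noteq> i0" using that i0[of i] by auto
    then have "L (f j) \<bullet> f i = c (h j) * (f j \<bullet> f i)" using hn Le by (simp add: f_def)
    then show ?thesis using f that by simp
  qed
  have "Determinants.det (matrix L) = (\<Prod>i\<in>UNIV. L (f i) \<bullet> f i)"
    unfolding det_orthonormal_basis[OF L f]
    using off by (subst Determinants.det_lowerdiagonal) auto
  also have "\<dots> = (L x \<bullet> x) * (\<Prod>i\<in>UNIV - {i0}. L (f i) \<bullet> f i)"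
    by (subst prod.remove[of _ i0]) (auto simp: f_def)
  also have "(\<Prod>i\<in>UNIV - {i0}. L (f i) \<bullet> f i) = (\<Prod>i\<in>UNIV - {i0}. c (h i))"
  proof (rule prod.cong[OF refl])
    fix i assume "i \<in> UNIV - {i0}"
    then have "L (f i) = c (h i) *\<^sub>R f i" using hn Le by (simp add: f_def)
    then show "L (f i) \<bullet> f i = c (h i)" using f by simp
  qed
  also have "\<dots> = (\<Prod>i<n. c i)"
    by (rule prod.reindex_bij_betw[OF h])
  finally show ?thesis .
qed

text \<open>The dual case: \<open>x\<close> is an eigenvector and the images of the frame may have a normal part.\<close>

lemma det_frame':
  fixes L :: "real^'n::{finite,wellorder} \<Rightarrow> real^'n::_"
  assumes L: "linear L" and x: "norm x = 1" and e: "orthonormal_frame n x e" and n: "CARD('n) = n + 1"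
    and Lx: "L x = a *\<^sub>R x" and Le: "\<And>i. i < n \<Longrightarrow> L (e i) = c i *\<^sub>R e i + d i *\<^sub>R x"
  shows "Determinants.det (matrix L) = a * (\<Prod>i<n. c i)"
proof -
  have D: "DIM(real^'n::_) = n + 1" using n by simp
  have xx: "x \<bullet> x = 1" using x by (simp add: dot_square_norm)
  have ee: "e i \<bullet> x = 0" "e i \<bullet> e j = (if i = j then 1 else 0)" if "i < n" "j < n" for i j
    using e that by (auto simp: orthonormal_frame_def)
  have "Determinants.det (matrix L) = Determinants.det (matrix (adjoint L))"
    by (simp add: matrix_adjoint L Determinants.det_transpose)
  also have "\<dots> = (adjoint L x \<bullet> x) * (\<Prod>i<n. c i)"
  proof (rule det_frame[OF adjoint_linear[OF L] x e n])
    fix i assume i: "i < n"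
    show "adjoint L (e i) = c i *\<^sub>R e i"
    proof (rule frame_eqI[OF x e D])
      show "adjoint L (e i) \<bullet> x = (c i *\<^sub>R e i) \<bullet> x"
        using ee[OF i i] by (simp add: adjoint_clauses[OF L] Lx)
      show "adjoint L (e i) \<bullet> e j = (c i *\<^sub>R e i) \<bullet> e j" if "j < n" for j
        using ee[OF i that] by (simp add: adjoint_clauses[OF L] Le[OF that] inner_add_right)
    qed
  qed
  also have "adjoint L x \<bullet> x = a" by (simp add: adjoint_clauses[OF L] Lx xx)
  finally show ?thesis .
qed

section \<open>The inverse Gauss map of a support function\<close>

text \<open>
  The point of the boundary with outer normal \<open>sgn y\<close>, for the convex body with support
  function \<open>u\<close>, and its derivative in \<open>y\<close>.  At a point \<open>x\<close> of the sphere the latter vanishes on \<open>x\<close>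
  and is \<open>D\<^sup>2u + u g\<close> on the tangent space.
\<close>

definition inv_gauss :: "('a::euclidean_space \<Rightarrow> real) \<Rightarrow> 'a \<Rightarrow> 'a" where
  "inv_gauss u y = u (sgn y) *\<^sub>R sgn y + sphere_grad u (sgn y)"

definition radii_map :: "('a::euclidean_space \<Rightarrow> real) \<Rightarrow> 'a \<Rightarrow> 'a \<Rightarrow> 'a" where
  "radii_map u x v = frechet_derivative (inv_gauss u) (at x) v"

text \<open>
  Smoothness of a function on the sphere, stated for its radially constant extension to the
  complement of the origin.
\<close>

definition smooth_radial :: "('a::euclidean_space \<Rightarrow> real) \<Rightarrow> bool" where
  "smooth_radial u \<longleftrightarrow> (\<forall>k. Ck_on k (- {0}) (\<lambda>y. u (sgn y)))"

lemma sgn_eq_self: "norm x = 1 \<Longrightarrow> sgn x = (x :: 'a::real_normed_vector)"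
  by (simp add: sgn_div_norm)

lemma norm_sgn_1: "y \<noteq> 0 \<Longrightarrow> norm (sgn y) = (1::real)"
  by (simp add: norm_sgn)

lemma sgn_sgn': "sgn (sgn y) = sgn (y :: 'a::real_normed_vector)"
  by (cases "y = 0") (simp_all add: sgn_div_norm)

lemma inner_self_1: "norm x = 1 \<Longrightarrow> x \<bullet> x = (1::real)"
  by (simp add: dot_square_norm)

lemma norm_scale_sgn: "norm y *\<^sub>R sgn y = (y :: 'a::real_normed_vector)"
  by (cases "y = 0") (simp_all add: sgn_div_norm)

lemma sgn_scale_pos: "c > 0 \<Longrightarrow> sgn (c *\<^sub>R y) = sgn (y :: 'a::real_normed_vector)"
  by (simp add: sgn_scaleR)

lemma inner_sgn_self: "y \<bullet> sgn y = norm (y :: 'a::real_inner)"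
  by (cases "y = 0") (simp_all add: sgn_div_norm power2_norm_eq_inner[symmetric] power2_eq_square)

lemma tangent_proj_orth: "v \<bullet> x = 0 \<Longrightarrow> tangent_proj x v = v"
  by (simp add: tangent_proj_def)

lemma tangent_proj_self: "norm x = 1 \<Longrightarrow> tangent_proj x x = 0"
  by (simp add: tangent_proj_def inner_self_1)

text \<open>The derivative of a radially constant function is homogeneous of degree \<open>-1\<close>.\<close>

lemma has_derivative_radial:
  fixes f :: "'a::euclidean_space \<Rightarrow> 'b::real_normed_vector"
  assumes f: "\<And>y. f (sgn y) = f y" and y: "y \<noteq> 0" and d: "(f has_derivative f') (at (sgn y))"
  shows "(f has_derivative (\<lambda>v. (1 / norm y) *\<^sub>R f' v)) (at y)"
proof -
  have "((\<lambda>z. (1 / norm y) *\<^sub>R z) has_derivative (\<lambda>v. (1 / norm y) *\<^sub>R v)) (at y)"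
    by (intro derivative_eq_intros) auto
  moreover have "(1 / norm y) *\<^sub>R y = sgn y" by (simp add: sgn_div_norm divide_inverse)
  ultimately have "((\<lambda>z. f ((1 / norm y) *\<^sub>R z)) has_derivative (\<lambda>v. f' ((1 / norm y) *\<^sub>R v))) (at y)"
    using has_derivative_compose[of "\<lambda>z. (1 / norm y) *\<^sub>R z" _ y UNIV f f'] d by simp
  moreover have "f ((1 / norm y) *\<^sub>R z) = f z" for z
    using f[of z] f[of "(1 / norm y) *\<^sub>R z"] y by (simp add: sgn_scale_pos)
  ultimately show ?thesis
    using linear_cmul[OF has_derivative_linear[OF d]] by simp
qed

lemma has_derivative_sgn:
  fixes y :: "'a::euclidean_space"
  assumes "y \<noteq> 0"
  shows "(sgn has_derivative (\<lambda>v. (1 / norm y) *\<^sub>R tangent_proj (sgn y) v)) (at y)"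
  using assms by (intro has_derivative_radial has_derivative_sgn_sphere)
    (auto simp: sgn_sgn' norm_sgn)

lemma inv_gauss_sgn: "inv_gauss u (sgn y) = inv_gauss u y"
  by (simp add: inv_gauss_def sgn_sgn')

lemma sphere_grad_inner_Basis: "b \<in> Basis \<Longrightarrow> sphere_grad u x \<bullet> b = sphere_deriv u x b"
  by (simp add: sphere_grad_def inner_sum_left inner_Basis if_distrib cong: if_cong)

lemma smooth_radial_differentiable:
  assumes "smooth_radial u" "y \<noteq> 0"
  shows "(\<lambda>y. u (sgn y)) differentiable (at y)"
  using assms Ck_on_differentiable[OF _ open_nonzero, of 0 "\<lambda>y. u (sgn y)" y]
  unfolding smooth_radial_def by blast

lemma Ck_on_sphere_deriv:
  assumes "smooth_radial u" "b \<in> Basis"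
  shows "Ck_on k (- {0}) (\<lambda>y. sphere_deriv u y b)"
  using assms unfolding smooth_radial_def sphere_deriv_def by (metis Ck_on.simps(2))

lemma Ck_on_inv_gauss:
  assumes u: "smooth_radial u" and b: "b \<in> Basis"
  shows "Ck_on k (- {0}) (\<lambda>y. inv_gauss u y \<bullet> b)"
proof -
  have "Ck_on k (- {0}) (\<lambda>y. u (sgn y) * (sgn y \<bullet> b) + sphere_deriv u (sgn y) b)"
    using u Ck_on_sphere_deriv[OF u b]
    by (intro Ck_on_add Ck_on_mult Ck_on_sgn open_nonzero Ck_on_compose_sgn[of k "\<lambda>y. sphere_deriv u y b"])
      (auto simp: smooth_radial_def)
  then show ?thesis
    by (simp add: inv_gauss_def inner_add_left sphere_grad_inner_Basis[OF b])
qed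

lemma inv_gauss_differentiable:
  assumes "smooth_radial u" "y \<noteq> 0"
  shows "inv_gauss u differentiable (at y)"
proof (rule differentiable_componentwise)
  fix c :: 'a assume c: "c \<in> Basis"
  show "(\<lambda>y. inv_gauss u y \<bullet> c) differentiable (at y)"
    by (rule Ck_on_differentiable[OF Ck_on_inv_gauss[OF assms(1) c] open_nonzero]) (use assms(2) in simp)
qed

lemma inv_gauss_has_derivative_at:
  assumes "smooth_radial u" "y \<noteq> 0"
  shows "(inv_gauss u has_derivative radii_map u y) (at y)"
  using inv_gauss_differentiable[OF assms] unfolding radii_map_def[abs_def]
  by (simp add: frechet_derivative_works[symmetric])

lemma inv_gauss_has_derivative:
  assumes "smooth_radial u" "y \<noteq> 0"
  shows "(inv_gauss u has_derivative (\<lambda>v. (1 / norm y) *\<^sub>R radii_map u (sgn y) v)) (at y)"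
  using assms by (intro has_derivative_radial inv_gauss_has_derivative_at) (auto simp: inv_gauss_sgn sgn_zero_iff)

lemma radii_map_linear:
  assumes "smooth_radial u" "y \<noteq> 0"
  shows "linear (radii_map u y)"
  using has_derivative_linear[OF inv_gauss_has_derivative_at[OF assms]] .

lemma Ck_on_radii_map:
  assumes u: "smooth_radial u" and b: "b \<in> Basis" "c \<in> Basis"
  shows "Ck_on k (- {0}) (\<lambda>y. radii_map u y b \<bullet> c)"
proof (subst Ck_on_cong[OF open_nonzero])
  show "Ck_on k (- {0}) (\<lambda>y. frechet_derivative (\<lambda>y. inv_gauss u y \<bullet> c) (at y) b)"
    using Ck_on_inv_gauss[OF u b(2), of "Suc k"] b(1) by simp
  show "radii_map u y b \<bullet> c = frechet_derivative (\<lambda>y. inv_gauss u y \<bullet> c) (at y) b" if "y \<in> - {0}" for y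
    unfolding radii_map_def using that
    by (subst frechet_derivative_inner_const[OF inv_gauss_differentiable[OF u]]) auto
qed

lemma radii_map_normal:
  assumes u: "smooth_radial u" and x: "norm x = 1"
  shows "radii_map u x x = 0"
proof -
  have xn: "x \<noteq> 0" using x by auto
  have "sphere_deriv (inv_gauss u) x x = radii_map u x (tangent_proj x x)"
    using x by (intro sphere_deriv_eq inv_gauss_has_derivative_at[OF u xn]) auto
  moreover have "sphere_deriv (inv_gauss u) x x = radii_map u x x"
    by (simp add: sphere_deriv_def radii_map_def inv_gauss_sgn)
  ultimately show ?thesis
    using linear_0[OF radii_map_linear[OF u xn]] by (simp add: tangent_proj_self[OF x])
qed

lemma sphere_grad_inner:
  assumes u: "smooth_radial u" and x: "norm x = 1"
  shows "sphere_grad u x \<bullet> v = sphere_deriv u x v" and "sphere_grad u x \<bullet> x = 0"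
proof -
  have "(\<lambda>y. u (sgn y)) differentiable (at x)"
    using x by (intro smooth_radial_differentiable[OF u]) auto
  from sphere_grad[OF _ this] x show "sphere_grad u x \<bullet> v = sphere_deriv u x v" "sphere_grad u x \<bullet> x = 0"
    by auto
qed

lemma inv_gauss_inner_self:
  assumes "smooth_radial u" "norm x = 1"
  shows "inv_gauss u x \<bullet> x = u x"
  using assms sphere_grad_inner(2)[OF assms]
  by (simp add: inv_gauss_def inner_add_left sgn_eq_self inner_self_1)

lemma u_sgn_has_derivative:
  assumes u: "smooth_radial u" and y: "y \<noteq> 0"
  shows "((\<lambda>y. u (sgn y)) has_derivative (\<lambda>v. (1 / norm y) * (sphere_grad u (sgn y) \<bullet> v))) (at y)"
proof -
  have "((\<lambda>y. u (sgn y)) has_derivative sphere_deriv u (sgn y)) (at (sgn y))"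
    using smooth_radial_differentiable[OF u, of "sgn y"] y
    by (simp add: sphere_deriv_def[abs_def] frechet_derivative_works[symmetric] sgn_zero_iff)
  from has_derivative_radial[OF _ y this] show ?thesis
    using sphere_grad_inner(1)[OF u norm_sgn_1[OF y]] by (simp add: sgn_sgn')
qed

text \<open>The gradient of the one-homogeneous extension of the support function is the inverse Gauss map.\<close>

lemma homogeneous_has_derivative:
  assumes u: "smooth_radial u" and y: "y \<noteq> 0"
  shows "((\<lambda>y. norm y * u (sgn y)) has_derivative (\<lambda>v. inv_gauss u y \<bullet> v)) (at y)"
  using y by (auto intro!: derivative_eq_intros has_derivative_norm u_sgn_has_derivative[OF u]
      simp: inv_gauss_def inner_add_left inner_add_right inner_commute)

lemma radii_map_inner_normal:
  assumes u: "smooth_radial u" and x: "norm x = 1"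
  shows "radii_map u x v \<bullet> x = 0"
proof -
  have xn: "x \<noteq> 0" using x by auto
  have "((\<lambda>y. inv_gauss u y \<bullet> y) has_derivative (\<lambda>v. inv_gauss u x \<bullet> v + radii_map u x v \<bullet> x)) (at x)"
    by (intro has_derivative_inner inv_gauss_has_derivative_at[OF u xn] has_derivative_ident)
  moreover have "inv_gauss u y \<bullet> y = norm y * u (sgn y)" for y
  proof (cases "y = 0")
    case False
    then show ?thesis
      using inv_gauss_inner_self[OF u norm_sgn_1[OF False]]
      by (metis inner_scaleR_right inv_gauss_sgn norm_scale_sgn)
  qed auto
  ultimately have "(\<lambda>v. inv_gauss u x \<bullet> v + radii_map u x v \<bullet> x) = (\<lambda>v. inv_gauss u x \<bullet> v)"
    using homogeneous_has_derivative[OF u xn] has_derivative_unique by (metis (no_types, lifting) ext)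
  from fun_cong[OF this, of v] show ?thesis by simp
qed

text \<open>
  On the sphere the map is the second derivative of the one-homogeneous extension of \<open>u\<close>.
\<close>

lemma radii_map_symmetric:
  assumes u: "smooth_radial u" and x: "norm x = 1"
  shows "radii_map u x v \<bullet> w = v \<bullet> radii_map u x w"
proof -
  let ?h = "\<lambda>y. norm y * u (sgn y)"
  have xn: "x \<noteq> 0" using x by auto
  have lin: "linear (radii_map u x)" by (rule radii_map_linear[OF u xn])
  have D: "frechet_derivative ?h (at y) b = inv_gauss u y \<bullet> b" if "y \<in> - {0}" for y b
    using fun_cong[OF frechet_derivative_at[OF homogeneous_has_derivative[OF u, of y]], of b] that by simp
  have dh: "?h differentiable_on - {0}"
    unfolding differentiable_on_eq_differentiable_at[OF open_nonzero] differentiable_def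
    using homogeneous_has_derivative[OF u] by blast
  have "Ck_on (Suc 1) (- {0}) ?h"
    unfolding Ck_on.simps(2)
  proof (intro conjI ballI dh)
    fix b :: 'a assume b: "b \<in> Basis"
    show "Ck_on 1 (- {0}) (\<lambda>y. frechet_derivative ?h (at y) b)"
      by (rule Ck_on_cong[OF open_nonzero D, THEN iffD2, OF _ Ck_on_inv_gauss[OF u b]])
  qed
  then have h: "Ck_on 2 (- {0}) ?h" by (simp add: numeral_2_eq_2)
  have X: "frechet_derivative (\<lambda>y. frechet_derivative ?h (at y) a) (at x) b = radii_map u x b \<bullet> a" for a b
  proof -
    have "((\<lambda>y. inv_gauss u y \<bullet> a) has_derivative (\<lambda>v. radii_map u x v \<bullet> a)) (at x)"
      by (intro has_derivative_inner_left inv_gauss_has_derivative_at[OF u xn])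
    then have "((\<lambda>y. frechet_derivative ?h (at y) a) has_derivative (\<lambda>v. radii_map u x v \<bullet> a)) (at x)"
      by (rule has_derivative_transform_within_open[OF _ open_nonzero]) (use xn D in auto)
    from fun_cong[OF frechet_derivative_at[OF this]] show ?thesis by simp
  qed
  have basis: "radii_map u x b \<bullet> a = radii_map u x a \<bullet> b" if "a \<in> Basis" "b \<in> Basis" for a b
  proof -
    have "x \<in> - {0}" using xn by simp
    then have "frechet_derivative (\<lambda>y. frechet_derivative ?h (at y) a) (at x) b
        = frechet_derivative (\<lambda>y. frechet_derivative ?h (at y) b) (at x) a"
      by (rule second_derivative_symmetric[OF open_nonzero _ h that])
    then show ?thesis
      by (simp only: X)
  qed
  have "radii_map u x = adjoint (radii_map u x)"
  proof (rule linear_eq_stdbasis[OF lin adjoint_linear[OF lin]])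
    fix b :: 'a assume b: "b \<in> Basis"
    show "radii_map u x b = adjoint (radii_map u x) b"
    proof (rule euclidean_eqI)
      fix a :: 'a assume a: "a \<in> Basis"
      show "radii_map u x b \<bullet> a = adjoint (radii_map u x) b \<bullet> a"
        unfolding adjoint_clauses(2)[OF lin] basis[OF a b] by (rule inner_commute)
    qed
  qed
  then have "radii_map u x v \<bullet> w = adjoint (radii_map u x) v \<bullet> w" by (rule arg_cong)
  also have "\<dots> = v \<bullet> radii_map u x w" by (rule adjoint_clauses(2)[OF lin])
  finally show ?thesis .
qed

lemma radii_map_hessian:
  assumes u: "smooth_radial u" and x: "norm x = 1" and vw: "v \<bullet> x = 0" "w \<bullet> x = 0"
  shows "radii_map u x v \<bullet> w = sphere_hessian u x v w + u x * (v \<bullet> w)"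
proof -
  have xn: "x \<noteq> 0" using x by auto
  have du: "((\<lambda>y. u (sgn y)) has_derivative (\<lambda>v. sphere_grad u x \<bullet> v)) (at x)"
    using u_sgn_has_derivative[OF u xn] x by (simp add: sgn_eq_self)
  have ds: "(sgn has_derivative tangent_proj x) (at x)"
    using x by (intro has_derivative_sgn_sphere) auto
  have "(\<lambda>y. sphere_grad u (sgn y)) differentiable (at x)"
  proof (rule differentiable_componentwise)
    fix c :: 'a assume c: "c \<in> Basis"
    show "(\<lambda>y. sphere_grad u (sgn y) \<bullet> c) differentiable (at x)"
      unfolding sphere_grad_inner_Basis[OF c]
      by (rule Ck_on_differentiable[OF Ck_on_compose_sgn[OF Ck_on_sphere_deriv[OF u c]] open_nonzero]) (use xn in simp)
  qed
  then have dg: "((\<lambda>y. sphere_grad u (sgn y)) has_derivative sphere_deriv (sphere_grad u) x) (at x)"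
    by (simp add: sphere_deriv_def[abs_def] frechet_derivative_works[symmetric])
  have "(inv_gauss u has_derivative (\<lambda>v. (u (sgn x) *\<^sub>R tangent_proj x v + (sphere_grad u x \<bullet> v) *\<^sub>R sgn x)
       + sphere_deriv (sphere_grad u) x v)) (at x)"
    unfolding inv_gauss_def[abs_def]
    by (intro has_derivative_add has_derivative_scaleR du ds dg)
  from fun_cong[OF frechet_derivative_at[OF this], of v]
  have "radii_map u x v = u x *\<^sub>R v + (sphere_grad u x \<bullet> v) *\<^sub>R x + sphere_deriv (sphere_grad u) x v"
    using x vw by (simp add: radii_map_def sgn_eq_self tangent_proj_orth)
  then show ?thesis
    using vw by (simp add: sphere_hessian_def levi_civita_def tangent_proj_def inner_add_left inner_diff_left
        inner_add_right inner_diff_right inner_commute)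
qed

lemma continuous_on_radii_map:
  assumes u: "smooth_radial u"
  shows "continuous_on (- {0}) (\<lambda>y. radii_map u y v)"
proof -
  have "continuous_on (- {0}) (\<lambda>y. radii_map u y b)" if b: "b \<in> Basis" for b
    using Ck_on_continuous[OF Ck_on_radii_map[OF u b]] by (intro continuous_on_componentwise[THEN iffD2]) auto
  then have "continuous_on (- {0}) (\<lambda>y. \<Sum>b\<in>Basis. (v \<bullet> b) *\<^sub>R radii_map u y b)"
    by (intro continuous_intros) auto
  then show ?thesis
    by (rule continuous_on_eq)
      (use frechet_derivative_eq_sum_Basis[OF inv_gauss_differentiable[OF u], of _ v] in \<open>auto simp: radii_map_def\<close>)
qed

lemma radii_map_bounded:
  assumes u: "smooth_radial u"
  obtains M where "M > 0" "\<And>x v. norm x = 1 \<Longrightarrow> norm (radii_map u x v) \<le> M * norm v"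
proof -
  have "\<exists>m. \<forall>x\<in>sphere 0 1. norm (radii_map u x b) \<le> m" for b
  proof -
    have "compact ((\<lambda>x. radii_map u x b) ` sphere 0 1)"
      by (intro compact_continuous_image continuous_on_subset[OF continuous_on_radii_map[OF u]]) auto
    from compact_imp_bounded[OF this] show ?thesis by (auto simp: bounded_iff)
  qed
  then obtain m where m: "\<And>b x. norm x = 1 \<Longrightarrow> norm (radii_map u x b) \<le> m b"
    by (metis mem_sphere_0)
  show thesis
  proof (rule that[of "1 + (\<Sum>b\<in>Basis. \<bar>m b\<bar>)"])
    fix x v :: 'a assume x: "norm x = 1"
    then have "radii_map u x v = (\<Sum>b\<in>Basis. (v \<bullet> b) *\<^sub>R radii_map u x b)"
      unfolding radii_map_def by (intro frechet_derivative_eq_sum_Basis inv_gauss_differentiable[OF u]) auto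
    also have "norm \<dots> \<le> (\<Sum>b\<in>Basis. norm v * \<bar>m b\<bar>)"
    proof (rule sum_norm_le)
      fix b :: 'a assume "b \<in> Basis"
      then have "\<bar>v \<bullet> b\<bar> \<le> norm v" by (rule Basis_le_norm)
      then show "norm ((v \<bullet> b) *\<^sub>R radii_map u x b) \<le> norm v * \<bar>m b\<bar>"
        using m[OF x, of b] by (auto intro!: mult_mono)
    qed
    also have "\<dots> = (\<Sum>b\<in>Basis. \<bar>m b\<bar>) * norm v" by (simp add: sum_distrib_left mult.commute)
    also have "\<dots> \<le> (1 + (\<Sum>b\<in>Basis. \<bar>m b\<bar>)) * norm v" by (simp add: algebra_simps)
    finally show "norm (radii_map u x v) \<le> (1 + (\<Sum>b\<in>Basis. \<bar>m b\<bar>)) * norm v" .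
  qed (auto intro!: add_pos_nonneg sum_nonneg)
qed

section \<open>Convex bodies with smooth support function\<close>

text \<open>
  The support function of a strictly convex body with the origin in its interior.
\<close>

locale convex_support =
  fixes u :: "'a::euclidean_space \<Rightarrow> real" and n :: nat
  assumes u: "smooth_radial u"
    and pos: "\<And>x. norm x = 1 \<Longrightarrow> u x > 0"
    and convex: "\<And>x v. norm x = 1 \<Longrightarrow> v \<bullet> x = 0 \<Longrightarrow> v \<noteq> 0 \<Longrightarrow> radii_map u x v \<bullet> v > 0"
    and n: "DIM('a) = n + 1" "n \<ge> 1"
begin

abbreviation "X \<equiv> inv_gauss u"
abbreviation "A \<equiv> radii_map u"

lemma nonzero: "norm x = 1 \<Longrightarrow> x \<noteq> (0::'a)"
  by auto

lemma A_linear: "norm x = 1 \<Longrightarrow> linear (A x)"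
  by (rule radii_map_linear[OF u nonzero])

lemma A_inner_tangent:
  assumes x: "norm x = 1"
  shows "A x v \<bullet> v = A x (tangent_proj x v) \<bullet> tangent_proj x v"
proof -
  have "A x (tangent_proj x v) = A x v"
    using linear_diff[OF A_linear[OF x]] linear_cmul[OF A_linear[OF x]] radii_map_normal[OF u x]
    by (simp add: tangent_proj_def)
  moreover have "A x v \<bullet> tangent_proj x v = A x v \<bullet> v"
    unfolding tangent_proj_def inner_diff_right inner_scaleR_right radii_map_inner_normal[OF u x] by simp
  ultimately show ?thesis by (simp only:)
qed

lemma tangent_proj_tangent: "norm x = 1 \<Longrightarrow> tangent_proj x v \<bullet> x = 0"
  by (simp add: tangent_proj_def inner_diff_left inner_self_1)

lemma A_pos:
  assumes x: "norm x = 1" and v: "tangent_proj x v \<noteq> 0"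
  shows "A x v \<bullet> v > 0"
  by (subst A_inner_tangent[OF x]) (rule convex[OF x tangent_proj_tangent[OF x] v])

text \<open>
  The boundary point with normal \<open>x\<close> lies strictly inside the other supporting half-spaces.  Along
  the segment from \<open>x\<close> to \<open>y\<close> the function \<open>X (c t) \<bullet> y\<close> increases, by convexity.  The segment to the
  antipode meets the origin, but there the claim is the positivity of \<open>u\<close>.
\<close>

lemma X_inner_less:
  assumes x: "norm x = 1" and y: "norm y = 1" and ne: "x \<noteq> y"
  shows "X x \<bullet> y < u y"
proof (cases "y = - x")
  case True
  then show ?thesis using inv_gauss_inner_self[OF u x] pos[OF x] pos[OF y] by simp
next
  case False
  define w where "w = y - x"
  define c where "c t = x + t *\<^sub>R w" for t
  have not_par: "x \<noteq> a *\<^sub>R z \<or> y \<noteq> b *\<^sub>R z" for a b z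
  proof (rule ccontr)
    assume "\<not> (x \<noteq> a *\<^sub>R z \<or> y \<noteq> b *\<^sub>R z)"
    then have xy: "x = a *\<^sub>R z" "y = b *\<^sub>R z" by auto
    then have "\<bar>a\<bar> * norm z = \<bar>b\<bar> * norm z" "norm z \<noteq> 0" using x y by auto
    then have "a = b \<or> a = - b" by auto
    then show False using xy ne False by auto
  qed
  have c0: "c t \<noteq> 0" for t
  proof
    assume "c t = 0"
    then have "x = (t - 1 + 1) *\<^sub>R (x - y)" "(1 - t) *\<^sub>R x + t *\<^sub>R y = 0"
      by (auto simp: c_def w_def algebra_simps)
    then have eq: "(1 - t) *\<^sub>R x = - (t *\<^sub>R y)" by (simp add: eq_neg_iff_add_eq_0)
    show False
    proof (cases "t = 0")
      case True
      then show False using eq x by auto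
    next
      case tne: False
      have "t *\<^sub>R y = (t - 1) *\<^sub>R x" using eq by (simp add: algebra_simps)
      then have "(1 / t) *\<^sub>R (t *\<^sub>R y) = (1 / t) *\<^sub>R ((t - 1) *\<^sub>R x)" by simp
      then have "y = ((t - 1) / t) *\<^sub>R x" using tne by simp
      moreover have "x = 1 *\<^sub>R x" by simp
      ultimately show False using not_par[of 1 x] by blast
    qed
  qed
  have der: "((\<lambda>t. X (c t) \<bullet> y) has_real_derivative (1 / norm (c t)) * (A (sgn (c t)) w \<bullet> y)) (at t)" for t
    unfolding c_def
  proof (rule has_real_derivative_along[where f="\<lambda>z. X z \<bullet> y" and
        f'="\<lambda>v. (1 / norm (x + t *\<^sub>R w)) * (A (sgn (x + t *\<^sub>R w)) v \<bullet> y)"])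
    show "((\<lambda>z. X z \<bullet> y) has_derivative (\<lambda>v. (1 / norm (x + t *\<^sub>R w)) * (A (sgn (x + t *\<^sub>R w)) v \<bullet> y))) (at (x + t *\<^sub>R w))"
      using has_derivative_inner_left[OF inv_gauss_has_derivative[OF u c0[of t, unfolded c_def]], of y] by simp
  qed
  have "\<exists>t. 0 < t \<and> t < 1 \<and> X (c 1) \<bullet> y - X (c 0) \<bullet> y = (1 - 0) * ((1 / norm (c t)) * (A (sgn (c t)) w \<bullet> y))"
    by (rule MVT2) (use der in auto)
  then obtain t where t: "0 < t" "t < 1"
    and eq: "X (c 1) \<bullet> y - X (c 0) \<bullet> y = (1 / norm (c t)) * (A (sgn (c t)) w \<bullet> y)" by auto
  define z where "z = sgn (c t)"
  have z: "norm z = 1" using c0 by (simp add: z_def norm_sgn)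
  have cz: "c t = norm (c t) *\<^sub>R z" by (simp add: z_def norm_scale_sgn)
  have yc: "y = c t + (1 - t) *\<^sub>R w" by (simp add: c_def w_def algebra_simps)
  have "A z w \<bullet> c t = norm (c t) * (A z w \<bullet> z)" by (subst cz) simp
  then have "A z w \<bullet> y = (1 - t) * (A z w \<bullet> w)"
    unfolding yc by (simp add: inner_add_right radii_map_inner_normal[OF u z])
  moreover have "A z w \<bullet> w > 0"
  proof (rule A_pos[OF z], rule notI)
    assume "tangent_proj z w = 0"
    then have w: "w = (w \<bullet> z) *\<^sub>R z" by (simp add: tangent_proj_def)
    have "y = (norm (c t) + (1 - t) * (w \<bullet> z)) *\<^sub>R z"
      unfolding scaleR_add_left scaleR_scaleR[symmetric] using yc cz w by metis
    moreover have "x = c t - t *\<^sub>R w" by (simp add: c_def)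
    then have "x = (norm (c t) - t * (w \<bullet> z)) *\<^sub>R z"
      unfolding scaleR_diff_left scaleR_scaleR[symmetric] using cz w by metis
    ultimately show False using not_par by blast
  qed
  ultimately have "X (c 1) \<bullet> y - X (c 0) \<bullet> y > 0"
    unfolding eq z_def[symmetric] using t c0[of t] by simp
  moreover have "c 1 = y" "c 0 = x" by (auto simp: c_def w_def)
  ultimately show ?thesis using inv_gauss_inner_self[OF u y] by simp
qed

lemma X_inner_le: "norm x = 1 \<Longrightarrow> norm y = 1 \<Longrightarrow> X x \<bullet> y \<le> u y"
  using X_inner_less[of x y] inv_gauss_inner_self[OF u] by (cases "x = y") auto

lemma tangent_proj_inner: "z \<bullet> tangent_proj x v = tangent_proj x z \<bullet> v"
  by (simp add: tangent_proj_def inner_diff_left inner_diff_right inner_commute)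

text \<open>
  Where \<open>z \<bullet> y - a * u y\<close> is maximal on the sphere its tangential derivative vanishes, which
  recovers \<open>z\<close> from the position of the maximum and its value.
\<close>

lemma first_order_condition:
  assumes x: "norm x = 1" and max: "\<And>y. norm y = 1 \<Longrightarrow> z \<bullet> y - a * u y \<le> z \<bullet> x - a * u x"
  shows "z = a *\<^sub>R X x + (z \<bullet> x - a * u x) *\<^sub>R x"
proof -
  let ?f = "\<lambda>y. z \<bullet> sgn y - a * u (sgn y)"
  have d: "(?f has_derivative (\<lambda>v. z \<bullet> tangent_proj x v - a * (sphere_grad u x \<bullet> v))) (at x)"
    using has_derivative_diff[OF has_derivative_inner_right[OF has_derivative_sgn_sphere, of x z]
        has_derivative_mult_right[OF u_sgn_has_derivative[OF u nonzero[OF x]], of a]] x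
    by (simp add: sgn_eq_self)
  have "(\<forall>y\<in>- {0}. ?f x \<le> ?f y) \<or> (\<forall>y\<in>- {0}. ?f y \<le> ?f x)"
    using max by (simp add: sgn_eq_self[OF x] norm_sgn)
  then have "(\<lambda>v. z \<bullet> tangent_proj x v - a * (sphere_grad u x \<bullet> v)) = (\<lambda>v. 0)"
    using nonzero[OF x] by (intro differential_zero_maxmin[OF _ open_nonzero d]) auto
  from fun_cong[OF this] have "(tangent_proj x z - a *\<^sub>R sphere_grad u x) \<bullet> v = 0" for v
    by (simp add: tangent_proj_inner inner_diff_left)
  from this[of "tangent_proj x z - a *\<^sub>R sphere_grad u x"]
  have "tangent_proj x z = a *\<^sub>R sphere_grad u x" by simp
  then show ?thesis
    by (simp add: inv_gauss_def sgn_eq_self[OF x] tangent_proj_def algebra_simps)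
qed

text \<open>
  At a maximum of \<open>z \<bullet> y - u y\<close> with value \<open>s\<close> the second derivative is nonpositive, so that all
  radii of curvature are at least \<open>- s\<close>.
\<close>

lemma second_order_condition:
  assumes x: "norm x = 1" and max: "\<And>y. norm y = 1 \<Longrightarrow> z \<bullet> y - u y \<le> z \<bullet> x - u x" and v: "v \<bullet> x = 0"
  shows "A x v \<bullet> v + (z \<bullet> x - u x) * (v \<bullet> v) \<ge> 0"
proof (rule ccontr)
  define s where "s = z \<bullet> x - u x"
  assume "\<not> ?thesis"
  then have neg: "A x v \<bullet> v + s * (v \<bullet> v) < 0" by (simp add: s_def)
  have z: "z = X x + s *\<^sub>R x"
    using first_order_condition[OF x, of z 1] max by (simp add: s_def)
  \<comment> \<open>nonnegative, zero at \<open>x\<close>, with gradient \<open>G\<close>; contradicted along the line \<open>x + t v\<close>\<close>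
  define g where "g y = norm y * u (sgn y) + s * norm y - z \<bullet> y" for y
  define G where "G y = X y + s *\<^sub>R sgn y - z" for y
  have xv: "x + t *\<^sub>R v \<noteq> 0" for t
  proof
    assume "x + t *\<^sub>R v = 0"
    then have "(x + t *\<^sub>R v) \<bullet> x = 0" by simp
    then show False using v inner_self_1[OF x] by (simp add: inner_add_left)
  qed
  have g_nonneg: "g y \<ge> 0" if "y \<noteq> 0" for y
  proof -
    have "z \<bullet> sgn y \<le> u (sgn y) + s" using max[OF norm_sgn_1[OF that]] by (simp add: s_def)
    then have "norm y * (z \<bullet> sgn y) \<le> norm y * (u (sgn y) + s)" by (rule mult_left_mono) auto
    moreover have "norm y * (z \<bullet> sgn y) = z \<bullet> y" by (metis inner_scaleR_right norm_scale_sgn)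
    ultimately show ?thesis by (simp add: g_def algebra_simps)
  qed
  have g_x: "g x = 0" by (simp add: g_def x sgn_eq_self s_def)
  have dg: "(g has_derivative (\<lambda>w. G y \<bullet> w)) (at y)" if "y \<noteq> 0" for y
  proof -
    have "((\<lambda>y. norm y * u (sgn y) + s * norm y - z \<bullet> y) has_derivative (\<lambda>w. X y \<bullet> w + s * (w \<bullet> sgn y) - z \<bullet> w)) (at y)"
      by (intro has_derivative_diff has_derivative_add homogeneous_has_derivative[OF u that]
          has_derivative_mult_right has_derivative_norm[OF that] has_derivative_inner_right has_derivative_ident)
    moreover have "X y \<bullet> w + s * (w \<bullet> sgn y) - z \<bullet> w = G y \<bullet> w" for w
      by (simp add: G_def inner_diff_left inner_add_left inner_diff_right inner_add_right inner_commute)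
    ultimately show ?thesis
      unfolding g_def[abs_def] by (simp only:)
  qed
  have dG: "((\<lambda>y. G y \<bullet> v) has_derivative (\<lambda>w. (A x w + s *\<^sub>R tangent_proj x w) \<bullet> v)) (at (x + 0 *\<^sub>R v))"
  proof -
    have "((\<lambda>y. X y + s *\<^sub>R sgn y - z) has_derivative (\<lambda>w. A x w + s *\<^sub>R tangent_proj x w - 0)) (at x)"
      by (intro has_derivative_diff has_derivative_add inv_gauss_has_derivative_at[OF u nonzero[OF x]]
          has_derivative_scaleR_right has_derivative_sgn_sphere has_derivative_const) (use x in auto)
    from has_derivative_inner_left[OF this, of v] show ?thesis
      by (simp add: G_def[abs_def])
  qed
  from has_real_derivative_along[OF dG]
  have "((\<lambda>t. G (x + t *\<^sub>R v) \<bullet> v) has_real_derivative (A x v \<bullet> v + s * (v \<bullet> v))) (at 0)"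
    using v by (simp add: inner_add_left tangent_proj_orth)
  from DERIV_neg_dec_right[OF this neg] obtain d where d: "d > 0"
    "\<And>t. t > 0 \<Longrightarrow> t < d \<Longrightarrow> G (x + t *\<^sub>R v) \<bullet> v < G (x + 0 *\<^sub>R v) \<bullet> v" by auto
  have G0: "G (x + 0 *\<^sub>R v) \<bullet> v = 0"
    using z by (simp add: G_def sgn_eq_self[OF x])
  have "\<exists>t. 0 < t \<and> t < d / 2 \<and> g (x + (d / 2) *\<^sub>R v) - g (x + 0 *\<^sub>R v) = (d / 2 - 0) * (G (x + t *\<^sub>R v) \<bullet> v)"
    by (rule MVT2) (use d has_real_derivative_along[OF dg[OF xv]] in auto)
  then obtain t where "0 < t" "t < d / 2" "g (x + (d / 2) *\<^sub>R v) = (d / 2) * (G (x + t *\<^sub>R v) \<bullet> v)"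
    using g_x by auto
  moreover from this have "G (x + t *\<^sub>R v) \<bullet> v < 0"
    using d(1) d(2)[of t] G0 by linarith
  moreover from this have "d / 2 * (G (x + t *\<^sub>R v) \<bullet> v) < 0"
    using d(1) by (intro mult_pos_neg) auto
  ultimately have "g (x + (d / 2) *\<^sub>R v) < 0" by linarith
  then show False using g_nonneg[OF xv] by (meson not_less)
qed

lemma u_continuous: "continuous_on (- {0}) (\<lambda>y. u (sgn y))"
  using u Ck_on_continuous unfolding smooth_radial_def by blast

lemma u_continuous_sphere: "continuous_on (sphere 0 1) u"
proof (rule continuous_on_eq)
  show "continuous_on (sphere 0 1) (\<lambda>y. u (sgn y))"
    by (rule continuous_on_subset[OF u_continuous]) auto
qed (auto simp: sgn_eq_self)

lemma sphere_nonempty: "sphere (0::'a) 1 \<noteq> {}"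
  using n by simp

lemma support_maximum:
  obtains x where "norm x = 1" "\<And>y. norm y = 1 \<Longrightarrow> z \<bullet> y - u y \<le> z \<bullet> x - u x"
proof -
  have "\<exists>x\<in>sphere 0 1. \<forall>y\<in>sphere 0 1. z \<bullet> y - u y \<le> z \<bullet> x - u x"
    by (rule continuous_attains_sup) (auto intro!: continuous_intros u_continuous_sphere simp: sphere_nonempty[simplified])
  then show thesis using that by auto
qed

lemma gauge_maximum:
  obtains x where "norm x = 1" "\<And>y. norm y = 1 \<Longrightarrow> (z \<bullet> y) / u y \<le> (z \<bullet> x) / u x"
proof -
  have "u x \<noteq> 0" if "x \<in> sphere 0 1" for x using pos[of x] that by auto
  then have "\<exists>x\<in>sphere 0 1. \<forall>y\<in>sphere 0 1. (z \<bullet> y) / u y \<le> (z \<bullet> x) / u x"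
    by (intro continuous_attains_sup)
      (auto intro!: continuous_intros u_continuous_sphere simp: sphere_nonempty[simplified])
  then show thesis using that by auto
qed

text \<open>The body whose support function is \<open>u + t\<close>.\<close>

definition body :: "real \<Rightarrow> 'a set" where
  "body t = {z. \<forall>y. norm y = 1 \<longrightarrow> z \<bullet> y \<le> u y + t}"

lemma body_compact: "compact (body t)"
proof -
  have "bounded (body t)"
  proof -
    from compact_imp_bounded[OF compact_continuous_image[OF u_continuous_sphere compact_sphere]]
    obtain M where "\<forall>r\<in>u ` sphere 0 1. norm r \<le> M" unfolding bounded_iff by blast
    then have M: "\<bar>u y\<bar> \<le> M" if "norm y = 1" for y using that by auto
    have "norm z \<le> \<bar>M\<bar> + \<bar>t\<bar>" if "z \<in> body t" for z
    proof (cases "z = 0")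
      case False
      then have "z \<bullet> sgn z \<le> u (sgn z) + t" using that by (simp add: body_def norm_sgn)
      then show ?thesis using M[OF norm_sgn_1[OF False]] by (simp add: inner_sgn_self)
    qed auto
    then show ?thesis by (auto simp: bounded_iff)
  qed
  moreover have "body t = (\<Inter>y\<in>sphere 0 1. {z. y \<bullet> z \<le> u y + t})"
    by (auto simp: body_def inner_commute)
  then have "closed (body t)" by (auto intro!: closed_halfspace_le)
  ultimately show ?thesis by (simp add: compact_eq_bounded_closed)
qed

text \<open>
  A point \<open>z\<close> other than the origin is \<open>a X x\<close> for exactly one \<open>a > 0\<close> and unit vector \<open>x\<close>, namely with
  \<open>x\<close> maximising \<open>(z \<bullet> x) / u x\<close> and \<open>a\<close> this maximum; it is in the body iff \<open>a \<le> 1\<close>.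
\<close>

lemma radial_map_bij:
  "inj_on (\<lambda>y. norm y *\<^sub>R X y) (cball 0 1 - {0})"
  "(\<lambda>y. norm y *\<^sub>R X y) ` (cball 0 1 - {0}) = body 0 - {0}"
proof -
  have gauge_less: "(norm y *\<^sub>R X y) \<bullet> w < norm y * u w" if "y \<noteq> 0" "norm w = 1" "w \<noteq> sgn y" for y w
  proof -
    have "X (sgn y) \<bullet> w < u w" using X_inner_less[OF norm_sgn_1[OF that(1)] that(2)] that(3) by auto
    then show ?thesis using that(1) by (simp add: inv_gauss_sgn)
  qed
  have gauge: "(norm y *\<^sub>R X y) \<bullet> w \<le> norm y * u w" if "y \<noteq> 0" "norm w = 1" for y w
    using X_inner_le[OF norm_sgn_1[OF that(1)] that(2)] by (simp add: inv_gauss_sgn mult_left_mono)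
  have gauge_eq: "(norm y *\<^sub>R X y) \<bullet> sgn y = norm y * u (sgn y)" if "y \<noteq> 0" for y
    using inv_gauss_inner_self[OF u norm_sgn_1[OF that]] by (simp add: inv_gauss_sgn)
  show "inj_on (\<lambda>y. norm y *\<^sub>R X y) (cball 0 1 - {0})"
  proof (rule inj_onI)
    fix y z :: 'a assume yz: "y \<in> cball 0 1 - {0}" "z \<in> cball 0 1 - {0}" and eq: "norm y *\<^sub>R X y = norm z *\<^sub>R X z"
    have y: "y \<noteq> 0" and z: "z \<noteq> 0" using yz by auto
    note sy = norm_sgn_1[OF y] and sz = norm_sgn_1[OF z]
    have 1: "norm y * u (sgn y) \<le> norm z * u (sgn y)"
      using gauge[OF z sy] unfolding eq[symmetric] gauge_eq[OF y] .
    have 2: "norm z * u (sgn z) \<le> norm y * u (sgn z)"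
      using gauge[OF y sz] unfolding eq gauge_eq[OF z] .
    have nn: "norm y = norm z" using 1 2 pos[OF sy] pos[OF sz] by simp
    have "sgn y = sgn z"
    proof (rule ccontr)
      assume "sgn y \<noteq> sgn z"
      from gauge_less[OF z sy this] show False unfolding eq[symmetric] unfolding gauge_eq[OF y] unfolding nn by simp
    qed
    then show "y = z" using nn by (metis norm_scale_sgn)
  qed
  show "(\<lambda>y. norm y *\<^sub>R X y) ` (cball 0 1 - {0}) = body 0 - {0}"
  proof (intro equalityI subsetI)
    fix z assume "z \<in> (\<lambda>y. norm y *\<^sub>R X y) ` (cball 0 1 - {0})"
    then obtain y where "y \<in> cball 0 1 - {0}" and z: "z = norm y *\<^sub>R X y" by blast
    then have y: "y \<noteq> 0" "norm y \<le> 1" by auto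
    have "z \<bullet> w \<le> u w" if w: "norm w = 1" for w
      using gauge[OF y(1) w] y(2) pos[OF w] mult_right_mono[OF y(2), of "u w"] unfolding z by linarith
    moreover have "z \<bullet> sgn y > 0"
      unfolding z gauge_eq[OF y(1)] using pos[OF norm_sgn_1[OF y(1)]] y(1) by simp
    then have "z \<noteq> 0" by auto
    ultimately show "z \<in> body 0 - {0}" by (auto simp: body_def)
  next
    fix z assume z: "z \<in> body 0 - {0}"
    obtain x where x: "norm x = 1" and max: "\<And>y. norm y = 1 \<Longrightarrow> (z \<bullet> y) / u y \<le> (z \<bullet> x) / u x"
      using gauge_maximum by blast
    define a where "a = (z \<bullet> x) / u x"
    have ax: "z \<bullet> x = a * u x" using pos[OF x] by (simp add: a_def)
    have "z \<bullet> y - a * u y \<le> z \<bullet> x - a * u x" if y: "norm y = 1" for y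
    proof -
      have "z \<bullet> y / u y \<le> a" using max[OF y] by (simp only: a_def)
      then have "z \<bullet> y \<le> a * u y" using pos[OF y] by (simp only: pos_divide_le_eq)
      then show ?thesis using ax by simp
    qed
    from first_order_condition[OF x this] have za: "z = a *\<^sub>R X x" using ax by simp
    have "a > 0"
    proof -
      have "z \<bullet> sgn z / u (sgn z) \<le> a" using max[of "sgn z"] z by (simp add: a_def norm_sgn)
      moreover have "z \<bullet> sgn z / u (sgn z) > 0" using z pos[of "sgn z"] by (simp add: inner_sgn_self norm_sgn)
      ultimately show ?thesis by linarith
    qed
    moreover have "a \<le> 1" using z x pos[OF x] by (simp add: a_def body_def)
    moreover have "X (a *\<^sub>R x) = X x"
      using inv_gauss_sgn[of u "a *\<^sub>R x"] inv_gauss_sgn[of u x] sgn_scale_pos[OF \<open>a > 0\<close>, of x] by simp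
    ultimately show "z \<in> (\<lambda>y. norm y *\<^sub>R X y) ` (cball 0 1 - {0})"
      using x by (intro image_eqI[of _ _ "a *\<^sub>R x"]) (auto simp: za)
  qed
qed

text \<open>
  Each point \<open>z\<close> outside the body is \<open>X x + s x\<close> for exactly one unit vector \<open>x\<close> and \<open>s > 0\<close>, namely
  with \<open>x\<close> maximising \<open>z \<bullet> x - u x\<close> and \<open>s\<close> this maximum.
\<close>

lemma tube_map_bij:
  fixes f :: "real \<Rightarrow> real"
  assumes f: "strict_mono_on {1..R} f" "continuous_on {1..R} f" "f 1 = 0" and R: "R \<ge> 1"
  shows "inj_on (\<lambda>y. X y + f (norm y) *\<^sub>R sgn y) (cball 0 R - cball 0 1)"
    and "(\<lambda>y. X y + f (norm y) *\<^sub>R sgn y) ` (cball 0 R - cball 0 1) = body (f R) - body 0"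
proof -
  let ?T = "\<lambda>y. X y + f (norm y) *\<^sub>R sgn y"
  have fpos: "f t > 0" if "1 < t" "t \<le> R" for t
    using strict_mono_onD[OF f(1), of 1 t] that f(3) by auto
  have fle: "f t \<le> f R" if "1 < t" "t \<le> R" for t
    using strict_mono_onD[OF f(1), of t R] that by (cases "t = R") auto
  have finj: "s = t" if "f s = f t" "1 < s" "s \<le> R" "1 < t" "t \<le> R" for s t
    using strict_mono_on_eqD[OF f(1), of s t] that by auto
  have T_self: "?T y \<bullet> sgn y - u (sgn y) = f (norm y)" if "y \<noteq> 0" for y
    using inv_gauss_inner_self[OF u norm_sgn_1[OF that]] inner_self_1[OF norm_sgn_1[OF that]]
    by (simp add: inner_add_left inv_gauss_sgn)
  have T_less: "?T y \<bullet> w - u w < f (norm y)"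
    if "y \<noteq> 0" "norm w = 1" "f (norm y) > 0" "w \<noteq> sgn y" for y w
  proof -
    have "X y \<bullet> w < u w" using X_inner_less[OF norm_sgn_1[OF that(1)] that(2)] that(4) by (auto simp: inv_gauss_sgn)
    moreover have "sgn y \<bullet> w \<le> 1"
      using Cauchy_Schwarz_ineq2[of "sgn y" w] norm_sgn_1[OF that(1)] that(2) by simp
    then have "f (norm y) * (sgn y \<bullet> w) \<le> f (norm y)" using that(3) by simp
    ultimately show ?thesis by (simp add: inner_add_left)
  qed
  have dom: "y \<noteq> 0" "1 < norm y" "norm y \<le> R" "f (norm y) > 0" if "y \<in> cball 0 R - cball 0 1" for y :: 'a
    using that fpos[of "norm y"] by auto
  show "inj_on ?T (cball 0 R - cball 0 1)"
  proof (rule inj_onI)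
    fix y z :: 'a assume y: "y \<in> cball 0 R - cball 0 1" and z: "z \<in> cball 0 R - cball 0 1" and eq: "?T y = ?T z"
    note dy = dom[OF y] and dz = dom[OF z]
    have s: "sgn y = sgn z"
    proof (rule ccontr)
      assume ne: "sgn y \<noteq> sgn z"
      have "f (norm y) < f (norm z)"
        using T_less[OF dz(1) norm_sgn_1[OF dy(1)] dz(4)] ne T_self[OF dy(1)] eq by auto
      moreover have "f (norm z) < f (norm y)"
        using T_less[OF dy(1) norm_sgn_1[OF dz(1)] dy(4)] ne T_self[OF dz(1)] eq by auto
      ultimately show False by simp
    qed
    then have "f (norm y) = f (norm z)" using T_self[OF dy(1)] T_self[OF dz(1)] eq by simp
    then have "norm y = norm z" using finj dy dz by auto
    then show "y = z" using s by (metis norm_scale_sgn)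
  qed
  show "?T ` (cball 0 R - cball 0 1) = body (f R) - body 0"
  proof (intro equalityI subsetI)
    fix z assume "z \<in> ?T ` (cball 0 R - cball 0 1)"
    then obtain y where y: "y \<in> cball 0 R - cball 0 1" and z: "z = ?T y" by auto
    note dy = dom[OF y]
    have "z \<bullet> w \<le> u w + f R" if "norm w = 1" for w
    proof (cases "w = sgn y")
      case True
      then show ?thesis using T_self[OF dy(1)] fle[OF dy(2,3)] z by simp
    next
      case False
      then show ?thesis using T_less[OF dy(1) that dy(4)] fle[OF dy(2,3)] z by simp
    qed
    moreover have "\<not> z \<bullet> sgn y \<le> u (sgn y) + 0" using T_self[OF dy(1)] dy(4) z by simp
    ultimately show "z \<in> body (f R) - body 0"
      using norm_sgn_1[OF dy(1)] unfolding body_def by blast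
  next
    fix z assume z: "z \<in> body (f R) - body 0"
    obtain x where x: "norm x = 1" and max: "\<And>y. norm y = 1 \<Longrightarrow> z \<bullet> y - u y \<le> z \<bullet> x - u x"
      using support_maximum by blast
    define s where "s = z \<bullet> x - u x"
    have zs: "z = X x + s *\<^sub>R x"
      using first_order_condition[OF x, of z 1] max by (simp add: s_def)
    obtain w where "norm w = 1" "z \<bullet> w > u w" using z by (auto simp: body_def not_le)
    then have s0: "s > 0" using max[of w] by (simp add: s_def)
    have sR: "s \<le> f R" using z x by (auto simp: body_def s_def)
    obtain t where t: "1 \<le> t" "t \<le> R" "f t = s"
      using IVT'[of f 1 s R] f s0 sR R by auto
    have "t \<noteq> 1" using t s0 f(3) by auto
    then have mem: "t *\<^sub>R x \<in> cball 0 R - cball 0 1" using t x by simp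
    have sg: "sgn (t *\<^sub>R x) = x" using t sgn_scale_pos[of t x] sgn_eq_self[OF x] by simp
    have nt: "norm (t *\<^sub>R x) = t" using t x by simp
    have Xt: "X (t *\<^sub>R x) = X x" using inv_gauss_sgn[of u "t *\<^sub>R x"] unfolding sg by (rule sym)
    have "z = ?T (t *\<^sub>R x)" unfolding sg nt Xt t(3) by (rule zs)
    then show "z \<in> ?T ` (cball 0 R - cball 0 1)" using mem by (rule image_eqI)
  qed
qed

end

section \<open>Integration over the unit sphere\<close>

abbreviation punctured_ball :: "'a::euclidean_space set" where
  "punctured_ball \<equiv> cball 0 1 - {0}"

text \<open>
  Integration over the sphere is integration of the radially constant extension over the unit
  ball, which differs from the surface integral by the constant factor \<open>DIM('a)\<close>.
\<close>

definition sphere_integrable :: "('a::euclidean_space \<Rightarrow> real) \<Rightarrow> bool" where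
  "sphere_integrable f \<longleftrightarrow> (\<lambda>y. f (sgn y)) absolutely_integrable_on punctured_ball"

definition sphere_integral :: "('a::euclidean_space \<Rightarrow> real) \<Rightarrow> real" where
  "sphere_integral f = integral punctured_ball (\<lambda>y. f (sgn y))"

lemma punctured_ball_sets: "punctured_ball \<in> sets lebesgue"
  by auto

lemma sphere_integrable_imp: "sphere_integrable f \<Longrightarrow> (\<lambda>y. f (sgn y)) integrable_on punctured_ball"
  unfolding sphere_integrable_def by (rule set_lebesgue_integral_eq_integral(1))

lemma sphere_integrable_cong:
  "(\<And>x. norm x = 1 \<Longrightarrow> f x = g x) \<Longrightarrow> sphere_integrable f \<longleftrightarrow> sphere_integrable g"
  unfolding sphere_integrable_def
  by (intro set_integrable_cong) (auto simp: norm_sgn)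

lemma sphere_integral_cong:
  "(\<And>x. norm x = 1 \<Longrightarrow> f x = g x) \<Longrightarrow> sphere_integral f = sphere_integral g"
  unfolding sphere_integral_def by (intro Henstock_Kurzweil_Integration.integral_cong) (auto simp: norm_sgn)

lemma sphere_integrable_add:
  "sphere_integrable f \<Longrightarrow> sphere_integrable g \<Longrightarrow> sphere_integrable (\<lambda>x. f x + g x)"
  unfolding sphere_integrable_def by (rule set_integral_add(1))

lemma sphere_integral_add:
  "sphere_integrable f \<Longrightarrow> sphere_integrable g \<Longrightarrow>
     sphere_integral (\<lambda>x. f x + g x) = sphere_integral f + sphere_integral g"
  unfolding sphere_integral_def by (intro Henstock_Kurzweil_Integration.integral_add sphere_integrable_imp)

lemma sphere_integrable_cmult: "sphere_integrable f \<Longrightarrow> sphere_integrable (\<lambda>x. c * f x)"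
  unfolding sphere_integrable_def by (rule set_integrable_mult_right)

lemma sphere_integral_cmult: "sphere_integral (\<lambda>x. c * f x) = c * sphere_integral f"
  unfolding sphere_integral_def by (rule integral_mult_right)

lemma sphere_integral_sum:
  "finite S \<Longrightarrow> (\<And>i. i \<in> S \<Longrightarrow> sphere_integrable (f i)) \<Longrightarrow>
     sphere_integral (\<lambda>x. \<Sum>i\<in>S. f i x) = (\<Sum>i\<in>S. sphere_integral (f i))"
  unfolding sphere_integral_def by (intro integral_sum sphere_integrable_imp)

lemma sphere_integral_mono:
  "sphere_integrable f \<Longrightarrow> sphere_integrable g \<Longrightarrow> (\<And>x. norm x = 1 \<Longrightarrow> f x \<le> g x) \<Longrightarrow>
     sphere_integral f \<le> sphere_integral g"
  unfolding sphere_integral_def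
  by (intro integral_le sphere_integrable_imp) (auto simp: norm_sgn)

lemma sgn_continuous: "continuous_on (- {0}) (sgn :: 'a::euclidean_space \<Rightarrow> 'a)"
proof -
  have "continuous_on (- {0}) (\<lambda>y :: 'a. inverse (norm y) *\<^sub>R y)"
    by (intro continuous_intros) auto
  then show ?thesis by (simp add: sgn_div_norm[abs_def])
qed

lemma radial_continuous:
  assumes "continuous_on (sphere 0 1) c"
  shows "continuous_on (- {0}) (\<lambda>y :: 'a::euclidean_space. c (sgn y))"
  by (rule continuous_on_compose2[OF assms sgn_continuous]) (auto simp: norm_sgn split: if_splits)

lemma radial_bounded:
  fixes c :: "'a::euclidean_space \<Rightarrow> real"
  assumes "continuous_on (sphere 0 1) c"
  obtains M where "\<And>x. norm x = 1 \<Longrightarrow> \<bar>c x\<bar> \<le> M"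
proof -
  from compact_imp_bounded[OF compact_continuous_image[OF assms compact_sphere]]
  obtain M where M: "\<forall>r\<in>c ` sphere 0 1. norm r \<le> M" unfolding bounded_iff by blast
  show thesis by (rule that[of M]) (use M in auto)
qed

lemma sphere_integrable_mult_continuous:
  fixes c :: "'a::euclidean_space \<Rightarrow> real"
  assumes c: "continuous_on (sphere 0 1) c" and f: "sphere_integrable f"
  shows "sphere_integrable (\<lambda>x. c x * f x)"
  unfolding sphere_integrable_def
proof -
  have mc: "(\<lambda>y. c (sgn y)) \<in> borel_measurable (lebesgue_on punctured_ball)"
    by (intro continuous_imp_measurable_on_sets_lebesgue continuous_on_subset[OF radial_continuous[OF c]]) auto
  have mf: "(\<lambda>y. f (sgn y)) \<in> borel_measurable (lebesgue_on punctured_ball)"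
    using f unfolding sphere_integrable_def by (rule absolutely_integrable_imp_borel_measurable) auto
  obtain M where M: "\<And>x. norm x = 1 \<Longrightarrow> \<bar>c x\<bar> \<le> M" using radial_bounded[OF c] by blast
  have "(\<lambda>y. norm (f (sgn y))) integrable_on punctured_ball"
    using f unfolding sphere_integrable_def absolutely_integrable_on_def by blast
  then have int: "(\<lambda>y. M * norm (f (sgn y))) integrable_on punctured_ball"
    by (rule integrable_on_mult_right)
  show "(\<lambda>y. c (sgn y) * f (sgn y)) absolutely_integrable_on punctured_ball"
    by (rule measurable_bounded_by_integrable_imp_absolutely_integrable[OF borel_measurable_times[OF mc mf] _ int])
      (use M in \<open>auto simp: norm_sgn abs_mult intro!: mult_right_mono\<close>)
qed

lemma sphere_integrable_const: "sphere_integrable (\<lambda>x. c)"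
  unfolding sphere_integrable_def
  by (intro absolutely_integrable_on_const fmeasurable_Diff lmeasurable_cball) auto

lemma sphere_integrable_continuous:
  "continuous_on (sphere 0 1) c \<Longrightarrow> sphere_integrable c"
  using sphere_integrable_mult_continuous[of c "\<lambda>x. 1", OF _ sphere_integrable_const] by simp

lemma sphere_integrable_bound:
  assumes "(\<lambda>y. f (sgn y)) \<in> borel_measurable (lebesgue_on punctured_ball)" "sphere_integrable g"
    and "\<And>x. norm x = 1 \<Longrightarrow> \<bar>f x\<bar> \<le> g x"
  shows "sphere_integrable f"
  unfolding sphere_integrable_def
  by (rule measurable_bounded_by_integrable_imp_absolutely_integrable[OF assms(1) _ sphere_integrable_imp[OF assms(2)]])
    (use assms(3) in \<open>auto simp: norm_sgn\<close>)

lemma sphere_integrable_measurable: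
  "sphere_integrable f \<Longrightarrow> (\<lambda>y. f (sgn y)) \<in> borel_measurable (lebesgue_on punctured_ball)"
  unfolding sphere_integrable_def by (rule absolutely_integrable_imp_borel_measurable) auto

lemma sphere_integrable_nonneg_iff:
  "(\<And>x. norm x = 1 \<Longrightarrow> f x \<ge> 0) \<Longrightarrow> sphere_integrable f \<longleftrightarrow> (\<lambda>y. f (sgn y)) integrable_on punctured_ball"
  unfolding sphere_integrable_def by (rule absolutely_integrable_on_iff_nonneg) (auto simp: norm_sgn)

lemma sphere_integral_nonneg_eq_0:
  fixes f :: "'a::euclidean_space \<Rightarrow> real"
  assumes f: "continuous_on (sphere 0 1) f" "\<And>x. norm x = 1 \<Longrightarrow> f x \<ge> 0" and le: "sphere_integral f \<le> 0"
    and x: "norm x = 1"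
  shows "f x = 0"
proof (rule ccontr)
  assume "f x \<noteq> 0"
  then have fx: "f x > 0" using f(2)[OF x] by simp
  \<comment> \<open>a neighbourhood of \<open>x / 2\<close> that stays in the punctured ball\<close>
  have "continuous_on (- {0}) (\<lambda>y. f (sgn y))" by (rule radial_continuous[OF f(1)])
  moreover have "(1/2) *\<^sub>R x \<in> - {0}" using x by auto
  moreover have sx: "f (sgn ((1/2) *\<^sub>R x)) = f x"
    using x by (simp add: sgn_scale_pos sgn_eq_self)
  ultimately have "isCont (\<lambda>y. f (sgn y)) ((1/2) *\<^sub>R x)"
    using continuous_on_eq_continuous_at[OF open_nonzero] by blast
  then obtain d where d: "d > 0" "\<And>y. dist y ((1/2) *\<^sub>R x) < d \<Longrightarrow> \<bar>f (sgn y) - f x\<bar> < f x / 2"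
    unfolding continuous_at_eps_delta using fx sx by (metis dist_real_def half_gt_zero)
  define B where "B = ball ((1/2) *\<^sub>R x) (min d (1/2))"
  have B: "B \<subseteq> punctured_ball"
  proof
    fix y assume "y \<in> B"
    then have y: "norm (y - (1/2) *\<^sub>R x) < 1/2" by (simp add: B_def dist_norm norm_minus_commute)
    have "norm y \<le> norm (y - (1/2) *\<^sub>R x) + norm ((1/2) *\<^sub>R x)"
      using norm_triangle_ineq[of "y - (1/2) *\<^sub>R x" "(1/2) *\<^sub>R x"] by simp
    then have "norm y \<le> 1" using y x by simp
    moreover have "y \<noteq> 0" using y x by auto
    ultimately show "y \<in> punctured_ball" by simp
  qed
  have "0 < measure lebesgue B * (f x / 2)"
    using d fx by (simp add: B_def content_ball_pos)
  also have "\<dots> = integral B (\<lambda>y. f x / 2)"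
  proof -
    have "integral B (\<lambda>y. 1 * (f x / 2)) = integral B (\<lambda>y. 1) * (f x / 2)" by (rule integral_mult_left)
    then show ?thesis using lmeasure_integral[of B] by (simp add: B_def)
  qed
  also have "\<dots> \<le> integral B (\<lambda>y. f (sgn y))"
  proof (rule integral_le)
    show "(\<lambda>y. f (sgn y)) integrable_on B"
      by (rule set_lebesgue_integral_eq_integral(1), rule set_integrable_subset[OF _ _ B])
        (use sphere_integrable_continuous[OF f(1)] in \<open>auto simp: sphere_integrable_def B_def\<close>)
    show "f x / 2 \<le> f (sgn y)" if "y \<in> B" for y
      using d(2)[of y] that by (auto simp: B_def dist_commute abs_if split: if_splits)
  qed (simp add: B_def integrable_on_const)
  also have "\<dots> \<le> sphere_integral f"
    unfolding sphere_integral_def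
    by (rule integral_subset_le[OF B])
      (use sphere_integrable_imp[OF sphere_integrable_continuous[OF f(1)]] f(2) B in
        \<open>auto simp: norm_sgn B_def intro: set_lebesgue_integral_eq_integral(1)[OF set_integrable_subset]
          sphere_integrable_continuous[OF f(1), unfolded sphere_integrable_def]\<close>)
  finally show False using le by simp
qed

lemma radial_integral_scale:
  fixes f :: "real^'m::{finite,wellorder} \<Rightarrow> real"
  assumes f: "sphere_integrable f" and R: "R > 0"
  shows "(\<lambda>y. f (sgn y)) absolutely_integrable_on (cball 0 R - {0})" (is ?int)
    and "integral (cball 0 R - {0}) (\<lambda>y. f (sgn y)) = R ^ CARD('m) * sphere_integral f" (is ?eq)
proof -
  let ?v = "\<lambda>y :: real^'m::_. Finite_Cartesian_Product.vec (f (sgn y)) :: real^1"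
  have img: "(*\<^sub>R) R ` (punctured_ball :: (real^'m::_) set) = cball 0 R - {0}"
  proof (intro equalityI subsetI)
    fix y :: "real^'m::_" assume y: "y \<in> cball 0 R - {0}"
    then have "(1 / R) *\<^sub>R y \<in> punctured_ball" using R by (simp add: field_simps)
    moreover have "y = R *\<^sub>R ((1 / R) *\<^sub>R y)" using R by simp
    ultimately show "y \<in> (*\<^sub>R) R ` punctured_ball" by blast
  qed (use R in \<open>auto simp: mult_left_le\<close>)
  have det: "\<bar>Determinants.det (matrix ((*\<^sub>R) R :: real^'m::_ \<Rightarrow> real^'m::_))\<bar> = R ^ CARD('m)"
    using R by simp
  have "(\<lambda>x. \<bar>Determinants.det (matrix ((*\<^sub>R) R :: real^'m::_ \<Rightarrow> real^'m::_))\<bar> *\<^sub>R ?v (R *\<^sub>R x)) absolutely_integrable_on punctured_ball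
     \<and> integral punctured_ball (\<lambda>x. \<bar>Determinants.det (matrix ((*\<^sub>R) R :: real^'m::_ \<Rightarrow> real^'m::_))\<bar> *\<^sub>R ?v (R *\<^sub>R x))
       = Finite_Cartesian_Product.vec (R ^ CARD('m) * sphere_integral f)"
    using f R
    by (simp add: det sgn_scale_pos absolutely_integrable_on_1_iff integral_on_1_eq sphere_integrable_def
        sphere_integral_def set_integrable_mult_right Finite_Cartesian_Product.vec_eq_iff)
  then have "?v absolutely_integrable_on (cball 0 R - {0}) \<and>
      integral (cball 0 R - {0}) ?v = Finite_Cartesian_Product.vec (R ^ CARD('m) * sphere_integral f)"
    unfolding img[symmetric]
    by (rule has_absolute_integral_change_of_variables_linear[THEN iffD1, rotated]) (rule linear_scaleR)
  then show ?int ?eq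
    by (simp_all add: absolutely_integrable_on_1_iff integral_on_1_eq)
qed

lemma radial_integral_annulus:
  fixes f :: "real^'m::{finite,wellorder} \<Rightarrow> real"
  assumes f: "sphere_integrable f" and R: "R \<ge> 1"
  shows "((\<lambda>y. f (sgn y)) has_integral (R ^ CARD('m) - 1) * sphere_integral f) (cball 0 R - cball 0 1)"
proof -
  have int: "(\<lambda>y. f (sgn y)) integrable_on (cball 0 R - {0})" "(\<lambda>y. f (sgn y)) integrable_on (cball 0 1 - {0})"
    using radial_integral_scale(1)[OF f, of R] radial_integral_scale(1)[OF f, of 1] R
    by (auto intro: set_lebesgue_integral_eq_integral(1))
  have sub: "cball 0 1 - {0} \<subseteq> cball (0::real^'m::_) R - {0}" using R by auto
  have eq: "cball 0 R - cball 0 1 = (cball 0 R - {0}) - (cball (0::real^'m::_) 1 - {0})" by auto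
  have "((\<lambda>y. f (sgn y)) has_integral (R ^ CARD('m) * sphere_integral f - 1 ^ CARD('m) * sphere_integral f))
      ((cball 0 R - {0}) - (cball (0::real^'m::_) 1 - {0}))"
    using int radial_integral_scale(2)[OF f, of R] radial_integral_scale(2)[OF f, of 1] R sub
    by (intro has_integral_setdiff) (auto simp: has_integral_integral[symmetric] has_integral_iff)
  then show ?thesis unfolding eq by (simp add: algebra_simps)
qed

section \<open>Volumes of parallel bodies\<close>

lemma inv_gauss_add_const:
  "inv_gauss (\<lambda>x. u x + t) y = inv_gauss u y + t *\<^sub>R sgn y" if "smooth_radial u" "y \<noteq> 0"
proof -
  have "sphere_deriv (\<lambda>x. u x + t) (sgn y) b = sphere_deriv u (sgn y) b" for b
  proof -
    have "(\<lambda>y. u (sgn y)) differentiable (at (sgn y))"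
      using that by (intro smooth_radial_differentiable) (auto simp: sgn_zero_iff)
    then have "((\<lambda>y. u (sgn y)) has_derivative sphere_deriv u (sgn y)) (at (sgn y))"
      by (simp add: sphere_deriv_def[abs_def] frechet_derivative_works[symmetric])
    from has_derivative_add_const[OF this, of t]
    show ?thesis unfolding sphere_deriv_def[of "\<lambda>x. u x + t"]
      using fun_cong[OF frechet_derivative_at] by metis
  qed
  then show ?thesis
    by (simp add: inv_gauss_def sphere_grad_def algebra_simps)
qed

lemma radii_map_add_const:
  assumes u: "smooth_radial u" and x: "norm x = 1"
  shows "radii_map (\<lambda>x. u x + t) x v = radii_map u x v + t *\<^sub>R tangent_proj x v"
proof -
  have xn: "x \<noteq> 0" using x by auto
  have "((\<lambda>y. inv_gauss u y + t *\<^sub>R sgn y) has_derivative (\<lambda>v. radii_map u x v + t *\<^sub>R tangent_proj x v)) (at x)"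
    by (intro has_derivative_add inv_gauss_has_derivative_at[OF u xn] has_derivative_scaleR_right
        has_derivative_sgn_sphere) (use x in auto)
  then have "(inv_gauss (\<lambda>x. u x + t) has_derivative (\<lambda>v. radii_map u x v + t *\<^sub>R tangent_proj x v)) (at x)"
    by (rule has_derivative_transform_within_open[OF _ open_nonzero]) (use xn inv_gauss_add_const[OF u] in auto)
  from fun_cong[OF frechet_derivative_at[OF this], of v] show ?thesis
    by (simp add: radii_map_def)
qed

lemma smooth_radial_add_const: "smooth_radial u \<Longrightarrow> smooth_radial (\<lambda>x. u x + t)"
  unfolding smooth_radial_def by (auto intro!: Ck_on_add Ck_on_const open_nonzero)

context convex_support
begin

lemma convex_support_add_const: "t \<ge> 0 \<Longrightarrow> convex_support (\<lambda>x. u x + t) n"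
proof
  assume t: "t \<ge> 0"
  fix x v :: 'a
  assume x: "norm x = 1"
  show "u x + t > 0" using pos[OF x] t by simp
  assume v: "v \<bullet> x = 0" "v \<noteq> 0"
  show "radii_map (\<lambda>x. u x + t) x v \<bullet> v > 0"
    using convex[OF x v] t unfolding radii_map_add_const[OF u x]
    by (simp add: inner_add_left tangent_proj_orth[OF v(1)] add_pos_nonneg)
qed (use u smooth_radial_add_const n in auto)

lemma body_add_const: "convex_support.body (\<lambda>x. u x + t) s = body (t + s)" if "t \<ge> 0"
  unfolding convex_support.body_def[OF convex_support_add_const[OF that]] body_def by (simp add: add.assoc)

end

text \<open>
  A support function on Euclidean space together with principal directions \<open>e x i\<close> and principal
  radii of curvature \<open>r x i\<close>.  No regularity in \<open>x\<close> is assumed of the directions.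
\<close>

locale convex_frame = convex_support u n
  for u :: "real^'m::{finite,wellorder} \<Rightarrow> real" and n :: nat +
  fixes e :: "real^'m::{finite,wellorder} \<Rightarrow> nat \<Rightarrow> real^'m::{finite,wellorder}" and r :: "real^'m::{finite,wellorder} \<Rightarrow> nat \<Rightarrow> real"
  assumes frame: "\<And>x. norm x = 1 \<Longrightarrow> orthonormal_frame n x (e x)"
    and radii: "\<And>x i. norm x = 1 \<Longrightarrow> i < n \<Longrightarrow> A x (e x i) = r x i *\<^sub>R e x i"
begin

lemma card_m: "CARD('m) = n + 1"
  using n by simp

lemma frame_orth: "norm x = 1 \<Longrightarrow> i < n \<Longrightarrow> e x i \<bullet> x = 0"
  using frame by (auto simp: orthonormal_frame_def)

lemma frame_norm: "norm x = 1 \<Longrightarrow> i < n \<Longrightarrow> e x i \<bullet> e x i = 1"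
  using frame by (auto simp: orthonormal_frame_def)

lemma r_pos: "r x i > 0" if "norm x = 1" "i < n"
proof -
  have "e x i \<noteq> 0" using frame_norm[OF that] by auto
  from convex[OF that(1) frame_orth[OF that] this] show ?thesis
    using frame_norm[OF that] by (simp add: radii[OF that])
qed

lemma convex_frame_add_const: "t \<ge> 0 \<Longrightarrow> convex_frame (\<lambda>x. u x + t) n e (\<lambda>x i. r x i + t)"
  using convex_support_add_const frame radii
  by (auto simp: convex_frame_def convex_frame_axioms_def radii_map_add_const[OF u]
      tangent_proj_orth frame_orth scaleR_add_left)

text \<open>The volume in the polar coordinates \<open>y \<mapsto> \<bar>y\<bar> X(y)\<close>, whose Jacobian is constant along rays.\<close>

lemma volume_body:
  "sphere_integrable (\<lambda>x. u x * (\<Prod>i<n. r x i))"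
  "measure lebesgue (body 0) = sphere_integral (\<lambda>x. u x * (\<Prod>i<n. r x i))"
proof -
  let ?f = "\<lambda>y. norm y *\<^sub>R X y"
  let ?f' = "\<lambda>y v. (v \<bullet> sgn y) *\<^sub>R X y + A (sgn y) v"
  have der: "(?f has_derivative ?f' y) (at y within punctured_ball)" if "y \<in> punctured_ball" for y
  proof (rule has_derivative_at_withinI)
    have y: "y \<noteq> 0" using that by simp
    have "(?f has_derivative (\<lambda>v. norm y *\<^sub>R ((1 / norm y) *\<^sub>R A (sgn y) v) + (v \<bullet> sgn y) *\<^sub>R X y)) (at y)"
      by (intro has_derivative_scaleR has_derivative_norm[OF y] inv_gauss_has_derivative[OF u y])
    then show "(?f has_derivative ?f' y) (at y)" using y by (simp add: add.commute)
  qed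
  have det: "\<bar>Determinants.det (matrix (?f' y))\<bar> = u (sgn y) * (\<Prod>i<n. r (sgn y) i)" if "y \<in> punctured_ball" for y
  proof -
    have y: "y \<noteq> 0" using that by simp
    have x: "norm (sgn y) = 1" by (rule norm_sgn_1[OF y])
    have lin: "linear (?f' y)"
      using has_derivative_linear[OF der[OF that]] .
    have "Determinants.det (matrix (?f' y)) = (?f' y (sgn y) \<bullet> sgn y) * (\<Prod>i<n. r (sgn y) i)"
      by (rule det_frame[OF lin x frame[OF x] card_m]) (simp add: frame_orth[OF x] radii[OF x])
    also have "?f' y (sgn y) \<bullet> sgn y = u (sgn y)"
      using inv_gauss_inner_self[OF u x] inner_self_1[OF x] radii_map_inner_normal[OF u x]
      by (simp add: inner_add_left inv_gauss_sgn)
    finally have "Determinants.det (matrix (?f' y)) = u (sgn y) * (\<Prod>i<n. r (sgn y) i)" .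
    moreover have "u (sgn y) * (\<Prod>i<n. r (sgn y) i) \<ge> 0"
      using pos[OF x] r_pos[OF x] by (intro mult_nonneg_nonneg prod_nonneg) (auto intro: less_imp_le)
    ultimately show ?thesis by (simp only: abs_of_nonneg)
  qed
  have body: "body 0 \<in> lmeasurable" by (rule lmeasurable_compact[OF body_compact])
  have "?f ` punctured_ball \<in> lmeasurable \<and> measure lebesgue (?f ` punctured_ball) = measure lebesgue (body 0)"
    unfolding radial_map_bij(2)
  proof
    show "body 0 - {0} \<in> lmeasurable" by (rule fmeasurable_Diff[OF body]) simp
    have "negligible (sym_diff (body 0) (body 0 - {0}))" by (rule negligible_subset[of "{0}"]) auto
    then show "measure lebesgue (body 0 - {0}) = measure lebesgue (body 0)"
      by (rule measure_negligible_symdiff[OF body])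
  qed
  then have "((\<lambda>y. \<bar>Determinants.det (matrix (?f' y))\<bar>) has_integral measure lebesgue (body 0)) punctured_ball"
    using has_measure_differentiable_image[OF punctured_ball_sets der radial_map_bij(1)] by blast
  then have "((\<lambda>y. u (sgn y) * (\<Prod>i<n. r (sgn y) i)) has_integral measure lebesgue (body 0)) punctured_ball"
    by (rule has_integral_eq[rotated]) (rule det)
  note int = this
  show "measure lebesgue (body 0) = sphere_integral (\<lambda>x. u x * (\<Prod>i<n. r x i))"
    using int by (simp add: has_integral_iff sphere_integral_def)
  have "u x * (\<Prod>i<n. r x i) \<ge> 0" if "norm x = 1" for x
    using pos[OF that] r_pos[OF that] by (intro mult_nonneg_nonneg prod_nonneg) (auto intro: less_imp_le)
  then have "sphere_integrable (\<lambda>x. u x * (\<Prod>i<n. r x i)) \<longleftrightarrow>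
      (\<lambda>y. u (sgn y) * (\<Prod>i<n. r (sgn y) i)) integrable_on punctured_ball"
    by (rule sphere_integrable_nonneg_iff)
  with int show "sphere_integrable (\<lambda>x. u x * (\<Prod>i<n. r x i))"
    by (simp add: has_integral_iff)
qed

lemma prod_r_integrable: "sphere_integrable (\<lambda>x. \<Prod>i<n. r x i)"
proof -
  have "sphere_integrable (\<lambda>x. (1 / u x) * (u x * (\<Prod>i<n. r x i)))"
  proof (rule sphere_integrable_mult_continuous[OF _ volume_body(1)])
    show "continuous_on (sphere 0 1) (\<lambda>x. 1 / u x)"
      using pos by (intro continuous_intros u_continuous_sphere) force
  qed
  moreover have "(1 / u x) * (u x * (\<Prod>i<n. r x i)) = (\<Prod>i<n. r x i)" if "norm x = 1" for x
    using pos[OF that] by simp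
  ultimately show ?thesis by (rule sphere_integrable_cong[THEN iffD1, rotated])
qed

lemma prod_r_add_integrable: "t \<ge> 0 \<Longrightarrow> sphere_integrable (\<lambda>x. \<Prod>i<n. r x i + t)"
  using convex_frame.prod_r_integrable[OF convex_frame_add_const] .

text \<open>
  The volume of the tube between the body and a parallel body.  The distance \<open>s\<close> to the body is
  chosen such that its derivative \<open>norm y ^ n\<close> cancels the powers of \<open>norm y\<close> in the Jacobian.
\<close>

lemma volume_tube:
  assumes R: "R \<ge> 1"
  defines "s \<equiv> \<lambda>t. (t ^ (n + 1) - 1) / (real n + 1)"
  shows "((\<lambda>y. \<Prod>i<n. r (sgn y) i + s (norm y)) has_integral
     measure lebesgue (body (s R)) - measure lebesgue (body 0)) (cball 0 R - cball 0 1)"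
proof -
  let ?S = "cball (0::real^'m::_) R - cball 0 1"
  let ?f = "\<lambda>y. X y + s (norm y) *\<^sub>R sgn y"
  let ?f' = "\<lambda>y v. (1 / norm y) *\<^sub>R A (sgn y) v + (s (norm y) *\<^sub>R ((1 / norm y) *\<^sub>R tangent_proj (sgn y) v)
      + (norm y ^ n * (v \<bullet> sgn y)) *\<^sub>R sgn y)"
  have mono: "strict_mono_on {1..R} s"
    by (rule strict_mono_onI) (auto simp: s_def divide_strict_right_mono power_strict_mono simp del: power_Suc)
  have cont: "continuous_on {1..R} s" unfolding s_def by (intro continuous_intros) auto
  have s1: "s 1 = 0" by (simp add: s_def)
  have ds: "(s has_real_derivative t ^ n) (at t)" for t
  proof -
    have "(s has_real_derivative (real (n + 1) * t ^ (n + 1 - Suc 0) - 0) / (real n + 1)) (at t)"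
      unfolding s_def by (intro DERIV_cdivide DERIV_diff DERIV_pow DERIV_const)
    moreover have "(real (n + 1) * t ^ (n + 1 - Suc 0) - 0) / (real n + 1) = t ^ n"
      by (simp add: field_simps)
    ultimately show ?thesis by (simp only:)
  qed
  note tube = tube_map_bij[OF mono cont s1 R]
  have s_nonneg: "s (norm y) \<ge> 0" if "y \<in> ?S" for y
    using that by (simp add: s_def one_le_power del: power_Suc)
  have der: "(?f has_derivative ?f' y) (at y within ?S)" if "y \<in> ?S" for y
  proof (rule has_derivative_at_withinI)
    have y: "y \<noteq> 0" using that by auto
    have "((\<lambda>y. s (norm y)) has_derivative (\<lambda>v. norm y ^ n * (v \<bullet> sgn y))) (at y)"
      using has_derivative_compose[OF has_derivative_norm[OF y] ds[of "norm y", unfolded has_field_derivative_def]] .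
    then show "(?f has_derivative ?f' y) (at y)"
      by (intro has_derivative_add has_derivative_scaleR inv_gauss_has_derivative[OF u y] has_derivative_sgn[OF y])
  qed
  have det: "\<bar>Determinants.det (matrix (?f' y))\<bar> = (\<Prod>i<n. r (sgn y) i + s (norm y))" if S: "y \<in> ?S" for y
  proof -
    have y: "y \<noteq> 0" using that by auto
    have x: "norm (sgn y) = 1" by (rule norm_sgn_1[OF y])
    have lin: "linear (?f' y)"
      using has_derivative_linear[OF der[OF that]] .
    have "Determinants.det (matrix (?f' y)) = (?f' y (sgn y) \<bullet> sgn y) * (\<Prod>i<n. (r (sgn y) i + s (norm y)) / norm y)"
      by (rule det_frame[OF lin x frame[OF x] card_m])
        (simp add: frame_orth[OF x] radii[OF x] tangent_proj_orth add_divide_distrib scaleR_add_left)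
    also have "?f' y (sgn y) \<bullet> sgn y = norm y ^ n"
      using inner_self_1[OF x] by (simp add: inner_add_left radii_map_normal[OF u x] tangent_proj_self[OF x])
    also have "norm y ^ n * (\<Prod>i<n. (r (sgn y) i + s (norm y)) / norm y) = (\<Prod>i<n. r (sgn y) i + s (norm y))"
      using y by (simp add: prod_dividef)
    finally have "Determinants.det (matrix (?f' y)) = (\<Prod>i<n. r (sgn y) i + s (norm y))" .
    moreover have "(\<Prod>i<n. r (sgn y) i + s (norm y)) \<ge> 0"
      using r_pos[OF x] s_nonneg[OF S] by (intro prod_nonneg add_nonneg_nonneg) (auto intro: less_imp_le)
    ultimately show ?thesis by (simp only: abs_of_nonneg)
  qed
  have sR: "s R \<ge> 0" using R by (simp add: s_def one_le_power del: power_Suc)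
  have sub: "body 0 \<subseteq> body (s R)" using sR by (force simp: body_def)
  have lm: "body t \<in> lmeasurable" for t by (rule lmeasurable_compact[OF body_compact])
  have "?f ` ?S \<in> lmeasurable \<and> measure lebesgue (?f ` ?S) = measure lebesgue (body (s R)) - measure lebesgue (body 0)"
    unfolding tube(2)
    by (intro conjI fmeasurable_Diff[OF lm fmeasurableD[OF lm]] measurable_measure_Diff[OF lm fmeasurableD[OF lm] sub])
  moreover have "?f ` ?S \<in> lmeasurable \<and> measure lebesgue (?f ` ?S) = c \<longleftrightarrow>
      ((\<lambda>y. \<bar>Determinants.det (matrix (?f' y))\<bar>) has_integral c) ?S" for c
    by (rule has_measure_differentiable_image[OF _ der tube(1)]) auto
  ultimately have "((\<lambda>y. \<bar>Determinants.det (matrix (?f' y))\<bar>) has_integral measure lebesgue (body (s R)) - measure lebesgue (body 0)) ?S"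
    by (simp only:)
  then show ?thesis
    by (rule has_integral_eq[rotated]) (rule det)
qed

lemma volume_tube_bounds:
  assumes eps: "\<epsilon> \<ge> 0"
  shows "(real n + 1) * \<epsilon> * sphere_integral (\<lambda>x. \<Prod>i<n. r x i) \<le> measure lebesgue (body \<epsilon>) - measure lebesgue (body 0)"
    and "measure lebesgue (body \<epsilon>) - measure lebesgue (body 0) \<le> (real n + 1) * \<epsilon> * sphere_integral (\<lambda>x. \<Prod>i<n. r x i + \<epsilon>)"
proof -
  define R where "R = root (n + 1) (1 + (real n + 1) * \<epsilon>)"
  have Rpow: "R ^ (n + 1) = 1 + (real n + 1) * \<epsilon>"
    unfolding R_def using eps by (intro real_root_pow_pos2) auto
  have R: "R \<ge> 1" unfolding R_def using eps by (intro real_root_ge_1_iff[THEN iffD2]) auto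
  define s where "s t = (t ^ (n + 1) - 1) / (real n + 1)" for t :: real
  have sR: "s R = \<epsilon>" unfolding s_def Rpow by (simp add: add_pos_nonneg field_simps)
  have tube: "((\<lambda>y. \<Prod>i<n. r (sgn y) i + s (norm y)) has_integral
     measure lebesgue (body \<epsilon>) - measure lebesgue (body 0)) (cball 0 R - cball 0 1)"
    using volume_tube[OF R] unfolding sR[symmetric] s_def .
  have dom: "norm (sgn y) = 1" "0 \<le> s (norm y)" "s (norm y) \<le> \<epsilon>" if "y \<in> cball 0 R - cball 0 1" for y :: "real^'m::_"
  proof -
    show "norm (sgn y) = 1" using that by (auto simp: norm_sgn)
    show "0 \<le> s (norm y)" using that by (simp add: s_def one_le_power del: power_Suc)
    show "s (norm y) \<le> \<epsilon>" unfolding sR[symmetric] s_def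
      using that by (intro divide_right_mono diff_right_mono power_mono) auto
  qed
  have lo: "((\<lambda>y. \<Prod>i<n. r (sgn y) i) has_integral (R ^ CARD('m) - 1) * sphere_integral (\<lambda>x. \<Prod>i<n. r x i)) (cball 0 R - cball 0 1)"
    by (rule radial_integral_annulus[OF prod_r_integrable R])
  have hi: "((\<lambda>y. \<Prod>i<n. r (sgn y) i + \<epsilon>) has_integral (R ^ CARD('m) - 1) * sphere_integral (\<lambda>x. \<Prod>i<n. r x i + \<epsilon>)) (cball 0 R - cball 0 1)"
    by (rule radial_integral_annulus[OF prod_r_add_integrable[OF eps] R])
  have eq: "R ^ CARD('m) - 1 = (real n + 1) * \<epsilon>" unfolding card_m Rpow by simp
  show "(real n + 1) * \<epsilon> * sphere_integral (\<lambda>x. \<Prod>i<n. r x i) \<le> measure lebesgue (body \<epsilon>) - measure lebesgue (body 0)"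
    unfolding eq[symmetric]
    by (rule has_integral_le[OF lo tube], rule prod_mono) (use dom r_pos in \<open>force intro: less_imp_le\<close>)
  show "measure lebesgue (body \<epsilon>) - measure lebesgue (body 0) \<le> (real n + 1) * \<epsilon> * sphere_integral (\<lambda>x. \<Prod>i<n. r x i + \<epsilon>)"
    unfolding eq[symmetric]
    by (rule has_integral_le[OF tube hi], rule prod_mono) (use dom r_pos in \<open>force intro: add_nonneg_nonneg less_imp_le\<close>)
qed

end

section \<open>The Minkowski formulas\<close>

text \<open>
  Measurability of the values of a polynomial gives that of its coefficients: the constant one
  is the value at \<open>0\<close>, and the next one is a limit of difference quotients.
\<close>

lemma measurable_coefficients:
  fixes a :: "nat \<Rightarrow> 'b \<Rightarrow> real"
  assumes "\<And>t. t \<ge> 0 \<Longrightarrow> (\<lambda>y. \<Sum>j\<le>m. a j y * t ^ j) \<in> borel_measurable M" and "j \<le> m"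
  shows "a j \<in> borel_measurable M"
  using assms
proof (induction m arbitrary: a j)
  case 0
  then show ?case using "0.prems"(1)[of 0] by simp
next
  case (Suc m)
  have a0: "a 0 \<in> borel_measurable M"
    using Suc.prems(1)[of 0] by (simp add: sum.atMost_Suc_shift del: sum.atMost_Suc)
  define b where "b j = a (Suc j)" for j
  have bt: "(\<lambda>y. \<Sum>j\<le>m. b j y * t ^ j) \<in> borel_measurable M" if t: "t > 0" for t
  proof -
    have "(\<lambda>y. ((\<Sum>j\<le>Suc m. a j y * t ^ j) - a 0 y) / t) \<in> borel_measurable M"
      using Suc.prems(1)[of t] a0 t by (intro borel_measurable_divide borel_measurable_diff borel_measurable_const) auto
    also have "(\<lambda>y. ((\<Sum>j\<le>Suc m. a j y * t ^ j) - a 0 y) / t) = (\<lambda>y. \<Sum>j\<le>m. b j y * t ^ j)"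
    proof
      fix y
      have "(\<Sum>j\<le>Suc m. a j y * t ^ j) - a 0 y = (\<Sum>j\<le>m. b j y * t ^ j) * t"
        by (simp add: sum.atMost_Suc_shift b_def sum_distrib_left sum_distrib_right mult_ac del: sum.atMost_Suc)
      then show "((\<Sum>j\<le>Suc m. a j y * t ^ j) - a 0 y) / t = (\<Sum>j\<le>m. b j y * t ^ j)"
        using t by simp
    qed
    finally show ?thesis .
  qed
  have bt': "(\<lambda>y. \<Sum>j\<le>m. b j y * t ^ j) \<in> borel_measurable M" if "t \<ge> 0" for t
  proof (cases "t = 0")
    case True
    have "(\<lambda>y. \<Sum>j\<le>m. b j y * 0 ^ j) \<in> borel_measurable M"
    proof (rule borel_measurable_LIMSEQ_real)
      show "(\<lambda>k. \<Sum>j\<le>m. b j y * (1 / real (Suc k)) ^ j) \<longlonglongrightarrow> (\<Sum>j\<le>m. b j y * 0 ^ j)" for y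
        by (intro tendsto_intros LIMSEQ_Suc[OF lim_1_over_n])
    qed (auto intro: bt)
    then show ?thesis by (simp add: True)
  qed (use bt that in auto)
  have "b j \<in> borel_measurable M" if "j \<le> m" for j
    by (rule Suc.IH[OF bt' that])
  with a0 Suc.prems(2) show ?case by (cases j) (auto simp: b_def)
qed

lemma poly_eqI_nonneg:
  fixes p q :: "real poly"
  assumes "\<And>t. t \<ge> 0 \<Longrightarrow> poly p t = poly q t"
  shows "p = q"
proof (rule ccontr)
  assume "p \<noteq> q"
  then have "finite {t. poly (p - q) t = 0}" by (intro poly_roots_finite) simp
  moreover have "{0..} \<subseteq> {t. poly (p - q) t = 0}" using assms by auto
  ultimately have "finite {0::real..}" by (rule rev_finite_subset)
  then show False using infinite_Ici by blast
qed

text \<open>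
  If the difference quotients of \<open>p\<close> lie between the values of \<open>q\<close> at the two endpoints then \<open>q\<close> is
  the derivative of \<open>p\<close>.
\<close>

lemma pderiv_eqI_sandwich:
  fixes p q :: "real poly"
  assumes lo: "\<And>t h. t \<ge> 0 \<Longrightarrow> h \<ge> 0 \<Longrightarrow> h * poly q t \<le> poly p (t + h) - poly p t"
    and hi: "\<And>t h. t \<ge> 0 \<Longrightarrow> h \<ge> 0 \<Longrightarrow> poly p (t + h) - poly p t \<le> h * poly q (t + h)"
  shows "pderiv p = q"
proof (rule poly_eqI_nonneg)
  fix t :: real assume t: "t \<ge> 0"
  have "(\<lambda>h. (poly p (t + h) - poly p t) / h) \<midarrow>0\<rightarrow> poly (pderiv p) t"
    using poly_DERIV[of p t] by (simp add: DERIV_def)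
  then have lim: "((\<lambda>h. (poly p (t + h) - poly p t) / h) \<longlongrightarrow> poly (pderiv p) t) (at_right 0)"
    by (rule filterlim_mono) (auto simp: at_le)
  have pos: "\<forall>\<^sub>F h in at_right 0. h > (0::real)"
    by (simp add: eventually_at_right_less)
  have "poly q t \<le> poly (pderiv p) t"
    by (rule tendsto_lowerbound[OF lim eventually_mono[OF pos]]) (use lo[OF t] in \<open>auto simp: field_simps\<close>)
  moreover have "((\<lambda>h. poly q (t + h)) \<longlongrightarrow> poly q (t + 0)) (at_right 0)"
    by (intro tendsto_intros)
  then have "poly (pderiv p) t \<le> poly q (t + 0)"
    by (rule tendsto_le[OF trivial_limit_at_right_real _ lim])
      (rule eventually_mono[OF pos], use hi[OF t] in \<open>auto simp: field_simps\<close>)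
  ultimately show "poly (pderiv p) t = poly q t" by simp
qed

context convex_frame
begin

text \<open>The elementary symmetric functions of the principal radii.\<close>

definition sigma :: "nat \<Rightarrow> real^'m::{finite,wellorder} \<Rightarrow> real" where
  "sigma k x = esym k (r x) {..<n}"

lemma sigma_nonneg: "norm x = 1 \<Longrightarrow> sigma k x \<ge> 0"
  unfolding sigma_def using r_pos by (intro esym_nonneg) (auto intro: less_imp_le)

lemma prod_r_add_eq: "(\<Prod>i<n. r x i + t) = (\<Sum>j\<le>n. sigma (n - j) x * t ^ j)"
proof -
  have "(\<Prod>i<n. r x i + t) = (\<Sum>j\<le>n. sigma j x * t ^ (n - j))"
    using prod_add_eq_esym[of "{..<n}" "r x" t] by (simp add: sigma_def)
  also have "\<dots> = (\<Sum>j\<le>n. sigma (n - j) x * t ^ j)"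
    by (rule sum.reindex_bij_witness[of _ "\<lambda>j. n - j" "\<lambda>j. n - j"]) auto
  finally show ?thesis .
qed

lemma sigma_integrable:
  assumes k: "k \<le> n"
  shows "sphere_integrable (sigma k)"
proof (rule sphere_integrable_bound[OF _ prod_r_add_integrable[of 1]])
  have meas: "(\<lambda>y. \<Sum>j\<le>n. sigma (n - j) (sgn y) * t ^ j) \<in> borel_measurable (lebesgue_on punctured_ball)" if "t \<ge> 0" for t
    using sphere_integrable_measurable[OF prod_r_add_integrable[OF that]] by (simp only: prod_r_add_eq)
  have "(\<lambda>y. sigma (n - (n - k)) (sgn y)) \<in> borel_measurable (lebesgue_on punctured_ball)"
    by (rule measurable_coefficients[where m=n and a="\<lambda>j y. sigma (n - j) (sgn y)", OF meas]) auto
  then show "(\<lambda>y. sigma k (sgn y)) \<in> borel_measurable (lebesgue_on punctured_ball)" using k by simp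
  fix x :: "real^'m::_" assume x: "norm x = 1"
  have "sigma (n - (n - k)) x \<le> (\<Sum>j\<le>n. sigma (n - j) x)"
    by (rule member_le_sum) (use sigma_nonneg[OF x] in auto)
  then show "\<bar>sigma k x\<bar> \<le> (\<Prod>i<n. r x i + 1)"
    unfolding prod_r_add_eq using k sigma_nonneg[OF x] by simp
qed simp

lemma u_sigma_integrable: "k \<le> n \<Longrightarrow> sphere_integrable (\<lambda>x. u x * sigma k x)"
  by (rule sphere_integrable_mult_continuous[OF u_continuous_sphere sigma_integrable])

text \<open>
  The volume of the parallel body is the polynomial \<open>p\<close> with coefficients \<open>J\<close> and \<open>S\<close>.  The volume
  of the tube shows that its derivative is \<open>n + 1\<close> times the integral of \<open>\<Prod>i<n. r x i + t\<close>.
\<close>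

lemma minkowski_formula:
  assumes k: "k < n"
  shows "(real n - real k) * sphere_integral (\<lambda>x. u x * sigma k x) = (real k + 1) * sphere_integral (sigma (Suc k))"
proof -
  define J where "J k = sphere_integral (\<lambda>x. u x * sigma k x)" for k
  define S where "S k = sphere_integral (sigma k)" for k
  define p where "p = (\<Sum>j\<le>n. monom (J (n - j)) j + monom (S (n - j)) (Suc j))"
  define q where "q = (\<Sum>j\<le>n. monom (S (n - j)) j)"
  have q: "sphere_integral (\<lambda>x. \<Prod>i<n. r x i + t) = poly q t" if "t \<ge> 0" for t
  proof -
    have "sphere_integral (\<lambda>x. \<Prod>i<n. r x i + t) = sphere_integral (\<lambda>x. \<Sum>j\<le>n. t ^ j * sigma (n - j) x)"
      by (simp only: prod_r_add_eq mult.commute)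
    also have "\<dots> = (\<Sum>j\<le>n. t ^ j * S (n - j))"
      unfolding S_def
      by (subst sphere_integral_sum) (simp_all add: sphere_integral_cmult sphere_integrable_cmult sigma_integrable)
    finally show ?thesis by (simp add: q_def poly_sum poly_monom mult.commute)
  qed
  have p: "measure lebesgue (body t) = poly p t" if t: "t \<ge> 0" for t
  proof -
    interpret b: convex_frame "\<lambda>x. u x + t" n e "\<lambda>x i. r x i + t" by (rule convex_frame_add_const[OF t])
    have "measure lebesgue (body t) = sphere_integral (\<lambda>x. (u x + t) * (\<Prod>i<n. r x i + t))"
      using b.volume_body(2) body_add_const[OF t, of 0] by simp
    also have "\<dots> = sphere_integral (\<lambda>x. \<Sum>j\<le>n. t ^ j * (u x * sigma (n - j) x) + t ^ Suc j * sigma (n - j) x)"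
      by (simp only: prod_r_add_eq) (simp add: sum.distrib sum_distrib_left algebra_simps)
    also have "\<dots> = (\<Sum>j\<le>n. t ^ j * J (n - j) + t ^ Suc j * S (n - j))"
    proof -
      have int: "sphere_integrable (\<lambda>x. t ^ j * (u x * sigma (n - j) x))" "sphere_integrable (\<lambda>x. t ^ Suc j * sigma (n - j) x)" for j
        using sphere_integrable_cmult[OF u_sigma_integrable[of "n - j"], of "t ^ j"]
          sphere_integrable_cmult[OF sigma_integrable[of "n - j"], of "t ^ Suc j"] by auto
      have "sphere_integral (\<lambda>x. \<Sum>j\<le>n. t ^ j * (u x * sigma (n - j) x) + t ^ Suc j * sigma (n - j) x)
          = (\<Sum>j\<le>n. sphere_integral (\<lambda>x. t ^ j * (u x * sigma (n - j) x) + t ^ Suc j * sigma (n - j) x))"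
        by (rule sphere_integral_sum) (auto intro: sphere_integrable_add int simp del: power_Suc)
      also have "\<dots> = (\<Sum>j\<le>n. t ^ j * J (n - j) + t ^ Suc j * S (n - j))"
        unfolding J_def S_def by (simp only: sphere_integral_add[OF int] sphere_integral_cmult)
      finally show ?thesis .
    qed
    finally show ?thesis by (simp add: p_def poly_sum poly_monom mult.commute)
  qed
  have "pderiv p = Polynomial.smult (real n + 1) q"
  proof (rule pderiv_eqI_sandwich)
    fix t h :: real assume t: "t \<ge> 0" and h: "h \<ge> 0"
    interpret b: convex_frame "\<lambda>x. u x + t" n e "\<lambda>x i. r x i + t" by (rule convex_frame_add_const[OF t])
    note bounds = b.volume_tube_bounds[OF h, unfolded body_add_const[OF t]]
    show "h * poly (Polynomial.smult (real n + 1) q) t \<le> poly p (t + h) - poly p t"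
      using bounds(1) p[of "t + h"] p[of t] q[of t] t h by (simp add: mult_ac)
    show "poly p (t + h) - poly p t \<le> h * poly (Polynomial.smult (real n + 1) q) (t + h)"
      using bounds(2) p[of "t + h"] p[of t] q[of "t + h"] t h by (simp add: mult_ac add.assoc)
  qed
  then have c: "coeff (pderiv p) m = (real n + 1) * coeff q m" for m by simp
  \<comment> \<open>\<open>sigma (Suc k)\<close> belongs to the power \<open>m\<close> of \<open>t\<close> in \<open>\<Prod>i<n. r x i + t\<close>\<close>
  define m where "m = n - Suc k"
  have m: "Suc m \<le> n" "n - Suc m = k" "n - m = Suc k" using k by (auto simp: m_def)
  have "coeff p (Suc m) = J k + S (Suc k)"
    using m by (simp add: p_def coeff_sum sum.distrib)
  moreover have "coeff q m = S (Suc k)"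
    using m by (simp add: q_def coeff_sum)
  moreover have "real (Suc m) = real n - real k" using k by (simp add: m_def of_nat_diff)
  ultimately have "(real n - real k) * (J k + S (Suc k)) = (real n + 1) * S (Suc k)"
    using c[of m] by (simp only: coeff_pderiv)
  then show ?thesis unfolding J_def[symmetric] S_def[symmetric] by (simp add: algebra_simps)
qed

end

section \<open>The Heintze--Karcher inequality\<close>

context convex_frame
begin

text \<open>
  The arithmetic mean of the principal radii, written as a trace over the standard basis so that
  its smoothness in \<open>x\<close> is plain.
\<close>

definition mean_radius :: "real^'m::{finite,wellorder} \<Rightarrow> real" where
  "mean_radius x = (\<Sum>b\<in>Basis. A x b \<bullet> b) / real n"

lemma sum_r_eq: "norm x = 1 \<Longrightarrow> sum (r x) {..<n} = real n * mean_radius x"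
  using trace_frame[OF A_linear _ frame n(1), of x] n(2)
  by (simp add: mean_radius_def radii_map_normal[OF u] radii frame_norm)

lemma mean_radius_pos: "norm x = 1 \<Longrightarrow> mean_radius x > 0"
proof -
  assume x: "norm x = 1"
  have "sum (r x) {..<n} > 0" using r_pos[OF x] n(2) by (intro sum_pos) (auto simp: lessThan_empty_iff)
  then show ?thesis using sum_r_eq[OF x] by (simp add: zero_less_mult_iff)
qed

lemma Ck_on_mean_radius: "Ck_on k (- {0}) mean_radius"
proof -
  have "Ck_on k (- {0}) (\<lambda>y. (\<Sum>b\<in>Basis. A y b \<bullet> b) * (1 / real n))"
    by (intro Ck_on_mult Ck_on_sum Ck_on_radii_map[OF u] Ck_on_const open_nonzero)
  then show ?thesis by (simp add: mean_radius_def[abs_def])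
qed

lemma continuous_on_mean_radius: "continuous_on (sphere 0 1) mean_radius"
  by (rule continuous_on_subset[OF Ck_on_continuous[OF Ck_on_mean_radius]]) auto

lemma mean_radius_differentiable: "norm x = 1 \<Longrightarrow> mean_radius differentiable (at x)"
  by (rule Ck_on_differentiable[OF Ck_on_mean_radius open_nonzero]) auto

lemma sigma_n: "sigma n x = (\<Prod>i<n. r x i)"
  using esym_card[of "{..<n}" "r x"] by (simp add: sigma_def)

lemma sigma_1: "norm x = 1 \<Longrightarrow> sigma 1 x = real n * mean_radius x"
  using esym_1[of "{..<n}" "r x"] sum_r_eq by (simp add: sigma_def)

text \<open>
  The parameter \<open>y\<close> stands for the point at distance \<open>(1 - norm y) * mean_radius (sgn y)\<close> from \<open>X y\<close>
  on the inner normal there, which is \<open>focal_map y\<close> below.  It is in the domain if no principal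
  radius of curvature at \<open>X y\<close> is smaller than this distance.
\<close>

definition focal_domain :: "(real^'m::{finite,wellorder}) set" where
  "focal_domain = {y \<in> punctured_ball. \<forall>v. (1 - norm y) * mean_radius (sgn y) * (v \<bullet> v - (v \<bullet> sgn y)\<^sup>2) \<le> A (sgn y) v \<bullet> v}"

lemma focal_domain_sets: "focal_domain \<in> sets lebesgue"
proof -
  let ?g = "\<lambda>v y. A (sgn y) v \<bullet> v - (1 - norm y) * mean_radius (sgn y) * (v \<bullet> v - (v \<bullet> sgn y)\<^sup>2)"
  let ?S = "- {0 :: real^'m::_}"
  have "continuous_on (sphere 0 1) (\<lambda>x. A x v)" for v
    by (rule continuous_on_subset[OF continuous_on_radii_map[OF u]]) auto
  then have cA: "continuous_on ?S (\<lambda>y. A (sgn y) v \<bullet> v)" for v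
    by (intro continuous_on_inner[OF radial_continuous continuous_on_const])
  have cn: "continuous_on ?S (\<lambda>y. 1 - norm y)"
    by (intro continuous_on_diff continuous_on_norm continuous_on_id continuous_on_const)
  have cs: "continuous_on ?S (\<lambda>y. v \<bullet> v - (v \<bullet> sgn y)\<^sup>2)" for v :: "real^'m::_"
    by (rule continuous_on_diff[OF continuous_on_const continuous_on_power[OF continuous_on_inner[OF continuous_on_const sgn_continuous]]])
  have "continuous_on ?S (?g v)" for v
    by (rule continuous_on_diff[OF cA continuous_on_mult[OF continuous_on_mult[OF cn radial_continuous[OF continuous_on_mean_radius]] cs]])
  then have cl: "closedin (top_of_set ?S) (?S \<inter> ?g v -` {0..})" for v
    by (rule continuous_closedin_preimage) simp
  have "closedin (top_of_set ?S) (\<Inter>v. ?S \<inter> ?g v -` {0..})"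
  proof (rule closedin_Inter)
    fix T assume "T \<in> range (\<lambda>v. ?S \<inter> ?g v -` {0..})"
    then show "closedin (top_of_set ?S) T" using cl by (elim rangeE) (simp only:)
  qed simp
  then obtain C where C: "closed C" "(\<Inter>v. ?S \<inter> ?g v -` {0..}) = ?S \<inter> C"
    unfolding closedin_closed by (elim exE conjE)
  have "focal_domain = cball 0 1 \<inter> (\<Inter>v. ?S \<inter> ?g v -` {0..})"
    by (auto simp: focal_domain_def)
  also have "\<dots> = cball 0 1 \<inter> (?S \<inter> C)" by (simp only: C(2))
  also have "\<dots> \<in> sets lebesgue"
    using C(1) by (intro sets.Int) auto
  finally show ?thesis .
qed

lemma focal_domain_radii:
  assumes y: "y \<in> focal_domain" and i: "i < n"
  shows "(1 - norm y) * mean_radius (sgn y) \<le> r (sgn y) i"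
proof -
  have x: "norm (sgn y) = 1" using y by (auto simp: focal_domain_def norm_sgn)
  have "(1 - norm y) * mean_radius (sgn y) * (e (sgn y) i \<bullet> e (sgn y) i - (e (sgn y) i \<bullet> sgn y)\<^sup>2)
      \<le> A (sgn y) (e (sgn y) i) \<bullet> e (sgn y) i"
    using y unfolding focal_domain_def by blast
  then show ?thesis
    unfolding radii[OF x i] frame_orth[OF x i] inner_scaleR_left frame_norm[OF x i] by simp
qed

definition focal_map :: "real^'m::{finite,wellorder} \<Rightarrow> real^'m::{finite,wellorder}" where
  "focal_map y = X y - ((1 - norm y) * mean_radius (sgn y)) *\<^sub>R sgn y"

text \<open>The derivative of \<open>focal_map\<close>, in the form in which the product rule gives it.\<close>

definition focal_map_deriv :: "real^'m::{finite,wellorder} \<Rightarrow> real^'m::{finite,wellorder} \<Rightarrow> real^'m::{finite,wellorder}" where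
  "focal_map_deriv y v = (1 / norm y) *\<^sub>R A (sgn y) v
     - (((1 - norm y) * mean_radius (sgn y)) *\<^sub>R ((1 / norm y) *\<^sub>R tangent_proj (sgn y) v)
        + ((1 - norm y) * frechet_derivative mean_radius (at (sgn y)) ((1 / norm y) *\<^sub>R tangent_proj (sgn y) v)
           + (0 - v \<bullet> sgn y) * mean_radius (sgn y)) *\<^sub>R sgn y)"

lemma focal_map_has_derivative:
  assumes y: "y \<noteq> 0"
  shows "(focal_map has_derivative focal_map_deriv y) (at y)"
proof -
  have "(mean_radius has_derivative frechet_derivative mean_radius (at (sgn y))) (at (sgn y))"
    using mean_radius_differentiable[OF norm_sgn_1[OF y]] by (simp add: frechet_derivative_works[symmetric])
  from has_derivative_compose[OF has_derivative_sgn[OF y] this]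
  have d: "((\<lambda>y. mean_radius (sgn y)) has_derivative
      (\<lambda>v. frechet_derivative mean_radius (at (sgn y)) ((1 / norm y) *\<^sub>R tangent_proj (sgn y) v))) (at y)" .
  show ?thesis
    unfolding focal_map_def[abs_def] focal_map_deriv_def[abs_def]
    by (intro has_derivative_diff has_derivative_scaleR has_derivative_mult has_derivative_const
        has_derivative_norm[OF y] d inv_gauss_has_derivative[OF u y] has_derivative_sgn[OF y])
qed

lemma focal_map_jacobian:
  assumes y: "y \<in> focal_domain"
  shows "\<bar>Determinants.det (matrix (focal_map_deriv y))\<bar> \<le> mean_radius (sgn y) * sigma n (sgn y)"
proof -
  have y0: "y \<noteq> 0" and y1: "norm y \<le> 1" using y by (auto simp: focal_domain_def)
  have x: "norm (sgn y) = 1" by (rule norm_sgn_1[OF y0])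
  let ?x = "sgn y"
  let ?D = "frechet_derivative mean_radius (at ?x)"
  let ?c = "\<lambda>i. (r ?x i - (1 - norm y) * mean_radius ?x) / norm y"
  have D0: "?D 0 = 0"
    by (rule linear_0[OF linear_frechet_derivative[OF mean_radius_differentiable[OF x]]])
  have "Determinants.det (matrix (focal_map_deriv y)) = mean_radius ?x * (\<Prod>i<n. ?c i)"
  proof (rule det_frame'[OF has_derivative_linear[OF focal_map_has_derivative[OF y0]] x frame[OF x] card_m])
    show "focal_map_deriv y ?x = mean_radius ?x *\<^sub>R ?x"
      by (simp add: focal_map_deriv_def radii_map_normal[OF u x] tangent_proj_self[OF x] D0 inner_self_1[OF x])
    show "focal_map_deriv y (e ?x i) = ?c i *\<^sub>R e ?x i + (- ((1 - norm y) * ?D ((1 / norm y) *\<^sub>R e ?x i))) *\<^sub>R ?x"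
      if i: "i < n" for i
      by (simp add: focal_map_deriv_def radii[OF x i] tangent_proj_orth[OF frame_orth[OF x i]] frame_orth[OF x i]
          diff_divide_distrib scaleR_diff_left)
  qed
  moreover have c0: "?c i \<ge> 0" if "i < n" for i using focal_domain_radii[OF y that] by simp
  then have "(\<Prod>i<n. ?c i) \<ge> 0" by (intro prod_nonneg) auto
  ultimately have "\<bar>Determinants.det (matrix (focal_map_deriv y))\<bar> = mean_radius ?x * (\<Prod>i<n. ?c i)"
    using mean_radius_pos[OF x] by (simp add: abs_mult)
  also have "\<dots> \<le> mean_radius ?x * (\<Prod>i<n. r ?x i)"
    by (intro mult_left_mono prod_diff_mean_le)
      (use mean_radius_pos[OF x] r_pos[OF x] sum_r_eq[OF x] y0 y1 focal_domain_radii[OF y] in auto)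
  finally show ?thesis by (simp add: sigma_n)
qed

text \<open>
  A point \<open>z\<close> of the body lies on the inner normal at the boundary point with normal \<open>x\<close>, where \<open>x\<close>
  maximises \<open>z \<bullet> x - u x\<close>, and the second order condition says that it does not lie beyond the
  first focal point on this normal.  The parameter \<open>y = 0\<close> has no direction; it is replaced by the
  image of the sphere, which is negligible.
\<close>

lemma body_subset_focal_image:
  "body 0 \<subseteq> focal_map ` focal_domain \<union> (\<lambda>y. X y - mean_radius (sgn y) *\<^sub>R sgn y) ` sphere 0 1"
proof
  fix z assume z: "z \<in> body 0"
  obtain x where x: "norm x = 1" and max: "\<And>y. norm y = 1 \<Longrightarrow> z \<bullet> y - u y \<le> z \<bullet> x - u x"
    using support_maximum by blast
  define s where "s = z \<bullet> x - u x"
  define m where "m = mean_radius x"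
  define t where "t = 1 + s / m"
  have m: "m > 0" unfolding m_def by (rule mean_radius_pos[OF x])
  have zs: "z = X x + s *\<^sub>R x"
    using first_order_condition[OF x, of z 1] max by (simp add: s_def)
  have s0: "s \<le> 0" using z x by (auto simp: body_def s_def)
  have so: "A x v \<bullet> v + s * (v \<bullet> v) \<ge> 0" if "v \<bullet> x = 0" for v
    unfolding s_def by (rule second_order_condition[OF x max that])
  have "- s \<le> r x i" if "i < n" for i
    using so[OF frame_orth[OF x that]] by (simp add: radii[OF x that] frame_norm[OF x that])
  then have "(\<Sum>i<n. - s) \<le> sum (r x) {..<n}" by (intro sum_mono) auto
  then have "real n * (- s) \<le> real n * m" unfolding sum_r_eq[OF x] m_def by simp
  then have "- s \<le> m" by (rule mult_left_le_imp_le) (use n(2) in simp)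
  then have t: "0 \<le> t" "t \<le> 1" using m s0 by (auto simp: t_def field_simps)
  have sm: "s = - ((1 - t) * m)" using m by (simp add: t_def)
  show "z \<in> focal_map ` focal_domain \<union> (\<lambda>y. X y - mean_radius (sgn y) *\<^sub>R sgn y) ` sphere 0 1"
  proof (cases "t = 0")
    case True
    then have "z = X x - mean_radius (sgn x) *\<^sub>R sgn x"
      using zs sm True by (simp add: sgn_eq_self[OF x] m_def)
    then show ?thesis using x by (intro UnI2 image_eqI[of _ _ x]) auto
  next
    case False
    then have t0: "t > 0" using t by simp
    have sg: "sgn (t *\<^sub>R x) = x" using sgn_scale_pos[OF t0, of x] sgn_eq_self[OF x] by simp
    have nt: "norm (t *\<^sub>R x) = t" using t0 x by simp
    have Xt: "X (t *\<^sub>R x) = X x" using inv_gauss_sgn[of u "t *\<^sub>R x"] unfolding sg by (rule sym)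
    have "z = focal_map (t *\<^sub>R x)"
      unfolding focal_map_def sg nt Xt m_def[symmetric] using zs sm by simp
    moreover have "t *\<^sub>R x \<in> focal_domain"
    proof -
      have "(1 - t) * m * (v \<bullet> v - (v \<bullet> x)\<^sup>2) \<le> A x v \<bullet> v" for v
      proof -
        have "A x v \<bullet> v + s * (tangent_proj x v \<bullet> tangent_proj x v) \<ge> 0"
          using so[OF tangent_proj_tangent[OF x]] A_inner_tangent[OF x, of v] by simp
        moreover have "tangent_proj x v \<bullet> tangent_proj x v = v \<bullet> v - (v \<bullet> x)\<^sup>2"
          using inner_self_1[OF x]
          by (simp add: tangent_proj_def inner_diff_left inner_diff_right inner_commute power2_eq_square)
        moreover have "(1 - t) * m = - s" using sm by simp
        ultimately show ?thesis by simp
      qed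
      then show ?thesis
        unfolding focal_domain_def mem_Collect_eq sg nt m_def using t0 t x by auto
    qed
    ultimately show ?thesis by blast
  qed
qed

lemma mean_radius_sigma_integrable: "k \<le> n \<Longrightarrow> sphere_integrable (\<lambda>x. mean_radius x * sigma k x)"
  by (rule sphere_integrable_mult_continuous[OF continuous_on_mean_radius sigma_integrable])

lemma heintze_karcher:
  "sphere_integral (\<lambda>x. u x * sigma n x) \<le> sphere_integral (\<lambda>x. mean_radius x * sigma n x)"
proof -
  let ?Z = "(\<lambda>y. X y - mean_radius (sgn y) *\<^sub>R sgn y) ` sphere 0 1"
  let ?J = "\<lambda>y. \<bar>Determinants.det (matrix (focal_map_deriv y))\<bar>"
  let ?g = "\<lambda>y. mean_radius (sgn y) * sigma n (sgn y)"
  have body: "body 0 \<in> lmeasurable" by (rule lmeasurable_compact[OF body_compact])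
  have der: "(focal_map has_derivative focal_map_deriv y) (at y within focal_domain)" if "y \<in> focal_domain" for y
    by (rule has_derivative_at_withinI[OF focal_map_has_derivative]) (use that in \<open>auto simp: focal_domain_def\<close>)
  have Z: "negligible ?Z"
  proof (rule negligible_differentiable_image_negligible[OF order_refl])
    show "negligible (sphere (0::real^'m::_) 1)" by (rule negligible_sphere)
    have "(\<lambda>y. X y - mean_radius (sgn y) *\<^sub>R sgn y) differentiable (at y)" if "y \<in> sphere 0 1" for y
    proof -
      have y: "y \<noteq> 0" using that by auto
      have "(\<lambda>y. mean_radius (sgn y)) differentiable (at y)"
        by (rule Ck_on_differentiable[OF Ck_on_compose_sgn[OF Ck_on_mean_radius] open_nonzero]) (use y in simp)
      moreover have "sgn differentiable (at y)"
        using has_derivative_sgn[OF y] unfolding differentiable_def by blast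
      ultimately show ?thesis
        by (intro differentiable_diff differentiable_scaleR inv_gauss_differentiable[OF u y])
    qed
    then show "(\<lambda>y. X y - mean_radius (sgn y) *\<^sub>R sgn y) differentiable_on sphere 0 1"
      unfolding differentiable_on_def using differentiable_at_withinI by blast
  qed
  have fd: "focal_domain \<subseteq> punctured_ball" by (auto simp: focal_domain_def)
  have g: "?g absolutely_integrable_on punctured_ball"
    using mean_radius_sigma_integrable[of n] by (simp add: sphere_integrable_def)
  have gD: "?g integrable_on focal_domain"
    by (rule set_lebesgue_integral_eq_integral(1)[OF set_integrable_subset[OF g focal_domain_sets fd]])
  have JD: "?J integrable_on focal_domain"
  proof (rule measurable_bounded_by_integrable_imp_integrable_real[OF _ gD _ focal_domain_sets])
    show "?J \<in> borel_measurable (lebesgue_on focal_domain)"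
      by (intro borel_measurable_abs borel_measurable_det_Jacobian[OF focal_domain_sets der])
  qed (use focal_map_jacobian in auto)
  have img: "focal_map ` focal_domain \<in> lmeasurable"
    by (rule measurable_differentiable_image[OF focal_domain_sets der JD])
  have "sphere_integral (\<lambda>x. u x * sigma n x) = measure lebesgue (body 0)"
    unfolding volume_body(2) sigma_n ..
  also have "\<dots> = measure lebesgue (body 0 - ?Z)"
    by (rule measure_negligible_symdiff[OF body, symmetric], rule negligible_subset[OF Z]) auto
  also have "\<dots> \<le> measure lebesgue (focal_map ` focal_domain)"
    by (rule measure_mono_fmeasurable[OF _ _ img])
      (use body_subset_focal_image body Z in \<open>auto intro!: sets.Diff dest: negligible_imp_sets fmeasurableD\<close>)
  also have "\<dots> \<le> integral focal_domain ?J"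
    by (rule measure_differentiable_image[OF focal_domain_sets der JD])
  also have "\<dots> \<le> integral focal_domain ?g"
    by (rule integral_le[OF JD gD focal_map_jacobian])
  also have "\<dots> \<le> integral punctured_ball ?g"
  proof (rule integral_subset_le[OF fd gD])
    show "?g integrable_on punctured_ball" using g by (rule set_lebesgue_integral_eq_integral(1))
    have "0 \<le> ?g y" if "y \<in> punctured_ball" for y
      using that mean_radius_pos[of "sgn y"] sigma_nonneg[of "sgn y" n] by (auto simp: norm_sgn intro!: mult_nonneg_nonneg)
    then show "\<forall>y\<in>punctured_ball. 0 \<le> ?g y" by blast
  qed
  finally show ?thesis by (simp add: sphere_integral_def)
qed

text \<open>The case \<open>k = n\<close> is the Heintze--Karcher inequality; for smaller \<open>k\<close> the Minkowski formula is used.\<close>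

lemma sigma_1_sigma_ge:
  assumes k: "k \<le> n"
  shows "real n * sphere_integral (\<lambda>x. u x * sigma k x) \<le> sphere_integral (\<lambda>x. sigma 1 x * sigma k x)"
proof -
  have eq: "sphere_integral (\<lambda>x. sigma 1 x * sigma k x) = real n * sphere_integral (\<lambda>x. mean_radius x * sigma k x)"
    unfolding sphere_integral_cmult[symmetric]
    by (rule sphere_integral_cong) (simp only: sigma_1 mult.assoc)
  show ?thesis
  proof (cases "k = n")
    case True
    then show ?thesis unfolding eq using heintze_karcher by (intro mult_left_mono) auto
  next
    case False
    then have kn: "k < n" using k by simp
    have int: "sphere_integrable (\<lambda>x. sigma 1 x * sigma k x)"
    proof (subst sphere_integrable_cong)
      show "sphere_integrable (\<lambda>x. real n * (mean_radius x * sigma k x))"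
        by (rule sphere_integrable_cmult[OF mean_radius_sigma_integrable[OF k]])
    qed (simp only: sigma_1 mult.assoc)
    have "(real n - real k) * (real n * sphere_integral (\<lambda>x. u x * sigma k x))
        = real n * (real k + 1) * sphere_integral (sigma (Suc k))"
      using minkowski_formula[OF kn] by (simp add: mult_ac)
    also have "\<dots> = sphere_integral (\<lambda>x. real n * (real k + 1) * sigma (Suc k) x)"
      by (rule sphere_integral_cmult[symmetric])
    also have "\<dots> \<le> sphere_integral (\<lambda>x. (real n - real k) * (sigma 1 x * sigma k x))"
    proof (rule sphere_integral_mono)
      show "sphere_integrable (\<lambda>x. real n * (real k + 1) * sigma (Suc k) x)"
        by (rule sphere_integrable_cmult[OF sigma_integrable]) (use kn in simp)
      show "sphere_integrable (\<lambda>x. (real n - real k) * (sigma 1 x * sigma k x))"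
        by (rule sphere_integrable_cmult[OF int])
      show "real n * (real k + 1) * sigma (Suc k) x \<le> (real n - real k) * (sigma 1 x * sigma k x)"
        if x: "norm x = 1" for x
        using newton_maclaurin[of "{..<n}" "r x" k] r_pos[OF x] esym_1[of "{..<n}" "r x"]
        by (auto simp: sigma_def less_imp_le)
    qed
    also have "\<dots> = (real n - real k) * sphere_integral (\<lambda>x. sigma 1 x * sigma k x)"
      by (rule sphere_integral_cmult)
    finally show ?thesis using kn by simp
  qed
qed

end

section \<open>Uniqueness for the curvature equation\<close>

lemma convex_frame_exists:
  fixes u :: "real^'m::{finite,wellorder} \<Rightarrow> real"
  assumes "convex_support u n"
  obtains e r where "convex_frame u n e r"
proof -
  interpret convex_support u n by (rule assms)
  have "\<forall>x. \<exists>F. norm x = 1 \<longrightarrow> orthonormal_frame n x (fst F) \<and> (\<forall>i<n. A x (fst F i) = snd F i *\<^sub>R fst F i)"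
  proof
    fix x :: "real^'m::_"
    show "\<exists>F. norm x = 1 \<longrightarrow> orthonormal_frame n x (fst F) \<and> (\<forall>i<n. A x (fst F i) = snd F i *\<^sub>R fst F i)"
    proof (cases "norm x = 1")
      case True
      obtain e r where "orthonormal_frame n x e" "\<And>i. i < n \<Longrightarrow> A x (e i) = r i *\<^sub>R e i"
        using orthonormal_frame_exists[OF True n(1) A_linear[OF True] radii_map_symmetric[OF u True] radii_map_normal[OF u True]]
        by blast
      then show ?thesis by (intro exI[of _ "(e, r)"]) simp
    qed simp
  qed
  from choice[OF this] obtain F where
    F: "\<And>x. norm x = 1 \<Longrightarrow> orthonormal_frame n x (fst (F x)) \<and> (\<forall>i<n. A x (fst (F x) i) = snd (F x) i *\<^sub>R fst (F x) i)"
    by blast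
  show thesis
    by (rule that[of "\<lambda>x. fst (F x)" "\<lambda>x. snd (F x)"]) (unfold_locales, use F in auto)
qed

lemma trace_tangent_proj:
  fixes x :: "'a::euclidean_space"
  assumes "norm x = 1" "DIM('a) = n + 1"
  shows "(\<Sum>b\<in>Basis. tangent_proj x b \<bullet> b) = real n"
proof -
  have "(\<Sum>b\<in>Basis. tangent_proj x b \<bullet> b) = (\<Sum>b\<in>Basis. 1 - (x \<bullet> b) * (x \<bullet> b))"
    by (intro sum.cong refl) (simp add: tangent_proj_def inner_diff_left inner_diff_right inner_commute inner_Basis)
  also have "\<dots> = real DIM('a) - x \<bullet> x"
    using euclidean_inner[of x x] by (simp add: sum_subtractf)
  finally show ?thesis using assms by (simp add: inner_self_1)
qed

text \<open>
  The trace is the Laplacian of \<open>g\<close> plus \<open>n * g\<close>, so this says that the integral of a Laplacian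
  vanishes.  It is the Minkowski formula with \<open>k = 0\<close> for the function \<open>g + C\<close>, which is positive and
  strictly convex for large \<open>C\<close>.
\<close>

lemma integral_trace_radii_map:
  fixes g :: "real^'m::{finite,wellorder} \<Rightarrow> real"
  assumes g: "smooth_radial g" and m: "CARD('m) = n + 1" and n: "n \<ge> 1"
  shows "sphere_integral (\<lambda>x. \<Sum>b\<in>Basis. radii_map g x b \<bullet> b) = real n * sphere_integral g"
proof -
  have gc: "continuous_on (sphere 0 1) g"
  proof (rule continuous_on_eq)
    have "Ck_on 0 (- {0}) (\<lambda>y. g (sgn y))" using g unfolding smooth_radial_def by blast
    from continuous_on_subset[OF Ck_on_continuous[OF this], of "sphere 0 1"]
    show "continuous_on (sphere 0 1) (\<lambda>y. g (sgn y))" by auto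
  qed (auto simp: sgn_eq_self)
  obtain G where G: "\<And>x. norm x = 1 \<Longrightarrow> \<bar>g x\<bar> \<le> G" using radial_bounded[OF gc] by blast
  obtain M where M: "M > 0" "\<And>x v. norm x = 1 \<Longrightarrow> norm (radii_map g x v) \<le> M * norm v"
    using radii_map_bounded[OF g] by blast
  define C where "C = M + \<bar>G\<bar> + 1"
  have C: "C > M" "C > G" using M(1) unfolding C_def by linarith+
  have "convex_support (\<lambda>x. g x + C) n"
  proof
    show "smooth_radial (\<lambda>x. g x + C)" by (rule smooth_radial_add_const[OF g])
    show "DIM(real^'m::_) = n + 1" "1 \<le> n" using m n by auto
    fix x v :: "real^'m::_" assume x: "norm x = 1"
    show "g x + C > 0" using G[OF x] C by linarith
    assume v: "v \<bullet> x = 0" "v \<noteq> 0"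
    have "\<bar>radii_map g x v \<bullet> v\<bar> \<le> norm (radii_map g x v) * norm v" by (rule Cauchy_Schwarz_ineq2)
    also have "\<dots> \<le> M * norm v * norm v" by (intro mult_right_mono M(2)[OF x]) auto
    also have "\<dots> < C * norm v * norm v" using C(1) v(2) by simp
    also have "\<dots> = C * (v \<bullet> v)" by (simp add: dot_square_norm power2_eq_square)
    finally show "radii_map (\<lambda>x. g x + C) x v \<bullet> v > 0"
      unfolding radii_map_add_const[OF g x] by (simp add: inner_add_left tangent_proj_orth[OF v(1)])
  qed
  then obtain e r where "convex_frame (\<lambda>x. g x + C) n e r" by (rule convex_frame_exists)
  then interpret h: convex_frame "\<lambda>x. g x + C" n e r .
  let ?T = "\<lambda>x. \<Sum>b\<in>Basis. radii_map g x b \<bullet> b"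
  have s0: "h.sigma 0 x = 1" for x by (simp add: h.sigma_def esym_0)
  have s1: "h.sigma 1 x = ?T x + real n * C" if x: "norm x = 1" for x
  proof -
    have "h.sigma 1 x = (\<Sum>b\<in>Basis. radii_map (\<lambda>x. g x + C) x b \<bullet> b)"
      using h.sigma_1[OF x] n by (simp add: h.mean_radius_def)
    also have "\<dots> = ?T x + C * (\<Sum>b\<in>Basis. tangent_proj x b \<bullet> b)"
      unfolding radii_map_add_const[OF g x] by (simp add: inner_add_left sum.distrib sum_distrib_left)
    also have "(\<Sum>b\<in>Basis. tangent_proj x b \<bullet> b) = real n"
      by (rule trace_tangent_proj[OF x]) (simp add: m)
    finally show ?thesis by simp
  qed
  have T: "sphere_integrable ?T"
  proof (rule sphere_integrable_continuous, rule continuous_on_sum)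
    fix b :: "real^'m::_" assume "b \<in> Basis"
    then show "continuous_on (sphere 0 1) (\<lambda>x. radii_map g x b \<bullet> b)"
      by (intro continuous_on_subset[OF Ck_on_continuous[OF Ck_on_radii_map[OF g, where k=0]]]) auto
  qed
  have "real n * sphere_integral (\<lambda>x. g x + C) = sphere_integral (h.sigma 1)"
    using h.minkowski_formula[of 0] n by (simp add: s0)
  also have "\<dots> = sphere_integral (\<lambda>x. ?T x + real n * C)" by (rule sphere_integral_cong[OF s1])
  also have "\<dots> = sphere_integral ?T + real n * sphere_integral (\<lambda>x :: real^'m::_. C)"
    unfolding sphere_integral_add[OF T sphere_integrable_const] sphere_integral_cmult ..
  finally show ?thesis
    unfolding sphere_integral_add[OF sphere_integrable_continuous[OF gc] sphere_integrable_const]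
    by (simp add: algebra_simps)
qed

context convex_frame
begin

lemma smooth_radial_powr: "smooth_radial (\<lambda>x. u x powr p)"
  unfolding smooth_radial_def
proof
  fix k
  show "Ck_on k (- {0}) (\<lambda>y. u (sgn y) powr p)"
  proof (rule Ck_on_powr_compose[OF open_nonzero])
    show "Ck_on k (- {0}) (\<lambda>y. u (sgn y))" using u unfolding smooth_radial_def by blast
    show "u (sgn y) > 0" if "y \<in> - {0}" for y using pos[of "sgn y"] that by (simp add: norm_sgn)
  qed
qed

lemma powr_has_derivative:
  assumes x: "norm x = 1"
  shows "((\<lambda>y. c * u (sgn y) powr a) has_derivative (\<lambda>v. c * a * u x powr (a - 1) * (sphere_grad u x \<bullet> v))) (at x)"
proof -
  have "((\<lambda>t. c * t powr a) has_derivative (\<lambda>h. (c * a * u (sgn x) powr (a - 1)) * h)) (at (u (sgn x)))"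
    using pos[OF x] by (auto intro!: derivative_eq_intros simp: powr_diff sgn_eq_self[OF x])
  from has_derivative_compose[OF u_sgn_has_derivative[OF u nonzero[OF x]] this]
  show ?thesis using x by (simp add: sgn_eq_self)
qed

lemma inv_gauss_powr:
  assumes y: "y \<noteq> 0"
  shows "inv_gauss (\<lambda>x. u x powr p) y
     = (p * u (sgn y) powr (p - 1)) *\<^sub>R X y + ((1 - p) * u (sgn y) powr p) *\<^sub>R sgn y"
proof -
  let ?x = "sgn y"
  have x: "norm ?x = 1" by (rule norm_sgn_1[OF y])
  have gr: "sphere_grad (\<lambda>x. u x powr p) ?x \<bullet> v = (p * u ?x powr (p - 1)) * (sphere_grad u ?x \<bullet> v)" for v
    unfolding sphere_grad_inner(1)[OF smooth_radial_powr x] sphere_deriv_def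
    using fun_cong[OF frechet_derivative_at[OF powr_has_derivative[OF x, of 1 p]], of v] by (simp only: mult_1 mult_1_left)
  have "sphere_grad (\<lambda>x. u x powr p) ?x = (p * u ?x powr (p - 1)) *\<^sub>R sphere_grad u ?x"
    by (rule euclidean_eqI) (simp only: gr inner_scaleR_left)
  moreover have "u ?x powr p = u ?x powr (p - 1) * u ?x"
    using pos[OF x] by (simp add: powr_diff)
  ultimately show ?thesis
    by (simp add: inv_gauss_def algebra_simps)
qed

text \<open>\<open>\<Delta>(u\<^sup>p) + n u\<^sup>p\<close> with \<open>\<Delta>u = sigma 1 - n u\<close>.\<close>

lemma trace_radii_map_powr:
  assumes x: "norm x = 1"
  shows "(\<Sum>b\<in>Basis. radii_map (\<lambda>x. u x powr p) x b \<bullet> b)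
     = p * u x powr (p - 1) * sigma 1 x + p * (p - 1) * (u x powr (p - 2) * (sphere_grad u x \<bullet> sphere_grad u x))
       + (1 - p) * real n * u x powr p"
proof -
  let ?g = "\<lambda>x. u x powr p" and ?G = "sphere_grad u x"
  have xn: "x \<noteq> 0" by (rule nonzero[OF x])
  let ?L = "\<lambda>v. (p * u x powr (p - 1)) *\<^sub>R A x v + (p * (p - 1) * u x powr (p - 1 - 1) * (?G \<bullet> v)) *\<^sub>R X x
      + (((1 - p) * u x powr p) *\<^sub>R tangent_proj x v + ((1 - p) * p * u x powr (p - 1) * (?G \<bullet> v)) *\<^sub>R sgn x)"
  have "((\<lambda>y. (p * u (sgn y) powr (p - 1)) *\<^sub>R X y + ((1 - p) * u (sgn y) powr p) *\<^sub>R sgn y) has_derivative ?L) (at x)"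
    using has_derivative_add[OF
        has_derivative_scaleR[OF powr_has_derivative[OF x, of p "p - 1"] inv_gauss_has_derivative_at[OF u xn]]
        has_derivative_scaleR[OF powr_has_derivative[OF x, of "1 - p" p] has_derivative_sgn_sphere]] x
    by (simp add: sgn_eq_self)
  then have "(inv_gauss ?g has_derivative ?L) (at x)"
    by (rule has_derivative_transform_within_open[OF _ open_nonzero]) (use xn inv_gauss_powr in auto)
  from fun_cong[OF frechet_derivative_at[OF this]]
  have A: "radii_map ?g x v = ?L v" for v by (simp add: radii_map_def)
  have GX: "X x \<bullet> e x i = ?G \<bullet> e x i" if "i < n" for i
    using frame_orth[OF x that] by (simp add: inv_gauss_def sgn_eq_self[OF x] inner_add_left inner_add_right inner_commute)
  have ei: "radii_map ?g x (e x i) \<bullet> e x i = p * u x powr (p - 1) * r x i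
      + p * (p - 1) * u x powr (p - 2) * ((?G \<bullet> e x i) * (?G \<bullet> e x i)) + (1 - p) * u x powr p" if i: "i < n" for i
  proof -
    have x0: "x \<bullet> e x i = 0" using frame_orth[OF x i] by (simp add: inner_commute)
    show ?thesis
      unfolding A radii[OF x i] tangent_proj_orth[OF frame_orth[OF x i]] sgn_eq_self[OF x]
        inner_add_left inner_scaleR_left frame_norm[OF x i] GX[OF i] x0 by simp
  qed
  have "?G \<bullet> ?G = (\<Sum>i<n. (?G \<bullet> e x i) * (?G \<bullet> e x i))"
    using frame_inner[OF x frame[OF x] n(1), of ?G ?G] sphere_grad_inner(2)[OF u x] by simp
  moreover have "(\<Sum>b\<in>Basis. radii_map ?g x b \<bullet> b) = (\<Sum>i<n. radii_map ?g x (e x i) \<bullet> e x i)"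
    using trace_frame[OF radii_map_linear[OF smooth_radial_powr xn] x frame[OF x] n(1)]
    by (simp add: radii_map_normal[OF smooth_radial_powr x])
  moreover have "sigma 1 x = (\<Sum>i<n. r x i)"
    using esym_1[of "{..<n}" "r x"] by (simp add: sigma_def)
  ultimately show ?thesis
    by (simp add: ei sum.distrib sum_distrib_left mult.assoc)
qed

lemma continuous_on_inv_gauss: "continuous_on (sphere 0 1) X"
proof (rule continuous_on_subset)
  show "continuous_on (- {0}) X"
    by (rule continuous_on_componentwise[THEN iffD2], rule ballI, rule Ck_on_continuous[OF Ck_on_inv_gauss[OF u]])
qed auto

lemma sphere_grad_eq_0:
  assumes p: "p > 1" and k: "k \<le> n" and eq: "\<And>x. norm x = 1 \<Longrightarrow> sigma k x = u x powr (p - 1)"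
    and x: "norm x = 1"
  shows "sphere_grad u x = 0"
proof -
  define Q where "Q x = u x powr (p - 2) * (sphere_grad u x \<bullet> sphere_grad u x)" for x
  have upowr: "continuous_on (sphere 0 1) (\<lambda>x. u x powr a)" for a
    using pos by (intro continuous_on_powr u_continuous_sphere continuous_on_const) force
  have "continuous_on (sphere 0 1) (\<lambda>x. X x - u x *\<^sub>R x)"
    by (intro continuous_on_diff continuous_on_inv_gauss continuous_on_scaleR u_continuous_sphere continuous_on_id)
  then have "continuous_on (sphere 0 1) (sphere_grad u)"
    by (rule continuous_on_eq) (auto simp: inv_gauss_def sgn_eq_self)
  then have Qc: "continuous_on (sphere 0 1) Q"
    unfolding Q_def by (intro continuous_on_mult upowr continuous_on_inner)
  have Q0: "Q x \<ge> 0" for x by (simp add: Q_def)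
  let ?S = "\<lambda>x. sigma 1 x * sigma k x"
  have Si: "sphere_integrable ?S"
  proof (subst sphere_integrable_cong)
    show "sphere_integrable (\<lambda>x. real n * (mean_radius x * sigma k x))"
      by (rule sphere_integrable_cmult[OF mean_radius_sigma_integrable[OF k]])
  qed (simp only: sigma_1 mult.assoc)
  have Qi: "sphere_integrable Q" by (rule sphere_integrable_continuous[OF Qc])
  have ui: "sphere_integrable (\<lambda>x. u x powr p)" by (rule sphere_integrable_continuous[OF upowr])
  have up: "u x powr p = u x * sigma k x" if "norm x = 1" for x
    using pos[OF that] eq[OF that] by (simp add: powr_diff)
  have "real n * sphere_integral (\<lambda>x. u x powr p)
      = sphere_integral (\<lambda>x. \<Sum>b\<in>Basis. radii_map (\<lambda>x. u x powr p) x b \<bullet> b)"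
    by (rule integral_trace_radii_map[OF smooth_radial_powr card_m n(2), symmetric])
  also have "\<dots> = sphere_integral (\<lambda>x. (p * ?S x + p * (p - 1) * Q x) + (1 - p) * real n * u x powr p)"
    by (rule sphere_integral_cong) (simp only: trace_radii_map_powr eq Q_def mult_ac)
  also have "\<dots> = p * sphere_integral ?S + p * (p - 1) * sphere_integral Q
      + (1 - p) * real n * sphere_integral (\<lambda>x. u x powr p)"
    by (simp only: sphere_integral_add[OF sphere_integrable_add[OF sphere_integrable_cmult[OF Si] sphere_integrable_cmult[OF Qi]]
          sphere_integrable_cmult[OF ui]] sphere_integral_add[OF sphere_integrable_cmult[OF Si] sphere_integrable_cmult[OF Qi]]
        sphere_integral_cmult)
  finally have "p * (p - 1) * sphere_integral Q = p * (real n * sphere_integral (\<lambda>x. u x powr p) - sphere_integral ?S)"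
    by (simp add: algebra_simps)
  also have "sphere_integral (\<lambda>x. u x powr p) = sphere_integral (\<lambda>x. u x * sigma k x)"
    by (rule sphere_integral_cong[OF up])
  also have "p * (real n * sphere_integral (\<lambda>x. u x * sigma k x) - sphere_integral ?S) \<le> 0"
    using sigma_1_sigma_ge[OF k] p by (simp add: mult_le_0_iff)
  finally have "sphere_integral Q \<le> 0" using p by (simp add: mult_le_0_iff)
  from sphere_integral_nonneg_eq_0[OF Qc Q0 this x] show ?thesis
    using pos[OF x] by (simp add: Q_def)
qed

end

lemma constant_on_sphere_if_grad_0:
  fixes u :: "'a::euclidean_space \<Rightarrow> real"
  assumes u: "smooth_radial u" and grad: "\<And>x. norm x = 1 \<Longrightarrow> sphere_grad u x = 0" and dim: "DIM('a) \<ge> 2"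
  shows "u constant_on sphere 0 1"
proof -
  have "((\<lambda>y. u (sgn y)) has_derivative (\<lambda>v. 0)) (at y)" if "y \<in> - {0}" for y
    using u_sgn_has_derivative[OF u, of y] that by (simp add: grad norm_sgn)
  note d = this
  have "u x = u y" if xy: "norm x = 1" "norm y = 1" for x y
  proof -
    have "u (sgn x) = u (sgn y)"
      by (rule has_derivative_zero_unique_connected[OF open_nonzero connected_punctured_universe[OF dim] d])
        (use xy in auto)
    then show ?thesis using xy by (simp add: sgn_eq_self)
  qed
  then show ?thesis unfolding constant_on_def by (metis mem_sphere_0)
qed

section \<open>From the matrix formulation to support functions\<close>

lemma smooth_on_sphere_imp_radial:
  assumes "smooth_on_sphere u"
  shows "smooth_radial u"
  unfolding smooth_radial_def
proof (intro allI Ck_on_local[OF open_nonzero])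
  fix k and y :: 'a assume y: "y \<in> - {0}"
  then have "sgn y \<in> sphere 0 1" by (simp add: norm_sgn)
  from assms[unfolded smooth_on_sphere_def, THEN bspec, OF this]
  obtain U F where U: "open U" "sgn y \<in> U" and F': "\<forall>k. Ck_on k U F" "\<forall>z\<in>U \<inter> sphere 0 1. F z = u z"
    by (elim exE conjE)
  note F = F'(1)[THEN spec] F'(2)[THEN bspec]
  define V where "V = - {0} \<inter> sgn -` U"
  have V: "open V"
    unfolding V_def by (rule continuous_open_preimage[OF sgn_continuous open_nonzero U(1)])
  have "Ck_on k V (\<lambda>z. F (sgn z))"
    by (rule Ck_on_compose[OF V U(1) Ck_on_subset[OF Ck_on_sgn] _ F(1)]) (auto simp: V_def)
  moreover have "Ck_on k V (\<lambda>z. F (sgn z)) \<longleftrightarrow> Ck_on k V (\<lambda>z. u (sgn z))"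
    by (rule Ck_on_cong[OF V]) (auto simp: V_def F(2) norm_sgn)
  ultimately show "\<exists>V. open V \<and> y \<in> V \<and> Ck_on k V (\<lambda>z. u (sgn z))"
    using V y U(2) by (intro exI[of _ V]) (auto simp: V_def)
qed

lemma hessian_plus_mat_eigenframe:
  assumes u: "smooth_radial u" and x: "norm x = 1" and e: "orthonormal_frame n x e"
    and r: "\<And>i. i < n \<Longrightarrow> radii_map u x (e i) = r i *\<^sub>R e i"
  shows "hessian_plus_mat n u x e = Matrix.mat n n (\<lambda>(i, j). if i = j then r i else 0)"
  unfolding hessian_plus_mat_def
proof (rule cong_mat[OF refl refl])
  fix i j assume "i < n" "j < n"
  then show "(case (i, j) of (i, j) \<Rightarrow> sphere_hessian u x (e i) (e j) + u x * (e i \<bullet> e j)) =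
      (case (i, j) of (i, j) \<Rightarrow> if i = j then r i else 0)"
    using radii_map_hessian[OF u x, of "e i" "e j"] e r by (cases "i = j") (simp_all add: orthonormal_frame_def)
qed

lemma positive_definite_diagonal:
  assumes "positive_definite (Matrix.mat n n (\<lambda>(i, j). if i = j then r i else 0))" and i: "i < n"
  shows "r i > 0"
proof -
  let ?D = "Matrix.mat n n (\<lambda>(i, j). if i = j then r i else 0)"
  let ?e = "unit_vec n i :: real Matrix.vec"
  have D: "?D \<in> carrier_mat n n" by simp
  have e: "?e \<in> carrier_vec n" by simp
  have "scalar_prod ?e (?D *\<^sub>v ?e) = (?D *\<^sub>v ?e) $ i"
    by (rule scalar_prod_left_unit[OF mult_mat_vec_carrier[OF D e] i])
  also have "\<dots> = scalar_prod (Matrix.row ?D i) ?e"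
    by (rule index_mult_mat_vec) (use i in simp)
  also have "\<dots> = Matrix.row ?D i $ i"
    by (rule scalar_prod_right_unit[OF i])
  also have "\<dots> = r i" using i by simp
  finally have eq: "scalar_prod ?e (?D *\<^sub>v ?e) = r i" .
  have "?e \<noteq> 0\<^sub>v n" using i by simp
  with assms(1)[unfolded positive_definite_def, THEN bspec, of ?e] e
  have "scalar_prod ?e (?D *\<^sub>v ?e) > 0" by simp
  then show ?thesis unfolding eq .
qed

lemma strictly_convex_imp_convex_support:
  fixes u :: "'a::euclidean_space \<Rightarrow> real"
  assumes u: "smooth_radial u" and pos: "\<And>x. norm x = 1 \<Longrightarrow> u x > 0"
    and conv: "strictly_convex_on_sphere n u" and n: "DIM('a) = n + 1" "n \<ge> 1"
  shows "convex_support u n"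
proof
  fix x v :: 'a assume x: "norm x = 1" and v: "v \<bullet> x = 0" "v \<noteq> 0"
  have xn: "x \<noteq> 0" using x by auto
  note lin = radii_map_linear[OF u xn] and sym = radii_map_symmetric[OF u x]
  obtain e r where e: "orthonormal_frame n x e" and r: "\<And>i. i < n \<Longrightarrow> radii_map u x (e i) = r i *\<^sub>R e i"
    using orthonormal_frame_exists[OF x n(1) lin sym radii_map_normal[OF u x]] by blast
  have "positive_definite (hessian_plus_mat n u x e)"
    using conv e x unfolding strictly_convex_on_sphere_def by auto
  then have pd: "positive_definite (Matrix.mat n n (\<lambda>(i, j). if i = j then r i else 0))"
    by (subst (asm) hessian_plus_mat_eigenframe[OF u x e r])
  have rpos: "r i > 0" if "i < n" for i
    by (rule positive_definite_diagonal[OF pd that])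
  have "radii_map u x v \<bullet> e i = r i * (v \<bullet> e i)" if "i < n" for i
    using sym[of v "e i"] r[OF that] by simp
  then have eq: "radii_map u x v \<bullet> v = (\<Sum>i<n. r i * (v \<bullet> e i)\<^sup>2)"
    using frame_inner[OF x e n(1), of "radii_map u x v" v] v(1) by (simp add: power2_eq_square mult.assoc)
  have vv: "v \<bullet> v = (\<Sum>i<n. (v \<bullet> e i) * (v \<bullet> e i))"
    using frame_inner[OF x e n(1), of v v] v(1) by simp
  have "\<not> (\<forall>i<n. v \<bullet> e i = 0)"
  proof
    assume "\<forall>i<n. v \<bullet> e i = 0"
    then have "v \<bullet> v = 0" unfolding vv by (intro sum.neutral) simp
    then show False using v(2) by simp
  qed
  then obtain i where i: "i < n" "v \<bullet> e i \<noteq> 0" by blast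
  have "0 < r i * (v \<bullet> e i)\<^sup>2" using rpos[OF i(1)] i(2) by simp
  also have "\<dots> \<le> (\<Sum>i<n. r i * (v \<bullet> e i)\<^sup>2)"
    by (rule member_le_sum) (use i rpos in \<open>auto simp: less_imp_le\<close>)
  finally show "radii_map u x v \<bullet> v > 0" unfolding eq .
qed (use assms in auto)

lemma curvature_equation_vec:
  fixes u :: "real^'m::{finite,wellorder} \<Rightarrow> real"
  assumes m: "CARD('m) = n + 1" and n: "n \<ge> 2" and k: "k \<le> n" and p: "p > 1"
    and pos: "\<forall>x\<in>sphere 0 1. u x > 0"
    and u: "smooth_on_sphere u" and conv: "strictly_convex_on_sphere n u"
    and eq: "\<forall>x\<in>sphere 0 1. \<forall>e. orthonormal_frame n x e \<longrightarrow>
           sigma_mat k (hessian_plus_mat n u x e) = u x powr (p - 1)"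
  shows "u constant_on sphere 0 1"
proof -
  have sm: "smooth_radial u" by (rule smooth_on_sphere_imp_radial[OF u])
  have "convex_support u n"
    by (rule strictly_convex_imp_convex_support[OF sm _ conv]) (use pos m n in auto)
  then obtain e r where "convex_frame u n e r" by (rule convex_frame_exists)
  then interpret convex_frame u n e r .
  have "sigma k x = u x powr (p - 1)" if x: "norm x = 1" for x
  proof -
    have "hessian_plus_mat n u x (e x) = Matrix.mat n n (\<lambda>(i, j). if i = j then r x i else 0)"
      by (rule hessian_plus_mat_eigenframe[OF sm x frame[OF x] radii[OF x]])
    from sigma_mat_diagonal[OF this, of k] show ?thesis
      using eq frame[OF x] x by (simp add: sigma_def)
  qed
  then have "sphere_grad u x = 0" if "norm x = 1" for x
    by (rule sphere_grad_eq_0[OF p k _ that])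
  then show ?thesis
    by (rule constant_on_sphere_if_grad_0[OF sm]) (use m n in auto)
qed

section \<open>Passage to an arbitrary Euclidean space\<close>

text \<open>
  An index type with \<open>DIM('a)\<close> elements, ordered like the natural numbers, so that \<open>real ^ 'a dim_index\<close>
  is isometric to \<open>'a\<close>.
\<close>

typedef (overloaded) ('a::euclidean_space) dim_index = "{..<DIM('a)}"
  by (rule exI[of _ 0]) simp

instantiation dim_index :: (euclidean_space) wellorder
begin

definition less_eq_dim_index :: "'a dim_index \<Rightarrow> 'a dim_index \<Rightarrow> bool" where
  "less_eq_dim_index i j \<longleftrightarrow> Rep_dim_index i \<le> Rep_dim_index j"

definition less_dim_index :: "'a dim_index \<Rightarrow> 'a dim_index \<Rightarrow> bool" where
  "less_dim_index i j \<longleftrightarrow> Rep_dim_index i < Rep_dim_index j"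

instance
proof
  fix P and a :: "'a dim_index"
  assume step: "\<And>x :: 'a dim_index. (\<And>y. y < x \<Longrightarrow> P y) \<Longrightarrow> P x"
  show "P a"
  proof (induction a rule: measure_induct_rule[of Rep_dim_index])
    case (less x)
    show ?case by (rule step, rule less.IH) (simp only: less_dim_index_def)
  qed
qed (auto simp: less_eq_dim_index_def less_dim_index_def Rep_dim_index_inject)

end

lemma dim_index_UNIV: "(UNIV :: 'a::euclidean_space dim_index set) = Abs_dim_index ` {..<DIM('a)}"
  by (rule type_definition.Abs_image[OF type_definition_dim_index, symmetric])

instance dim_index :: (euclidean_space) finite
  by standard (simp add: dim_index_UNIV)

lemma card_dim_index: "CARD('a::euclidean_space dim_index) = DIM('a)"
  using type_definition.card[OF type_definition_dim_index] by simp

text \<open>A linear isometry onto another Euclidean space, with its inverse.\<close>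

locale sphere_isometry =
  fixes f :: "'a::euclidean_space \<Rightarrow> 'b::euclidean_space" and g :: "'b \<Rightarrow> 'a"
  assumes f: "linear f" and g: "linear g" and norm_f: "\<And>x. norm (f x) = norm x"
    and gf: "\<And>x. g (f x) = x" and fg: "\<And>y. f (g y) = y"
begin

lemma inner_f: "f x \<bullet> f y = x \<bullet> y"
  by (simp add: dot_norm norm_f flip: linear_add[OF f])

lemma inner_fg: "f x \<bullet> y = x \<bullet> g y"
  using inner_f[of x "g y"] by (simp add: fg)

lemma inner_gf: "g y \<bullet> x = y \<bullet> f x"
  by (subst inner_commute, subst inner_fg[symmetric], rule inner_commute)

lemma sgn_f: "sgn (f y) = f (sgn y)"
  by (simp add: sgn_div_norm norm_f linear_cmul[OF f])

lemma f_nonzero: "x \<noteq> 0 \<Longrightarrow> f x \<noteq> 0"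
  using norm_f[of x] by auto

lemma f_has_derivative: "(f has_derivative f) (at x)"
  by (rule linear_imp_has_derivative[OF f])

lemma smooth_on_sphere_compose:
  assumes u: "smooth_on_sphere u"
  shows "smooth_on_sphere (\<lambda>x. u (f x))"
  unfolding smooth_on_sphere_def
proof
  fix x :: 'a assume "x \<in> sphere 0 1"
  then have "f x \<in> sphere 0 1" by (simp add: norm_f)
  from u[unfolded smooth_on_sphere_def, THEN bspec, OF this]
  obtain U F where U: "open U" "f x \<in> U" and F: "\<forall>k. Ck_on k U F" "\<forall>z\<in>U \<inter> sphere 0 1. F z = u z"
    by (elim exE conjE)
  have V: "open (f -` U)"
    using U(1) linear_continuous_on[of f UNIV] f by (simp add: continuous_on_open_vimage linear_conv_bounded_linear)
  have "Ck_on k (f -` U) (\<lambda>y. F (f y))" for k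
    by (rule Ck_on_compose[OF V U(1) _ _ F(1)[THEN spec]]) (simp_all add: inner_fg Ck_on_inner_const)
  moreover have "\<forall>y\<in>f -` U \<inter> sphere 0 1. F (f y) = u (f y)"
    using F(2) by (simp add: norm_f)
  ultimately show "\<exists>U F. open U \<and> x \<in> U \<and> (\<forall>k. Ck_on k U F) \<and> (\<forall>y\<in>U \<inter> sphere 0 1. F y = u (f y))"
    using V U(2) by (intro exI[of _ "f -` U"] exI[of _ "\<lambda>y. F (f y)"]) simp
qed

lemma inv_gauss_compose:
  assumes u: "smooth_radial u" and v: "smooth_radial (\<lambda>x. u (f x))" and y: "y \<noteq> 0"
  shows "inv_gauss (\<lambda>x. u (f x)) y = g (inv_gauss u (f y))"
proof -
  let ?x = "sgn y"
  have x: "norm ?x = 1" by (rule norm_sgn_1[OF y])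
  have fx: "norm (f ?x) = 1" by (simp add: norm_f x)
  have fx0: "f ?x \<noteq> 0" using fx by auto
  have "((\<lambda>y. u (sgn (f y))) has_derivative (\<lambda>w. (1 / norm (f ?x)) * (sphere_grad u (sgn (f ?x)) \<bullet> f w))) (at ?x)"
    by (rule has_derivative_compose[OF f_has_derivative u_sgn_has_derivative[OF u fx0]])
  then have "((\<lambda>y. u (f (sgn y))) has_derivative (\<lambda>w. sphere_grad u (f ?x) \<bullet> f w)) (at ?x)"
    by (simp add: sgn_f sgn_sgn' norm_f x)
  note eq = frechet_derivative_at[OF this]
  have "sphere_grad (\<lambda>x. u (f x)) ?x \<bullet> w = g (sphere_grad u (f ?x)) \<bullet> w" for w
    unfolding inner_gf sphere_grad_inner(1)[OF v x] sphere_deriv_def by (rule fun_cong[OF eq, symmetric])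
  then have "sphere_grad (\<lambda>x. u (f x)) ?x = g (sphere_grad u (f ?x))"
    by (rule euclidean_eqI)
  then show ?thesis
    by (simp add: inv_gauss_def sgn_f linear_add[OF g] linear_cmul[OF g] gf)
qed

lemma radii_map_compose:
  assumes u: "smooth_radial u" and v: "smooth_radial (\<lambda>x. u (f x))" and x: "x \<noteq> 0"
  shows "radii_map (\<lambda>x. u (f x)) x w = g (radii_map u (f x) (f w))"
proof -
  have "((\<lambda>y. g (inv_gauss u (f y))) has_derivative (\<lambda>w. g (radii_map u (f x) (f w)))) (at x)"
    by (rule has_derivative_compose[OF has_derivative_compose[OF f_has_derivative
          inv_gauss_has_derivative_at[OF u f_nonzero[OF x]]] linear_imp_has_derivative[OF g]])
  then have "(inv_gauss (\<lambda>x. u (f x)) has_derivative (\<lambda>w. g (radii_map u (f x) (f w)))) (at x)"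
    by (rule has_derivative_transform_within_open[OF _ open_nonzero]) (use x inv_gauss_compose[OF u v] in auto)
  from fun_cong[OF frechet_derivative_at[OF this], of w] show ?thesis by (simp add: radii_map_def)
qed

lemma orthonormal_frame_compose:
  "orthonormal_frame n x e \<Longrightarrow> orthonormal_frame n (f x) (\<lambda>i. f (e i))"
  by (simp add: orthonormal_frame_def inner_f)

lemma hessian_plus_mat_compose:
  assumes u: "smooth_radial u" and v: "smooth_radial (\<lambda>x. u (f x))" and x: "norm x = 1"
    and e: "orthonormal_frame n x e"
  shows "hessian_plus_mat n (\<lambda>x. u (f x)) x e = hessian_plus_mat n u (f x) (\<lambda>i. f (e i))"
  unfolding hessian_plus_mat_def
proof (rule cong_mat[OF refl refl])
  have xn: "x \<noteq> 0" using x by auto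
  have fx: "norm (f x) = 1" by (simp add: norm_f x)
  fix i j assume ij: "i < n" "j < n"
  have e0: "e i \<bullet> x = 0" "e j \<bullet> x = 0" using e ij by (auto simp: orthonormal_frame_def)
  have "sphere_hessian (\<lambda>x. u (f x)) x (e i) (e j) + u (f x) * (e i \<bullet> e j) = radii_map (\<lambda>x. u (f x)) x (e i) \<bullet> e j"
    by (rule radii_map_hessian[OF v x e0, symmetric])
  also have "\<dots> = radii_map u (f x) (f (e i)) \<bullet> f (e j)"
    unfolding radii_map_compose[OF u v xn] by (rule inner_gf)
  also have "\<dots> = sphere_hessian u (f x) (f (e i)) (f (e j)) + u (f x) * (f (e i) \<bullet> f (e j))"
    by (rule radii_map_hessian[OF u fx]) (simp_all add: inner_f e0)
  finally show "(case (i, j) of (i, j) \<Rightarrow> sphere_hessian (\<lambda>x. u (f x)) x (e i) (e j) + u (f x) * (e i \<bullet> e j)) =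
      (case (i, j) of (i, j) \<Rightarrow> sphere_hessian u (f x) (f (e i)) (f (e j)) + u (f x) * (f (e i) \<bullet> f (e j)))"
    by simp
qed

end

theorem corollary1p6:
  fixes u :: "'a::euclidean_space \<Rightarrow> real" and n k :: nat and p :: real
  assumes "DIM('a) = n + 1" and "n \<ge> 2"
    and "1 \<le> k" and "k \<le> n"
    and "p > 1"
    and "\<forall>x\<in>sphere 0 1. u x > 0"
    and "smooth_on_sphere u"
    and "strictly_convex_on_sphere n u"
    and "\<forall>x\<in>sphere 0 1. \<forall>e. orthonormal_frame n x e \<longrightarrow>
           sigma_mat k (hessian_plus_mat n u x e) = u x powr (p - 1)"
  shows "u constant_on sphere 0 1"
proof -
  have "DIM(real ^ 'a dim_index) = DIM('a)" by (simp add: card_dim_index)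
  from isomorphisms_UNIV_UNIV[OF this] obtain f :: "real ^ 'a dim_index \<Rightarrow> 'a" and g
    where "sphere_isometry f g"
    unfolding sphere_isometry_def by metis
  then interpret sphere_isometry f g .
  let ?v = "\<lambda>x. u (f x)"
  have sv: "smooth_on_sphere ?v" by (rule smooth_on_sphere_compose[OF assms(7)])
  note rad = smooth_on_sphere_imp_radial[OF assms(7)] smooth_on_sphere_imp_radial[OF sv]
  have fx: "f x \<in> sphere 0 1" if "x \<in> sphere 0 1" for x using that by (simp add: norm_f)
  have mat: "hessian_plus_mat n ?v x e = hessian_plus_mat n u (f x) (\<lambda>i. f (e i))"
    if "x \<in> sphere 0 1" "orthonormal_frame n x e" for x e
    by (rule hessian_plus_mat_compose[OF rad _ that(2)]) (use that(1) in simp)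
  have "?v constant_on sphere 0 1"
  proof (rule curvature_equation_vec[OF _ assms(2,4,5) _ sv])
    show "CARD('a dim_index) = n + 1" by (simp add: card_dim_index assms(1))
    show "\<forall>x\<in>sphere 0 1. ?v x > 0" using assms(6) fx by blast
    show "strictly_convex_on_sphere n ?v"
      unfolding strictly_convex_on_sphere_def
    proof (intro ballI allI impI)
      fix x e assume x: "x \<in> sphere (0 :: real ^ 'a dim_index) 1" and e: "orthonormal_frame n x e"
      show "positive_definite (hessian_plus_mat n ?v x e)"
        unfolding mat[OF x e]
        using assms(8)[unfolded strictly_convex_on_sphere_def, THEN bspec, OF fx[OF x]]
          orthonormal_frame_compose[OF e] by blast
    qed
    show "\<forall>x\<in>sphere 0 1. \<forall>e. orthonormal_frame n x e \<longrightarrow>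
        sigma_mat k (hessian_plus_mat n ?v x e) = ?v x powr (p - 1)"
    proof (intro ballI allI impI)
      fix x e assume x: "x \<in> sphere (0 :: real ^ 'a dim_index) 1" and e: "orthonormal_frame n x e"
      show "sigma_mat k (hessian_plus_mat n ?v x e) = ?v x powr (p - 1)"
        unfolding mat[OF x e]
        using assms(9)[THEN bspec, OF fx[OF x]] orthonormal_frame_compose[OF e] by blast
    qed
  qed
  then obtain c where c: "\<And>x. x \<in> sphere 0 1 \<Longrightarrow> u (f x) = c"
    unfolding constant_on_def by blast
  have "u y = c" if "y \<in> sphere 0 1" for y
    using c[of "g y"] that norm_f[of "g y"] by (simp add: fg)
  then show ?thesis unfolding constant_on_def by blast
qed

end
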